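(* A finitely generated malnormal subgroup $G_0$ of a locally quasiconvex LERF negatively curved group $G$ is strongly separable in $G$.
   Context: Groups. The profinite topology $\mathrm{PT}(G)$ on a group $G$ is the topology in which the finite index subgroups form a base of open neighborhoods of the identity. $G$ is LERF if every finitely generated subgroup of $G$ is closed in $\mathrm{PT}(G)$. Only finitely generated negatively curved groups are considered: $G$ is negatively curved (word-hyperbolic) if for some $\delta$ any side of any geodesic triangle in its Cayley graph lies in the $\delta$-neighborhood of the union of the two other sides. $G$ is locally quasiconvex if all its finitely generated subgroups are quasiconvex (a subgroup is quasiconvex if for some $K$ all geodesics in the Cayley graph with endpoints in the subgroup lie in its $K$-neighborhood). $G_0$ is malnormal in $G$ if $G_0\cap gG_0g^{-1}$ is trivial for any $g\in G$, $g\notin G_0$. Graphs. For a set $X$, $X^*=\{x,x^{-1}\mid x\in X\}$. Graphs are oriented, each edge $e$ has an inverse $\bar e$; a labeling by $X^*$ assigns $\mathrm{Lab}(e)\in X^*$ with $\mathrm{Lab}(\bar e)=\mathrm{Lab}(e)^{-1}$; the label of a path is the product of the labels of its edges. If $G$ is generated by $X$ and $S\le G$, the relative Cayley graph $\mathrm{Cayley}(G,S)$ has as vertices the right cosets $Sg$ and for each $Sg$ and $x\in X^*$ an edge from $Sg$ to $Sgx$ labeled $x$. Relative Cayley graphs of $G$ are called covers of $G$. For a labeled graph $\Gamma$ and vertex $v$, $\mathrm{Lab}(\Gamma,v)$ is the subgroup of $G$ of all labels of loops in $\Gamma$ beginning at $v$. Embeddings of graphs preserve labels (and base vertices). The subgraphs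 considered below are connected. If $(\Delta,u)$ is a subgraph of a cover of $G$ with base vertex $u$, it embeds in $\mathrm{Cayley}(G,\mathrm{Lab}(\Delta,u))$ with $u$ mapped to the vertex $\mathrm{Lab}(\Delta,u)\cdot 1$; this based relative Cayley graph is denoted $(\tilde\Delta,u)$, and $\Delta$ is identified with its image in $\tilde\Delta$. For $X_1\subseteq X$, the $X_1^*$-component of a vertex $w$ in a graph is the maximal connected subgraph containing $w$ all of whose edges are labeled in $X_1^*$ (the single vertex $w$ if there are no such edges at $w$). A graph is $X_1^*$-saturated at $v$ if for every $s\in X_1^*$ an edge labeled $s$ begins at $v$. Strong separability. Let $G_0$ be a finitely generated subgroup of $G$; choose generating sets $X_1$ of $G_0$ and $X$ of $G$ such that $X_1$ is a finite subset of $X$. A subgraph $\Gamma'$ of a cover $\tilde\Gamma$ has properties $4'$, $5'$, $7'$ in $\tilde\Gamma$ if: ($4'$) for any vertex $w$ of $\Gamma'$ and any $g\in\mathrm{Lab}(\tilde\Gamma,w)\cap G_0$ there is a loop beginning at $w$ in the $X_1^*$-component of $w$ in $\Gamma'$ with label equal to $g$; ($5'$) any two vertices of $\Gamma'$ are joined by a path in $\tilde\Gamma$ labeled by an element of $G_0$ if and only if they belong to the same $X_1^*$-component of $\Gamma'$; ($7'$) $\Gamma'$ is $X_1^*$-saturated at any vertex $v$ such that $\mathrm{Lab}(\tilde\Gamma,v)\cap G_0$ has finite index in $G_0$. $G_0$ is strongly separable in $G$ if for any finitely generated subgroups $S_1,S_2$ of $G$ such that $S_1\cap G_0$ and $S_2\cap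 G_0$ are equal and have infinite index in $G_0$, and for any finite subgraphs $(\Gamma_1,v_1)$, $(\Gamma_2,v_2)$ of covers of $G$ with $\mathrm{Lab}(\Gamma_i,v_i)=S_i$, there exist, for $i=1,2$, finite subgraphs $\Gamma'_i$ of $\tilde\Gamma_i$ which contain $\Gamma_i$ and have properties $4'$, $5'$, $7'$ in $\tilde\Gamma_i$, and embeddings $(\Gamma'_i,v_i)\to(\Delta_i,v_i)$ such that: (a) $\Delta_i$ is a finite subgraph of a cover of $G$ such that the $X_1^*$-component of $v_i$ in $\Delta_i$ is a cover of $G_0$ (with respect to $X_1$); and if an edge $e$ of $\Delta_i$ does not belong to $\Gamma'_i$, then $e$ belongs to the $X_1^*$-component of $v_i$ in $\Delta_i$; (b) $\mathrm{Lab}(\Delta_1,v_1)\cap G_0=\mathrm{Lab}(\Delta_2,v_2)\cap G_0$; (c) if a vertex $u_i$ of $\Gamma'_i$ does not belong to the $X_1^*$-component of $v_i$ in $\tilde\Gamma_i$, then $\mathrm{Lab}(\tilde\Gamma_i,u_i)\cap G_0=\mathrm{Lab}(\tilde\Delta_i,u_i)\cap G_0$; (d) a pair of vertices in the image of $\Gamma'_i$ belongs to the same $X_1^*$-component in $\tilde\Delta_i$ if and only if it belongs to the same $X_1^*$-component in $\tilde\Gamma_i$. *)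

theory Defs
  imports
    "HOL-Analysis.Abstract_Topology"
    "HOL-Algebra.Generated_Groups"
    "Graph_Theory.Digraph_Component"
begin

section \<open>Subgroups and the profinite topology\<close>

definition fg_subgroup :: "('a, 'm) monoid_scheme \<Rightarrow> 'a set \<Rightarrow> bool" where
  "fg_subgroup G H \<longleftrightarrow> subgroup H G \<and> (\<exists>Y. finite Y \<and> Y \<subseteq> H \<and> generate G Y = H)"

definition finite_index :: "('a, 'm) monoid_scheme \<Rightarrow> 'a set \<Rightarrow> bool" where
  "finite_index G H \<longleftrightarrow> subgroup H G \<and> finite (rcosets\<^bsub>G\<^esub> H)"

definition profinite_topology :: "('a, 'm) monoid_scheme \<Rightarrow> 'a topology" where
  "profinite_topology G =
     topology_generated_by {g <#\<^bsub>G\<^esub> N | g N. g \<in> carrier G \<and> finite_index G N}"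

definition LERF :: "('a, 'm) monoid_scheme \<Rightarrow> bool" where
  "LERF G \<longleftrightarrow> (\<forall>H. fg_subgroup G H \<longrightarrow> closedin (profinite_topology G) H)"

definition malnormal :: "('a, 'm) monoid_scheme \<Rightarrow> 'a set \<Rightarrow> bool" where
  "malnormal G G0 \<longleftrightarrow>
     (\<forall>g \<in> carrier G - G0. G0 \<inter> ((g <#\<^bsub>G\<^esub> G0) #>\<^bsub>G\<^esub> inv\<^bsub>G\<^esub> g) = {\<one>\<^bsub>G\<^esub>})"

section \<open>Labelled graphs and relative Cayley graphs\<close>

definition sym_gens :: "('a, 'm) monoid_scheme \<Rightarrow> 'a set \<Rightarrow> 'a set" where
  "sym_gens G X = X \<union> m_inv G ` X"

text \<open>
  An edge is a triple (initial vertex, label, terminal vertex), so that it determines its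
  endpoints and its label. The inverse of the edge \<open>(v, x, w)\<close> is \<open>(w, inv x, v)\<close>.
  In a relative Cayley graph an edge is determined by its initial vertex and its label,
  so no parallel edges are lost.
\<close>

type_synonym ('v, 'a) lgraph = "('v, 'v \<times> 'a \<times> 'v) pre_digraph"

definition mk_lgraph :: "'v set \<Rightarrow> ('v \<times> 'a \<times> 'v) set \<Rightarrow> ('v, 'a) lgraph" where
  "mk_lgraph V E = \<lparr>verts = V, arcs = E, tail = fst, head = snd \<circ> snd\<rparr>"

definition lab :: "'v \<times> 'a \<times> 'v \<Rightarrow> 'a" where
  "lab e = fst (snd e)"

definition path_label :: "('a, 'm) monoid_scheme \<Rightarrow> ('v \<times> 'a \<times> 'v) list \<Rightarrow> 'a" where
  "path_label G p = foldr (\<lambda>e g. lab e \<otimes>\<^bsub>G\<^esub> g) p \<one>\<^bsub>G\<^esub>"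

definition Cayley :: "('a, 'm) monoid_scheme \<Rightarrow> 'a set \<Rightarrow> 'a set \<Rightarrow> ('a set, 'a) lgraph" where
  "Cayley G X S = mk_lgraph (rcosets\<^bsub>G\<^esub> S)
     {(S #>\<^bsub>G\<^esub> g, x, S #>\<^bsub>G\<^esub> (g \<otimes>\<^bsub>G\<^esub> x)) | g x. g \<in> carrier G \<and> x \<in> sym_gens G X}"

text \<open>All subgraphs are connected and closed under inverting edges.\<close>

definition lsubgraph ::
    "('a, 'm) monoid_scheme \<Rightarrow> ('v, 'a) lgraph \<Rightarrow> ('v, 'a) lgraph \<Rightarrow> bool" where
  "lsubgraph G \<Gamma>' \<Gamma> \<longleftrightarrow> subgraph \<Gamma>' \<Gamma> \<and> strongly_connected \<Gamma>' \<and>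
     (\<forall>v x w. (v, x, w) \<in> arcs \<Gamma>' \<longrightarrow> (w, inv\<^bsub>G\<^esub> x, v) \<in> arcs \<Gamma>')"

definition finite_lsubgraph ::
    "('a, 'm) monoid_scheme \<Rightarrow> ('v, 'a) lgraph \<Rightarrow> ('v, 'a) lgraph \<Rightarrow> bool" where
  "finite_lsubgraph G \<Gamma>' \<Gamma> \<longleftrightarrow> lsubgraph G \<Gamma>' \<Gamma> \<and> finite (verts \<Gamma>') \<and> finite (arcs \<Gamma>')"

definition finite_cover_subgraph ::
    "('a, 'm) monoid_scheme \<Rightarrow> 'a set \<Rightarrow> ('a set, 'a) lgraph \<Rightarrow> 'a set \<Rightarrow> bool" where
  "finite_cover_subgraph G X \<Gamma> v \<longleftrightarrow>
     (\<exists>T. subgroup T G \<and> finite_lsubgraph G \<Gamma> (Cayley G X T)) \<and> v \<in> verts \<Gamma>"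

definition map_edge :: "('v \<Rightarrow> 'w) \<Rightarrow> 'v \<times> 'a \<times> 'v \<Rightarrow> 'w \<times> 'a \<times> 'w" where
  "map_edge f = (\<lambda>(v, x, w). (f v, x, f w))"

definition map_lgraph :: "('v \<Rightarrow> 'w) \<Rightarrow> ('v, 'a) lgraph \<Rightarrow> ('w, 'a) lgraph" where
  "map_lgraph f \<Gamma> = mk_lgraph (f ` verts \<Gamma>) (map_edge f ` arcs \<Gamma>)"

definition lgraph_embedding ::
    "('v \<Rightarrow> 'w) \<Rightarrow> ('v, 'a) lgraph \<Rightarrow> ('w, 'a) lgraph \<Rightarrow> bool" where
  "lgraph_embedding f \<Gamma> \<Delta> \<longleftrightarrow>
     inj_on f (verts \<Gamma>) \<and> f ` verts \<Gamma> \<subseteq> verts \<Delta> \<and> map_edge f ` arcs \<Gamma> \<subseteq> arcs \<Delta>"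

definition lgraph_iso ::
    "('v \<Rightarrow> 'w) \<Rightarrow> ('v, 'a) lgraph \<Rightarrow> ('w, 'a) lgraph \<Rightarrow> bool" where
  "lgraph_iso f \<Gamma> \<Delta> \<longleftrightarrow>
     inj_on f (verts \<Gamma>) \<and> f ` verts \<Gamma> = verts \<Delta> \<and> map_edge f ` arcs \<Gamma> = arcs \<Delta>"

definition path_labels ::
    "('a, 'm) monoid_scheme \<Rightarrow> ('v, 'a) lgraph \<Rightarrow> 'v \<Rightarrow> 'v \<Rightarrow> 'a set" where
  "path_labels G \<Gamma> v w = {path_label G p | p. pre_digraph.awalk \<Gamma> v p w}"

definition Lab :: "('a, 'm) monoid_scheme \<Rightarrow> ('v, 'a) lgraph \<Rightarrow> 'v \<Rightarrow> 'a set" where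
  "Lab G \<Gamma> v = path_labels G \<Gamma> v v"

text \<open>
  For a connected subgraph \<open>(\<Gamma>, v)\<close> of a cover, the labels of the paths from \<open>v\<close> to \<open>w\<close> form a
  right coset of \<open>Lab(\<Gamma>, v)\<close>, so \<open>path_labels G \<Gamma> v\<close> maps the vertices of \<open>\<Gamma>\<close> to vertices of
  \<open>tilde G X \<Gamma> v\<close>. It is the canonical embedding; see \<open>path_labels_embedding\<close> below.
\<close>

definition tilde ::
    "('a, 'm) monoid_scheme \<Rightarrow> 'a set \<Rightarrow> ('v, 'a) lgraph \<Rightarrow> 'v \<Rightarrow> ('a set, 'a) lgraph" where
  "tilde G X \<Gamma> v = Cayley G X (Lab G \<Gamma> v)"

text \<open>
  The \<open>X1*\<close>-component of \<open>w\<close>. All graphs considered are closed under inverting edges, so strongly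
  connected components are connected components.
\<close>

definition label_component ::
    "('a, 'm) monoid_scheme \<Rightarrow> 'a set \<Rightarrow> ('v, 'a) lgraph \<Rightarrow> 'v \<Rightarrow> ('v, 'a) lgraph" where
  "label_component G X1 \<Gamma> w =
     (let \<Gamma>1 = \<Gamma>\<lparr>arcs := {e \<in> arcs \<Gamma>. lab e \<in> sym_gens G X1}\<rparr>
      in induce_subgraph \<Gamma>1 (pre_digraph.scc_of \<Gamma>1 w))"

definition saturated ::
    "('a, 'm) monoid_scheme \<Rightarrow> 'a set \<Rightarrow> ('v, 'a) lgraph \<Rightarrow> 'v \<Rightarrow> bool" where
  "saturated G X1 \<Gamma> v \<longleftrightarrow> (\<forall>s \<in> sym_gens G X1. \<exists>w. (v, s, w) \<in> arcs \<Gamma>)"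

definition is_cover ::
    "('a, 'm) monoid_scheme \<Rightarrow> 'a set \<Rightarrow> ('v, 'a) lgraph \<Rightarrow> bool" where
  "is_cover G X \<Gamma> \<longleftrightarrow> (\<exists>T f. subgroup T G \<and> lgraph_iso f \<Gamma> (Cayley G X T))"

section \<open>Negative curvature and quasiconvexity\<close>

definition geodesic :: "('v, 'a) lgraph \<Rightarrow> 'v \<Rightarrow> ('v \<times> 'a \<times> 'v) list \<Rightarrow> 'v \<Rightarrow> bool" where
  "geodesic \<Gamma> u p v \<longleftrightarrow> pre_digraph.awalk \<Gamma> u p v \<and>
     (\<forall>q. pre_digraph.awalk \<Gamma> u q v \<longrightarrow> length p \<le> length q)"

definition neighborhood :: "('v, 'a) lgraph \<Rightarrow> nat \<Rightarrow> 'v set \<Rightarrow> 'v set" where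
  "neighborhood \<Gamma> K A = {v. \<exists>u \<in> A. \<exists>p. pre_digraph.awalk \<Gamma> u p v \<and> length p \<le> K}"

definition path_verts :: "('v, 'a) lgraph \<Rightarrow> 'v \<Rightarrow> ('v \<times> 'a \<times> 'v) list \<Rightarrow> 'v set" where
  "path_verts \<Gamma> u p = set (pre_digraph.awalk_verts \<Gamma> u p)"

text \<open>
  The Cayley graph of \<open>G\<close> is \<open>Cayley G Y {\<one>}\<close>; its vertices are the singletons
  \<open>{\<one>} #> g = {g}\<close>. Sides are read cyclically, so any side of a triangle can play the role of \<open>p\<close>.
\<close>

definition negatively_curved :: "('a, 'm) monoid_scheme \<Rightarrow> 'a set \<Rightarrow> bool" where
  "negatively_curved G Y \<longleftrightarrow>
     (let C = Cayley G Y {\<one>\<^bsub>G\<^esub>} in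
      \<exists>\<delta>. \<forall>a b c p q r. geodesic C a p b \<and> geodesic C b q c \<and> geodesic C c r a \<longrightarrow>
        path_verts C a p \<subseteq> neighborhood C \<delta> (path_verts C b q \<union> path_verts C c r))"

definition quasiconvex :: "('a, 'm) monoid_scheme \<Rightarrow> 'a set \<Rightarrow> 'a set \<Rightarrow> bool" where
  "quasiconvex G Y H \<longleftrightarrow>
     (let C = Cayley G Y {\<one>\<^bsub>G\<^esub>}; VH = (\<lambda>h. {\<one>\<^bsub>G\<^esub>} #>\<^bsub>G\<^esub> h) ` H in
      \<exists>K. \<forall>a \<in> VH. \<forall>b \<in> VH. \<forall>p. geodesic C a p b \<longrightarrow> path_verts C a p \<subseteq> neighborhood C K VH)"

definition locally_quasiconvex :: "('a, 'm) monoid_scheme \<Rightarrow> 'a set \<Rightarrow> bool" where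
  "locally_quasiconvex G Y \<longleftrightarrow> (\<forall>H. fg_subgroup G H \<longrightarrow> quasiconvex G Y H)"

section \<open>Strong separability\<close>

definition property4 ::
    "('a, 'm) monoid_scheme \<Rightarrow> 'a set \<Rightarrow> 'a set \<Rightarrow> ('v, 'a) lgraph \<Rightarrow> ('v, 'a) lgraph \<Rightarrow> bool" where
  "property4 G G0 X1 \<Gamma>' \<Gamma>t \<longleftrightarrow>
     (\<forall>w \<in> verts \<Gamma>'. \<forall>g \<in> Lab G \<Gamma>t w \<inter> G0.
        \<exists>p. pre_digraph.awalk (label_component G X1 \<Gamma>' w) w p w \<and> path_label G p = g)"

definition property5 ::
    "('a, 'm) monoid_scheme \<Rightarrow> 'a set \<Rightarrow> 'a set \<Rightarrow> ('v, 'a) lgraph \<Rightarrow> ('v, 'a) lgraph \<Rightarrow> bool" where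
  "property5 G G0 X1 \<Gamma>' \<Gamma>t \<longleftrightarrow>
     (\<forall>u \<in> verts \<Gamma>'. \<forall>w \<in> verts \<Gamma>'.
        (\<exists>p. pre_digraph.awalk \<Gamma>t u p w \<and> path_label G p \<in> G0) \<longleftrightarrow> w \<in> verts (label_component G X1 \<Gamma>' u))"

definition property7 ::
    "('a, 'm) monoid_scheme \<Rightarrow> 'a set \<Rightarrow> 'a set \<Rightarrow> ('v, 'a) lgraph \<Rightarrow> ('v, 'a) lgraph \<Rightarrow> bool" where
  "property7 G G0 X1 \<Gamma>' \<Gamma>t \<longleftrightarrow>
     (\<forall>v \<in> verts \<Gamma>'. finite_index (G\<lparr>carrier := G0\<rparr>) (Lab G \<Gamma>t v \<inter> G0) \<longrightarrow> saturated G X1 \<Gamma>' v)"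

text \<open>
  Everything that strong separability demands of a single \<open>(\<Gamma>, v)\<close>:
  \<open>\<Gamma>'\<close> is a finite subgraph of \<open>tilde G X \<Gamma> v\<close>, which has base vertex \<open>Lab(\<Gamma>, v)\<close>, and \<open>f\<close> is
  an embedding of \<open>\<Gamma>'\<close> in the finite subgraph \<open>(\<Delta>, d)\<close> of a cover. As \<open>\<Delta>\<close> need not be given as
  a subgraph of \<open>tilde G X \<Delta> d\<close>, its vertices are sent there by \<open>path_labels G \<Delta> d\<close>.
\<close>

definition separating_extension ::
    "('a, 'm) monoid_scheme \<Rightarrow> 'a set \<Rightarrow> 'a set \<Rightarrow> 'a set \<Rightarrow> ('a set, 'a) lgraph \<Rightarrow> 'a set \<Rightarrow>
     ('a set, 'a) lgraph \<Rightarrow> ('a set, 'a) lgraph \<Rightarrow> 'a set \<Rightarrow> ('a set \<Rightarrow> 'a set) \<Rightarrow> bool" where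
  "separating_extension G G0 X1 X \<Gamma> v \<Gamma>' \<Delta> d f \<longleftrightarrow>
     (let \<Gamma>t = tilde G X \<Gamma> v; b = Lab G \<Gamma> v;
          \<Delta>t = tilde G X \<Delta> d; j = (\<lambda>u. path_labels G \<Delta> d (f u)) in
      finite_lsubgraph G \<Gamma>' \<Gamma>t \<and>
      subgraph (map_lgraph (path_labels G \<Gamma> v) \<Gamma>) \<Gamma>' \<and>
      property4 G G0 X1 \<Gamma>' \<Gamma>t \<and> property5 G G0 X1 \<Gamma>' \<Gamma>t \<and> property7 G G0 X1 \<Gamma>' \<Gamma>t \<and>
      finite_cover_subgraph G X \<Delta> d \<and>
      lgraph_embedding f \<Gamma>' \<Delta> \<and> f b = d \<and>
      is_cover (G\<lparr>carrier := G0\<rparr>) X1 (label_component G X1 \<Delta> d) \<and>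
      (\<forall>e \<in> arcs \<Delta>. e \<notin> map_edge f ` arcs \<Gamma>' \<longrightarrow> e \<in> arcs (label_component G X1 \<Delta> d)) \<and>
      (\<forall>u \<in> verts \<Gamma>'. u \<notin> verts (label_component G X1 \<Gamma>t b) \<longrightarrow> Lab G \<Gamma>t u \<inter> G0 = Lab G \<Delta>t (j u) \<inter> G0) \<and>
      (\<forall>u \<in> verts \<Gamma>'. \<forall>w \<in> verts \<Gamma>'.
         j w \<in> verts (label_component G X1 \<Delta>t (j u)) \<longleftrightarrow> w \<in> verts (label_component G X1 \<Gamma>t u)))"

definition strongly_separable_wrt ::
    "('a, 'm) monoid_scheme \<Rightarrow> 'a set \<Rightarrow> 'a set \<Rightarrow> 'a set \<Rightarrow> bool" where
  "strongly_separable_wrt G G0 X1 X \<longleftrightarrow>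
     (\<forall>S1 S2. fg_subgroup G S1 \<and> fg_subgroup G S2 \<and> S1 \<inter> G0 = S2 \<inter> G0 \<and>
        \<not> finite_index (G\<lparr>carrier := G0\<rparr>) (S1 \<inter> G0) \<longrightarrow>
      (\<forall>\<Gamma>1 v1 \<Gamma>2 v2.
        finite_cover_subgraph G X \<Gamma>1 v1 \<and> Lab G \<Gamma>1 v1 = S1 \<and>
        finite_cover_subgraph G X \<Gamma>2 v2 \<and> Lab G \<Gamma>2 v2 = S2 \<longrightarrow>
        (\<exists>\<Gamma>1' \<Delta>1 d1 f1 \<Gamma>2' \<Delta>2 d2 f2.
           separating_extension G G0 X1 X \<Gamma>1 v1 \<Gamma>1' \<Delta>1 d1 f1 \<and>
           separating_extension G G0 X1 X \<Gamma>2 v2 \<Gamma>2' \<Delta>2 d2 f2 \<and>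
           Lab G \<Delta>1 d1 \<inter> G0 = Lab G \<Delta>2 d2 \<inter> G0)))"

text \<open>
  No particular choice of the generating sets is privileged: the property is required for all of
  them. The set \<open>X\<close> may be infinite.
\<close>

definition strongly_separable :: "('a, 'm) monoid_scheme \<Rightarrow> 'a set \<Rightarrow> bool" where
  "strongly_separable G G0 \<longleftrightarrow> fg_subgroup G G0 \<and>
     (\<forall>X1 X. finite X1 \<and> X1 \<subseteq> X \<and> X \<subseteq> carrier G \<and>
        generate G X1 = G0 \<and> generate G X = carrier G \<longrightarrow>
        strongly_separable_wrt G G0 X1 X)"

section \<open>Consistency of the conventions\<close>

text \<open>Finite index subgroups form a base of open neighbourhoods of the identity.\<close>

context group begin

lemma finite_index_Int:
  assumes N: "finite_index G N" and M: "finite_index G M"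
  shows "finite_index G (N \<inter> M)"
proof -
  have sN: "subgroup N G" and sM: "subgroup M G" using N M by (auto simp: finite_index_def)
  have coset: "(N \<inter> M) #> a = (N #> a) \<inter> (M #> a)" if "a \<in> carrier G" for a
    using that subgroup.mem_carrier[OF sN] subgroup.mem_carrier[OF sM]
    by (fastforce simp: r_coset_def)
  have "rcosets (N \<inter> M) \<subseteq> (\<lambda>(A, B). A \<inter> B) ` ((rcosets N) \<times> (rcosets M))"
  proof
    fix C assume "C \<in> rcosets (N \<inter> M)"
    then obtain a where "a \<in> carrier G" "C = (N #> a) \<inter> (M #> a)" by (auto simp: RCOSETS_def coset)
    then show "C \<in> (\<lambda>(A, B). A \<inter> B) ` ((rcosets N) \<times> (rcosets M))"
      by (intro image_eqI[of _ _ "(N #> a, M #> a)"]) (auto simp: RCOSETS_def)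
  qed
  then show ?thesis
    using N M subgroups_Inter_pair[OF sN sM] by (auto simp: finite_index_def intro: finite_subset)
qed

lemma finite_index_carrier: "finite_index G (carrier G)"
proof -
  have "rcosets (carrier G) \<subseteq> {carrier G}"
    using coset_join2 subgroup_self by (auto simp: RCOSETS_def)
  then show ?thesis by (auto simp: finite_index_def subgroup_self intro: finite_subset)
qed

lemma profinite_nhd:
  assumes "openin (profinite_topology G) U" "x \<in> U"
  shows "x \<in> carrier G \<and> (\<exists>N. finite_index G N \<and> x <# N \<subseteq> U)"
proof -
  have "generate_topology_on {g <# N | g N. g \<in> carrier G \<and> finite_index G N} U"
    using assms(1) by (simp add: profinite_topology_def openin_topology_generated_by_iff)
  then show ?thesis using assms(2)
  proof (induction arbitrary: x)
    case Empty
    then show ?case by simp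
  next
    case (Int a b)
    then obtain N M where "finite_index G N" "x <# N \<subseteq> a" "finite_index G M" "x <# M \<subseteq> b"
      using Int.IH(1)[of x] Int.IH(2)[of x] Int.prems by blast
    moreover have "x <# (N \<inter> M) \<subseteq> (x <# N) \<inter> (x <# M)" by (auto simp: l_coset_def)
    ultimately have "finite_index G (N \<inter> M)" "x <# (N \<inter> M) \<subseteq> a \<inter> b"
      using finite_index_Int by blast+
    then show ?case using Int.IH(1)[of x] Int.prems by blast
  next
    case (UN K)
    then show ?case by blast
  next
    case (Basis s)
    then obtain g N where s: "s = g <# N" "g \<in> carrier G" "finite_index G N" by blast
    then have sN: "subgroup N G" by (simp add: finite_index_def)
    then have "x <# N = g <# N" "x \<in> carrier G"
      using Basis(2) s l_repr_independence subgroup.mem_carrier[OF sN]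
      by (auto simp: l_coset_def)
    then show ?case using s by auto
  qed
qed

lemma profinite_base_at_one:
  "finite_index G N \<Longrightarrow> openin (profinite_topology G) N"
  "openin (profinite_topology G) U \<Longrightarrow> \<one> \<in> U \<Longrightarrow> \<exists>N. finite_index G N \<and> N \<subseteq> U"
proof -
  have one: "\<one> <# N = N" if "finite_index G N" for N
    using that subgroup.mem_carrier by (fastforce simp: finite_index_def l_coset_def)
  show "openin (profinite_topology G) N" if "finite_index G N"
    unfolding profinite_topology_def using that one
    by (intro topology_generated_by_Basis) force
  show "\<exists>N. finite_index G N \<and> N \<subseteq> U" if "openin (profinite_topology G) U" "\<one> \<in> U"
    using profinite_nhd[OF that] one by auto
qed

lemma sym_gens_carrier:
  assumes "X \<subseteq> carrier G"
  shows "sym_gens G X \<subseteq> carrier G"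
  using assms by (auto simp: sym_gens_def)

lemma Cayley_arcsD:
  assumes "subgroup T G" "X \<subseteq> carrier G" "(v, x, w) \<in> arcs (Cayley G X T)"
  shows "x \<in> sym_gens G X" "x \<in> carrier G" "v \<subseteq> carrier G" "w = v #> x"
proof -
  obtain g where g: "v = T #> g" "w = T #> (g \<otimes> x)" "g \<in> carrier G" "x \<in> sym_gens G X"
    using assms(3) by (auto simp: Cayley_def mk_lgraph_def)
  then show "x \<in> sym_gens G X" "x \<in> carrier G"
    using sym_gens_carrier[OF assms(2)] by auto
  then show "v \<subseteq> carrier G" "w = v #> x"
    using g assms(1) by (auto simp: coset_mult_assoc subgroup.subset r_coset_subset_G)
qed

lemma wf_digraph_Cayley:
  assumes "X \<subseteq> carrier G"
  shows "wf_digraph (Cayley G X T)"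
proof -
  have "T #> (g \<otimes> x) \<in> rcosets T" if "g \<in> carrier G" "x \<in> sym_gens G X" for g x
    using that sym_gens_carrier[OF assms] unfolding RCOSETS_def by blast
  then show ?thesis by unfold_locales (auto simp: Cayley_def mk_lgraph_def RCOSETS_def)
qed

lemma Cayley_arcs_inv:
  assumes "X \<subseteq> carrier G" "(v, x, w) \<in> arcs (Cayley G X T)"
  shows "(w, inv x, v) \<in> arcs (Cayley G X T)"
proof -
  obtain g where g: "v = T #> g" "w = T #> (g \<otimes> x)" "g \<in> carrier G" "x \<in> sym_gens G X"
    using assms(2) by (auto simp: Cayley_def mk_lgraph_def)
  then have x: "x \<in> carrier G" "inv x \<in> sym_gens G X"
    using assms(1) by (auto simp: sym_gens_def)
  then have "v = T #> (g \<otimes> x \<otimes> inv x)" "g \<otimes> x \<in> carrier G" using g by (simp_all add: m_assoc)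
  then show ?thesis using g(2) x(2) unfolding Cayley_def mk_lgraph_def by auto
qed

text \<open>The canonical map from a connected subgraph \<open>(\<Gamma>, v)\<close> of a cover into \<open>tilde G X \<Gamma> v\<close>.\<close>

context
  fixes X T \<Gamma>
  assumes T: "subgroup T G" and X: "X \<subseteq> carrier G" and \<Gamma>: "lsubgraph G \<Gamma> (Cayley G X T)"
begin

lemma lsubgraph_ends: "tail \<Gamma> = fst" "head \<Gamma> = snd \<circ> snd"
  using \<Gamma> by (auto simp: lsubgraph_def subgraph_def compatible_def Cayley_def mk_lgraph_def)

lemma lsubgraph_wf: "wf_digraph \<Gamma>"
  using \<Gamma> by (auto simp: lsubgraph_def subgraph_def)

lemma lsubgraph_arcD:
  assumes "(v, x, w) \<in> arcs \<Gamma>"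
  shows "x \<in> sym_gens G X" "x \<in> carrier G" "v \<subseteq> carrier G" "w = v #> x"
    "(w, inv x, v) \<in> arcs \<Gamma>" "v \<in> verts \<Gamma>" "w \<in> verts \<Gamma>"
proof -
  have "(v, x, w) \<in> arcs (Cayley G X T)"
    using \<Gamma> assms by (auto simp: lsubgraph_def subgraph_def)
  from Cayley_arcsD[OF T X this]
  show "x \<in> sym_gens G X" "x \<in> carrier G" "v \<subseteq> carrier G" "w = v #> x" by auto
  show "(w, inv x, v) \<in> arcs \<Gamma>" using \<Gamma> assms by (auto simp: lsubgraph_def)
  show "v \<in> verts \<Gamma>" "w \<in> verts \<Gamma>"
    using wf_digraph.tail_in_verts[OF lsubgraph_wf assms] wf_digraph.head_in_verts[OF lsubgraph_wf assms]
    by (auto simp: lsubgraph_ends)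
qed

lemma lsubgraph_vertD:
  assumes "v \<in> verts \<Gamma>"
  shows "v \<subseteq> carrier G"
proof -
  have "v \<in> rcosets T"
    using \<Gamma> assms by (auto simp: lsubgraph_def subgraph_def Cayley_def mk_lgraph_def)
  then show ?thesis by (rule subgroup.rcosets_carrier[OF T is_group])
qed

lemma lsubgraph_awalk_Cons:
  "pre_digraph.awalk \<Gamma> u ((v, x, w) # p) z \<longleftrightarrow>
     u = v \<and> (v, x, w) \<in> arcs \<Gamma> \<and> pre_digraph.awalk \<Gamma> w p z"
  using wf_digraph.awalk_Cons_iff[OF lsubgraph_wf, of u "(v, x, w)" p z] by (auto simp: lsubgraph_ends)

lemma lsubgraph_awalk_Nil: "pre_digraph.awalk \<Gamma> u [] z \<longleftrightarrow> u = z \<and> u \<in> verts \<Gamma>"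
  by (auto simp: wf_digraph.awalk_Nil_iff[OF lsubgraph_wf])

lemma path_label_simps:
  "path_label G [] = \<one>" "path_label G ((v, x, w) # p) = x \<otimes> path_label G p"
  by (simp_all add: path_label_def lab_def)

lemma path_labels_one: "v \<in> verts \<Gamma> \<Longrightarrow> \<one> \<in> path_labels G \<Gamma> v v"
  unfolding path_labels_def using lsubgraph_awalk_Nil path_label_simps(1) by (metis (mono_tags, lifting) mem_Collect_eq)

lemma path_labels_step:
  assumes "(u, x, w) \<in> arcs \<Gamma>" "h \<in> path_labels G \<Gamma> w z"
  shows "x \<otimes> h \<in> path_labels G \<Gamma> u z"
proof -
  obtain p where "pre_digraph.awalk \<Gamma> w p z" "h = path_label G p"
    using assms(2) by (auto simp: path_labels_def)
  then have "pre_digraph.awalk \<Gamma> u ((u, x, w) # p) z" "x \<otimes> h = path_label G ((u, x, w) # p)"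
    using assms(1) by (simp_all add: lsubgraph_awalk_Cons path_label_simps)
  then show ?thesis unfolding path_labels_def by blast
qed

lemma path_labels_induct [consumes 1, case_names refl step]:
  assumes "g \<in> path_labels G \<Gamma> u z"
    and "\<And>u. u \<in> verts \<Gamma> \<Longrightarrow> P u \<one> u"
    and "\<And>u x w g z. (u, x, w) \<in> arcs \<Gamma> \<Longrightarrow> g \<in> path_labels G \<Gamma> w z \<Longrightarrow> P w g z \<Longrightarrow> P u (x \<otimes> g) z"
  shows "P u g z"
proof -
  obtain p where "pre_digraph.awalk \<Gamma> u p z" "g = path_label G p"
    using assms(1) by (auto simp: path_labels_def)
  then show ?thesis
  proof (induction p arbitrary: u g)
    case Nil
    then show ?case using assms(2) by (auto simp: lsubgraph_awalk_Nil path_label_simps)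
  next
    case (Cons e p)
    obtain v x w where "e = (v, x, w)" by (cases e)
    then have e: "u = v" "(v, x, w) \<in> arcs \<Gamma>" "pre_digraph.awalk \<Gamma> w p z"
        "g = x \<otimes> path_label G p"
      using Cons.prems by (auto simp: lsubgraph_awalk_Cons path_label_simps)
    moreover have "path_label G p \<in> path_labels G \<Gamma> w z" using e(3) by (auto simp: path_labels_def)
    ultimately show ?case using Cons.IH[OF e(3) refl] assms(3) by simp
  qed
qed

lemma path_labels_carrier:
  assumes "g \<in> path_labels G \<Gamma> u z"
  shows "g \<in> carrier G \<and> u \<in> verts \<Gamma> \<and> z \<in> verts \<Gamma> \<and> z = u #> g"
  using assms
proof (induction rule: path_labels_induct)
  case (refl u)
  then show ?case using lsubgraph_vertD by (simp add: coset_mult_one)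
next
  case (step u x w g z)
  then show ?case using lsubgraph_arcD[OF step(1)] by (auto simp: coset_mult_assoc)
qed

lemma path_labels_trans:
  assumes "g \<in> path_labels G \<Gamma> u z" "h \<in> path_labels G \<Gamma> z w"
  shows "g \<otimes> h \<in> path_labels G \<Gamma> u w"
  using assms
proof (induction arbitrary: h rule: path_labels_induct)
  case (refl u)
  then show ?case using path_labels_carrier by simp
next
  case (step u x w' g z)
  then show ?case
    using path_labels_step[OF step(1)] path_labels_carrier lsubgraph_arcD[OF step(1)] by (simp add: m_assoc)
qed

lemma path_labels_inv:
  assumes "g \<in> path_labels G \<Gamma> u z"
  shows "inv g \<in> path_labels G \<Gamma> z u"
  using assms
proof (induction rule: path_labels_induct)
  case (refl u)
  then show ?case by (simp add: path_labels_one)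
next
  case (step u x w g z)
  have "inv x \<otimes> \<one> \<in> path_labels G \<Gamma> w u"
    using lsubgraph_arcD[OF step(1)] by (intro path_labels_step[of _ _ u] path_labels_one) auto
  then have "inv g \<otimes> inv x \<in> path_labels G \<Gamma> z u"
    using path_labels_trans[OF step(3)] lsubgraph_arcD[OF step(1)] by simp
  then show ?case
    using path_labels_carrier[OF step(2)] lsubgraph_arcD[OF step(1)] by (simp add: inv_mult_group)
qed

lemma path_labels_nonempty:
  assumes "u \<in> verts \<Gamma>" "w \<in> verts \<Gamma>"
  shows "path_labels G \<Gamma> u w \<noteq> {}"
proof -
  have "reachable \<Gamma> u w" using assms \<Gamma> by (auto simp: lsubgraph_def strongly_connected_def)
  then show ?thesis using wf_digraph.reachable_awalk[OF lsubgraph_wf] by (auto simp: path_labels_def)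
qed

lemma subgroup_Lab: "v \<in> verts \<Gamma> \<Longrightarrow> subgroup (Lab G \<Gamma> v) G"
  unfolding Lab_def
proof (rule subgroupI)
  assume v: "v \<in> verts \<Gamma>"
  show "path_labels G \<Gamma> v v \<noteq> {}" using path_labels_one[OF v] by blast
qed (use path_labels_carrier path_labels_inv path_labels_trans in auto)

lemma path_labels_coset:
  assumes g: "g \<in> path_labels G \<Gamma> v w"
  shows "path_labels G \<Gamma> v w = Lab G \<Gamma> v #> g"
proof
  show "Lab G \<Gamma> v #> g \<subseteq> path_labels G \<Gamma> v w"
    using path_labels_trans[OF _ g] by (auto simp: r_coset_def Lab_def)
  show "path_labels G \<Gamma> v w \<subseteq> Lab G \<Gamma> v #> g"
  proof
    fix h assume h: "h \<in> path_labels G \<Gamma> v w"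
    have "h \<otimes> inv g \<in> Lab G \<Gamma> v" unfolding Lab_def by (rule path_labels_trans[OF h path_labels_inv[OF g]])
    moreover have "h = (h \<otimes> inv g) \<otimes> g"
      using path_labels_carrier[OF g] path_labels_carrier[OF h] by (simp add: m_assoc)
    ultimately show "h \<in> Lab G \<Gamma> v #> g" by (auto simp: r_coset_def)
  qed
qed

lemma path_labels_embedding:
  assumes v: "v \<in> verts \<Gamma>"
  shows "lgraph_embedding (path_labels G \<Gamma> v) \<Gamma> (tilde G X \<Gamma> v)"
    and "path_labels G \<Gamma> v v = Lab G \<Gamma> v #> \<one>"
proof -
  show "path_labels G \<Gamma> v v = Lab G \<Gamma> v #> \<one>"
    by (rule path_labels_coset) (rule path_labels_one[OF v])
  have "inj_on (path_labels G \<Gamma> v) (verts \<Gamma>)"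
  proof (rule inj_onI)
    fix w w' assume "w \<in> verts \<Gamma>" "w' \<in> verts \<Gamma>" and eq: "path_labels G \<Gamma> v w = path_labels G \<Gamma> v w'"
    then obtain g where "g \<in> path_labels G \<Gamma> v w" using path_labels_nonempty[OF v] by blast
    then show "w = w'" using eq path_labels_carrier by metis
  qed
  moreover have "path_labels G \<Gamma> v w \<in> verts (tilde G X \<Gamma> v)" if w: "w \<in> verts \<Gamma>" for w
  proof -
    obtain g where "g \<in> path_labels G \<Gamma> v w" using path_labels_nonempty[OF v w] by auto
    then have "path_labels G \<Gamma> v w = Lab G \<Gamma> v #> g" "g \<in> carrier G"
      using path_labels_coset path_labels_carrier by simp_all
    then show ?thesis by (auto simp: tilde_def Cayley_def mk_lgraph_def RCOSETS_def)
  qed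
  moreover have "(path_labels G \<Gamma> v u, x, path_labels G \<Gamma> v w) \<in> arcs (tilde G X \<Gamma> v)"
    if e: "(u, x, w) \<in> arcs \<Gamma>" for u x w
  proof -
    obtain g where g: "g \<in> path_labels G \<Gamma> v u" using path_labels_nonempty[OF v] lsubgraph_arcD[OF e] by blast
    have "x \<otimes> \<one> \<in> path_labels G \<Gamma> u w"
      using lsubgraph_arcD[OF e] by (intro path_labels_step[OF e] path_labels_one)
    then have "g \<otimes> x \<in> path_labels G \<Gamma> v w" using path_labels_trans[OF g] lsubgraph_arcD[OF e] by simp
    then have "path_labels G \<Gamma> v u = Lab G \<Gamma> v #> g"
      "path_labels G \<Gamma> v w = Lab G \<Gamma> v #> (g \<otimes> x)"
      using path_labels_coset g by simp_all
    moreover have "g \<in> carrier G" "x \<in> sym_gens G X" using path_labels_carrier[OF g] lsubgraph_arcD[OF e] by auto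
    ultimately show ?thesis unfolding tilde_def Cayley_def mk_lgraph_def by auto
  qed
  ultimately show "lgraph_embedding (path_labels G \<Gamma> v) \<Gamma> (tilde G X \<Gamma> v)"
    by (auto simp: lgraph_embedding_def map_edge_def)
qed

end

end

end

theory Submission
  imports Defs
begin

text \<open>
  Let \<open>S1\<close>, \<open>S2\<close> be the given subgroups and \<open>D\<close> their common intersection with \<open>G0\<close>. The graphs
  \<open>\<Delta>i\<close> live in the covers \<open>Cayley G X Ki\<close> with \<open>Ki = \<langle>Si, L\<rangle>\<close>, for one and the same subgroup \<open>L\<close> of
  finite index in \<open>G0\<close> that contains \<open>D\<close>: \<open>\<Delta>i\<close> is the image of \<open>\<Gamma>i'\<close> together with the finite orbit of
  the base vertex under \<open>G0\<close>. All that strong separability asks of \<open>\<Delta>i\<close> then becomes a statement about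
  \<open>Ki\<close>: that \<open>Ki \<inter> G0 = L\<close>, and that passing from \<open>Si\<close> to \<open>Ki\<close> neither identifies vertices of \<open>\<Gamma>i'\<close>, nor
  merges \<open>G0\<close>-orbits among them, nor enlarges the stabilisers in \<open>G0\<close> outside the base orbit
  (\<open>separating_extension_quotient\<close>).

  These statements hold as soon as the elements of \<open>L - D\<close> are long enough (\<open>combination\<close>), and LERF
  provides such an \<open>L\<close>, because \<open>D\<close> is finitely generated, hence closed, and only finitely many
  elements have to be avoided (\<open>closed_subgroup_separated_finite\<close>).

  The combination theorem is a ping-pong argument with nearest-point projections to the cosets of
  \<open>G0\<close>. Quasiconvexity and slim triangles make these projections strongly contracting
  (\<open>projections_far_apart\<close>), which gives Behrstock's inequality (\<open>behrstock\<close>). Malnormality bounds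
  the projection of one coset of \<open>G0\<close> to another (\<open>coset_projection_bounded\<close>), and quasiconvexity of
  \<open>S\<close> puts the projection of \<open>s a G0\<close> to \<open>G0\<close> near \<open>D\<close> (\<open>coset_projection_near_intersection\<close>). Hence an
  element of \<open>S - D\<close> throws points with projection far from \<open>D\<close> to points with projection near \<open>D\<close>, and a
  long element of \<open>L - D\<close> does the opposite. By induction an alternating product of such elements moves
  \<open>G0\<close>, and each of finitely many other cosets, away from where it could violate the claim.

  For \<open>\<Gamma>i'\<close> it is enough to add to \<open>\<Gamma>i\<close> a large ball in the direction of \<open>X1\<close>
  (\<open>orbit_neighbourhood\<close>); the point is that the stabilisers in \<open>G0\<close> of the vertices are finitely
  generated, since quasiconvex subgroups intersect in finitely generated ones (\<open>fg_subgroup_Int\<close>).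
\<close>

section \<open>Nearest-point projections in slim spaces\<close>

text \<open>The vertices of a graph with slim triangles, with the combinatorial distance. A vertex \<open>u\<close> lies on
  a geodesic from \<open>x\<close> to \<open>y\<close> if and only if \<open>d x u + d u y = d x y\<close>, so paths need not be mentioned.\<close>

locale slim_space =
  fixes M :: "'p set" and d :: "'p \<Rightarrow> 'p \<Rightarrow> nat" and \<delta> :: nat
  assumes dist_self: "x \<in> M \<Longrightarrow> d x x = 0"
    and dist_sym: "x \<in> M \<Longrightarrow> y \<in> M \<Longrightarrow> d x y = d y x"
    and dist_triangle: "x \<in> M \<Longrightarrow> y \<in> M \<Longrightarrow> z \<in> M \<Longrightarrow> d x z \<le> d x y + d y z"
    and geodesic_point:
      "x \<in> M \<Longrightarrow> y \<in> M \<Longrightarrow> n \<le> d x y \<Longrightarrow> \<exists>u\<in>M. d x u = n \<and> d x u + d u y = d x y"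
    and slim: "x \<in> M \<Longrightarrow> y \<in> M \<Longrightarrow> z \<in> M \<Longrightarrow> u \<in> M \<Longrightarrow> d x u + d u y = d x y \<Longrightarrow>
      \<exists>v\<in>M. d u v \<le> \<delta> \<and> (d x v + d v z = d x z \<or> d z v + d v y = d z y)"
begin

definition between :: "'p \<Rightarrow> 'p \<Rightarrow> 'p \<Rightarrow> bool" where
  "between x u y \<longleftrightarrow> x \<in> M \<and> u \<in> M \<and> y \<in> M \<and> d x u + d u y = d x y"

definition qconvex :: "nat \<Rightarrow> 'p set \<Rightarrow> bool" where
  "qconvex K P \<longleftrightarrow> P \<subseteq> M \<and> (\<forall>a\<in>P. \<forall>b\<in>P. \<forall>u. between a u b \<longrightarrow> (\<exists>h\<in>P. d u h \<le> K))"

definition nearest :: "'p set \<Rightarrow> 'p \<Rightarrow> 'p \<Rightarrow> bool" where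
  "nearest P x p \<longleftrightarrow> p \<in> P \<and> (\<forall>h\<in>P. d x p \<le> d x h)"

lemma between_sym: "between x u y \<Longrightarrow> between y u x"
  unfolding between_def by (metis add.commute dist_sym)

lemma between_slim:
  assumes "between x u y" "z \<in> M"
  shows "\<exists>v. d u v \<le> \<delta> \<and> (between x v z \<or> between z v y)"
  using slim[of x y z u] assms unfolding between_def by blast

lemma nearest_exists:
  assumes "P \<noteq> {}"
  shows "\<exists>p. nearest P x p"
proof -
  obtain a where "a \<in> P" using assms by blast
  then show ?thesis
    unfolding nearest_def using ex_has_least_nat[of "\<lambda>h. h \<in> P" a "d x"] by blast
qed

text \<open>A geodesic from \<open>x\<close> to its projection moves straight away from \<open>P\<close>, so it comes close to
  \<open>P\<close> only near its end.\<close>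

lemma near_end_of_projection:
  assumes P: "P \<subseteq> M" and p: "nearest P x p" and v: "between p v x" and h: "h \<in> P" "d v h \<le> c"
  shows "d p v \<le> c"
proof -
  have M: "x \<in> M" "p \<in> M" "v \<in> M" "h \<in> M" using P h v by (auto simp: between_def)
  have "d x p \<le> d x h" using p h by (auto simp: nearest_def)
  also have "\<dots> \<le> d x v + d v h" using dist_triangle M by blast
  finally have "d x p \<le> d x v + c" using h by simp
  moreover have "d p v + d v x = d p x" using v by (simp add: between_def)
  moreover have "d x v = d v x" "d x p = d p x" using M dist_sym by auto
  ultimately show ?thesis by simp
qed

text \<open>Projections to a \<open>K\<close>-quasiconvex set count as distant from \<open>jump K\<close> on; a geodesic then passes
  within \<open>fellow K\<close> of both of them.\<close>

definition jump :: "nat \<Rightarrow> nat" where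
  "jump K = 2 * (4 * \<delta> + K + 1)"

definition fellow :: "nat \<Rightarrow> nat" where
  "fellow K = 6 * \<delta> + K + 1"

text \<open>The contraction property. In a quadrilateral with sides \<open>[x, p]\<close>, \<open>[p, q]\<close>, \<open>[q, y]\<close> and
  \<open>[x, y]\<close>, the points of \<open>[p, q]\<close> are near \<open>P\<close>; away from its ends they can therefore not be close to
  \<open>[x, p]\<close> or \<open>[q, y]\<close>, and slimness puts them close to \<open>[x, y]\<close>.\<close>

lemma projections_far_apart:
  assumes P: "qconvex K P" and p: "nearest P x p" and q: "nearest P y q"
    and xy: "x \<in> M" "y \<in> M" and far: "jump K \<le> d p q"
  shows "\<exists>v. between x v y \<and> d p v \<le> fellow K"
proof -
  \<comment> \<open>Points of \<open>[p, q]\<close> that are within \<open>2 * \<delta>\<close> of \<open>[x, p]\<close> are within \<open>4 * \<delta> + K\<close> of \<open>p\<close>.\<close>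
  define t where "t = 4 * \<delta> + K + 1"
  have pq: "p \<in> P" "q \<in> P" "p \<in> M" "q \<in> M"
    using P p q by (auto simp: nearest_def qconvex_def)
  have "t \<le> d p q" using far by (simp add: t_def jump_def)
  then obtain u where u: "u \<in> M" "d p u = t" "d p u + d u q = d p q"
    using geodesic_point[OF pq(3,4)] by blast
  have btw: "between p u q" using u pq by (simp add: between_def)
  have uq: "t \<le> d u q" using u far by (simp add: t_def jump_def)
  obtain h where h: "h \<in> P" "d u h \<le> K" using P btw pq unfolding qconvex_def by blast
  have hM: "h \<in> M" using h P by (auto simp: qconvex_def)
  have side: False
    if "d u v \<le> 2 * \<delta>" "between o' v z" "nearest P z o'" "z \<in> M" "t \<le> d o' u" for v z o'
  proof -
    have vM: "v \<in> M" "o' \<in> M" using that by (auto simp: between_def)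
    have "d v h \<le> d v u + d u h" using dist_triangle vM u hM by blast
    then have "d v h \<le> 2 * \<delta> + K" using that h dist_sym[OF vM(1) u(1)] by simp
    then have "d o' v \<le> 2 * \<delta> + K"
      using near_end_of_projection[OF _ that(3,2) h(1)] P by (auto simp: qconvex_def)
    moreover have "d o' u \<le> d o' v + d v u" using dist_triangle vM u by blast
    ultimately show False using that dist_sym[OF vM(1) u(1)] by (simp add: t_def)
  qed
  obtain v where v: "d u v \<le> \<delta>" "between p v x \<or> between x v q"
    using between_slim[OF btw xy(1)] by blast
  have goal: ?thesis if w: "d u w \<le> 2 * \<delta>" "between x w y" for w
  proof -
    have "w \<in> M" using w by (simp add: between_def)
    then have "d p w \<le> d p u + d u w" using dist_triangle pq u by blast
    then have "d p w \<le> fellow K" using w u by (simp add: t_def fellow_def)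
    then show ?thesis using w by blast
  qed
  from v(2) show ?thesis
  proof
    assume "between p v x"
    then show ?thesis using side[of v p x] v p xy u by simp
  next
    assume vq: "between x v q"
    then obtain w where w: "d v w \<le> \<delta>" "between x w y \<or> between y w q"
      using between_slim[OF vq xy(2)] by blast
    have M: "v \<in> M" "w \<in> M" using vq w by (auto simp: between_def)
    have uw: "d u w \<le> 2 * \<delta>" using dist_triangle[OF u(1) M] v w by simp
    from w(2) show ?thesis
    proof
      assume "between y w q"
      then show ?thesis
        using side[of w q y] between_sym uw q xy uq dist_sym[OF u(1) pq(4)] by simp
    qed (rule goal[OF uw])
  qed
qed

text \<open>Up to a bounded error, going from \<open>x\<close> to \<open>y\<close> through \<open>p\<close> is no detour.\<close>

lemma dist_via_projections:
  assumes P: "qconvex K P" and p: "nearest P x p" and q: "nearest P y q"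
    and xy: "x \<in> M" "y \<in> M" and far: "jump K \<le> d p q"
  shows "d x p + d p y \<le> d x y + 2 * fellow K"
proof -
  obtain v where v: "between x v y" "d p v \<le> fellow K"
    using projections_far_apart[OF assms] by blast
  have M: "v \<in> M" "p \<in> M" using v p P by (auto simp: between_def nearest_def qconvex_def)
  have "d x p \<le> d x v + d v p" "d p y \<le> d p v + d v y" using dist_triangle xy M by blast+
  then show ?thesis using v dist_sym[OF M] by (simp add: between_def)
qed

text \<open>Behrstock's inequality: \<open>z\<close> and \<open>Q\<close> cannot have distant projections to \<open>P\<close> while \<open>z\<close> and \<open>P\<close>
  have distant projections to \<open>Q\<close>. Otherwise a geodesic from \<open>z\<close> to \<open>q \<in> Q\<close> would pass near \<open>p\<close>, and
  one from \<open>z\<close> to \<open>p\<close> would pass near \<open>q\<close>; but then \<open>p\<close> and \<open>q\<close> are close to each other.\<close>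

lemma behrstock:
  assumes P: "qconvex K P" and Q: "qconvex K Q" and z: "z \<in> M"
    and p: "nearest P z p" and q: "nearest Q z q"
    and u: "nearest P q u" and w: "nearest Q p w"
  shows "d p u \<le> 4 * fellow K \<or> d q w \<le> 4 * fellow K"
proof (rule ccontr)
  assume "\<not> ?thesis"
  then have far: "4 * fellow K < d p u" "4 * fellow K < d q w" by auto
  moreover have "jump K \<le> 4 * fellow K" by (simp add: jump_def fellow_def)
  ultimately have jump: "jump K \<le> d p u" "jump K \<le> d q w" by auto
  have M: "p \<in> P" "u \<in> P" "p \<in> M" "q \<in> M" "u \<in> M"
    using p q u P Q by (auto simp: nearest_def qconvex_def)
  have "d z p + d p q \<le> d z q + 2 * fellow K"
    using dist_via_projections[OF P p u z M(4) jump(1)] .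
  moreover have "d z q + d q p \<le> d z p + 2 * fellow K"
    using dist_via_projections[OF Q q w z M(3) jump(2)] .
  moreover have "d q u \<le> d q p" using u M by (simp add: nearest_def)
  moreover have "d p u \<le> d p q + d q u" using dist_triangle M by blast
  ultimately show False using far dist_sym[OF M(3,4)] by simp
qed

end

section \<open>Word metrics\<close>

fun word_ball :: "('a, 'm) monoid_scheme \<Rightarrow> 'a set \<Rightarrow> nat \<Rightarrow> 'a set" where
  "word_ball G X 0 = {\<one>\<^bsub>G\<^esub>}"
| "word_ball G X (Suc n) =
     word_ball G X n \<union> {b \<otimes>\<^bsub>G\<^esub> x | b x. b \<in> word_ball G X n \<and> x \<in> sym_gens G X}"

definition word_length :: "('a, 'm) monoid_scheme \<Rightarrow> 'a set \<Rightarrow> 'a \<Rightarrow> nat" where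
  "word_length G X g = (LEAST n. g \<in> word_ball G X n)"

definition word_dist :: "('a, 'm) monoid_scheme \<Rightarrow> 'a set \<Rightarrow> 'a \<Rightarrow> 'a \<Rightarrow> nat" where
  "word_dist G X g h = word_length G X (inv\<^bsub>G\<^esub> g \<otimes>\<^bsub>G\<^esub> h)"

lemma word_ball_mono: "m \<le> n \<Longrightarrow> word_ball G X m \<subseteq> word_ball G X n"
  by (rule lift_Suc_mono_le[of "word_ball G X"]) auto

context group
begin

lemma inv_cancel_left:
  assumes "a \<in> carrier G" "b \<in> carrier G"
  shows "a \<otimes> (inv a \<otimes> b) = b" "inv a \<otimes> (a \<otimes> b) = b"
  using assms by (simp_all add: m_assoc[symmetric])

text \<open>With the unit and inverse laws of the simplifier, these rules rewrite products to normal form.\<close>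

lemmas group_normalize = m_assoc inv_mult_group inv_cancel_left

lemma word_ball_carrier:
  assumes "X \<subseteq> carrier G"
  shows "word_ball G X n \<subseteq> carrier G"
  using sym_gens_carrier[OF assms] by (induction n) auto

lemma word_ball_closed: "X \<subseteq> carrier G \<Longrightarrow> g \<in> word_ball G X n \<Longrightarrow> g \<in> carrier G"
  using word_ball_carrier by blast

lemma sym_gens_closed: "X \<subseteq> carrier G \<Longrightarrow> x \<in> sym_gens G X \<Longrightarrow> x \<in> carrier G"
  using sym_gens_carrier by blast

lemma sym_gens_inv:
  assumes "X \<subseteq> carrier G" "x \<in> sym_gens G X"
  shows "inv x \<in> sym_gens G X"
  using assms by (auto simp: sym_gens_def)

lemma finite_word_ball:
  assumes "finite X"
  shows "finite (word_ball G X n)"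
proof (induction n)
  case (Suc n)
  have "finite ((\<lambda>(b, x). b \<otimes> x) ` (word_ball G X n \<times> sym_gens G X))"
    using Suc assms by (auto simp: sym_gens_def)
  moreover have "{b \<otimes> x | b x. b \<in> word_ball G X n \<and> x \<in> sym_gens G X} \<subseteq>
    (\<lambda>(b, x). b \<otimes> x) ` (word_ball G X n \<times> sym_gens G X)" by auto
  ultimately show ?case using Suc finite_subset by auto
qed simp

lemma word_ball_mult:
  assumes X: "X \<subseteq> carrier G" and a: "a \<in> word_ball G X m" and b: "b \<in> word_ball G X n"
  shows "a \<otimes> b \<in> word_ball G X (m + n)"
  using b
proof (induction n arbitrary: b)
  case 0
  then show ?case using word_ball_closed[OF X a] a by simp
next
  case (Suc n)
  have aG: "a \<in> carrier G" using a word_ball_carrier[OF X] by auto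
  from Suc.prems consider "b \<in> word_ball G X n"
    | c x where "b = c \<otimes> x" "c \<in> word_ball G X n" "x \<in> sym_gens G X" by auto
  then show ?case
  proof cases
    case 1
    then show ?thesis using Suc.IH by auto
  next
    case 2
    moreover have "a \<otimes> b = (a \<otimes> c) \<otimes> x"
      using 2 aG word_ball_closed[OF X] sym_gens_closed[OF X] by (metis m_assoc)
    ultimately show ?thesis using Suc.IH[of c] by auto
  qed
qed

lemma sym_gens_word_ball:
  assumes "X \<subseteq> carrier G" "x \<in> sym_gens G X"
  shows "x \<in> word_ball G X (Suc 0)"
proof -
  have "\<one> \<otimes> x = x" using sym_gens_closed[OF assms] by simp
  then show ?thesis using assms(2) by force
qed

lemma word_ball_inv:
  assumes X: "X \<subseteq> carrier G" and b: "b \<in> word_ball G X n"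
  shows "inv b \<in> word_ball G X n"
  using b
proof (induction n arbitrary: b)
  case (Suc n)
  from Suc.prems consider "b \<in> word_ball G X n"
    | c x where "b = c \<otimes> x" "c \<in> word_ball G X n" "x \<in> sym_gens G X" by auto
  then show ?case
  proof cases
    case 1
    then show ?thesis using Suc.IH by auto
  next
    case 2
    then have "inv b = inv x \<otimes> inv c"
      using word_ball_carrier[OF X, of n] sym_gens_carrier[OF X] by (auto intro: inv_mult_group)
    then show ?thesis
      using word_ball_mult[OF X sym_gens_word_ball[OF X sym_gens_inv[OF X 2(3)]] Suc.IH[OF 2(2)]]
      by simp
  qed
qed simp

lemma word_ball_split:
  assumes X: "X \<subseteq> carrier G" and g: "g \<in> word_ball G X (m + n)"
  shows "\<exists>a\<in>word_ball G X m. \<exists>b\<in>word_ball G X n. g = a \<otimes> b"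
  using g
proof (induction n arbitrary: g)
  case 0
  then show ?case using word_ball_carrier[OF X, of m] by (auto intro!: bexI[of _ g])
next
  case (Suc n)
  from Suc.prems consider "g \<in> word_ball G X (m + n)"
    | c x where "g = c \<otimes> x" "c \<in> word_ball G X (m + n)" "x \<in> sym_gens G X" by auto
  then show ?case
  proof cases
    case 1
    then show ?thesis using Suc.IH by fastforce
  next
    case 2
    then obtain a b where ab: "a \<in> word_ball G X m" "b \<in> word_ball G X n" "c = a \<otimes> b"
      using Suc.IH by blast
    moreover have "g = a \<otimes> (b \<otimes> x)"
      using 2 ab word_ball_carrier[OF X] sym_gens_carrier[OF X] by (auto simp: m_assoc subset_iff)
    moreover have "b \<otimes> x \<in> word_ball G X (Suc n)" using ab(2) 2(3) by auto
    ultimately show ?thesis by blast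
  qed
qed

lemma generate_word_ball:
  assumes X: "X \<subseteq> carrier G"
  shows "generate G X = (\<Union>n. word_ball G X n)"
proof
  show "generate G X \<subseteq> (\<Union>n. word_ball G X n)"
  proof
    fix g assume "g \<in> generate G X"
    then show "g \<in> (\<Union>n. word_ball G X n)"
    proof induction
      case one
      have "\<one> \<in> word_ball G X 0" by simp
      then show ?case by blast
    next
      case (incl h)
      then show ?case using sym_gens_word_ball[OF X, of h] by (auto simp: sym_gens_def simp del: word_ball.simps)
    next
      case (inv h)
      then show ?case using sym_gens_word_ball[OF X, of "inv h"] by (auto simp: sym_gens_def simp del: word_ball.simps)
    next
      case (eng h1 h2)
      then show ?case using word_ball_mult[OF X] by blast
    qed
  qed
  have "word_ball G X n \<subseteq> generate G X" for n
  proof (induction n)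
    case (Suc n)
    have "sym_gens G X \<subseteq> generate G X" by (auto simp: sym_gens_def generate.intros)
    then show ?case using Suc by (auto intro: generate.eng)
  qed (simp add: generate.one)
  then show "(\<Union>n. word_ball G X n) \<subseteq> generate G X" by blast
qed

context
  fixes Y
  assumes Y: "Y \<subseteq> carrier G" and genY: "generate G Y = carrier G"
begin

lemma word_length_le_iff:
  assumes g: "g \<in> carrier G"
  shows "word_length G Y g \<le> n \<longleftrightarrow> g \<in> word_ball G Y n"
proof
  assume le: "word_length G Y g \<le> n"
  obtain m where "g \<in> word_ball G Y m" using g genY generate_word_ball[OF Y] by auto
  then have "g \<in> word_ball G Y (word_length G Y g)" unfolding word_length_def by (rule LeastI)
  then show "g \<in> word_ball G Y n" using word_ball_mono[OF le, of G Y] by auto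
qed (auto simp: word_length_def intro: Least_le)

lemma word_dist_le_iff:
  assumes "g \<in> carrier G" "h \<in> carrier G"
  shows "word_dist G Y g h \<le> n \<longleftrightarrow> inv g \<otimes> h \<in> word_ball G Y n"
  using assms by (simp add: word_dist_def word_length_le_iff)

lemma word_dist_self: "g \<in> carrier G \<Longrightarrow> word_dist G Y g g = 0"
  using word_dist_le_iff[of g g 0] by simp

lemma word_dist_translate:
  assumes "k \<in> carrier G" "g \<in> carrier G" "h \<in> carrier G"
  shows "word_dist G Y (k \<otimes> g) (k \<otimes> h) = word_dist G Y g h"
proof -
  have "inv (k \<otimes> g) \<otimes> (k \<otimes> h) = inv g \<otimes> (inv k \<otimes> (k \<otimes> h))"
    using assms by (simp add: inv_mult_group m_assoc)
  also have "inv k \<otimes> (k \<otimes> h) = h" using assms by (simp add: m_assoc[symmetric])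
  finally show ?thesis by (simp add: word_dist_def)
qed

lemma word_dist_mult_right:
  assumes "g \<in> carrier G" "h \<in> carrier G"
  shows "word_dist G Y g (g \<otimes> h) = word_length G Y h"
  using assms by (simp add: word_dist_def m_assoc[symmetric])

lemma word_dist_sym:
  assumes gh: "g \<in> carrier G" "h \<in> carrier G"
  shows "word_dist G Y g h = word_dist G Y h g"
proof -
  have "word_dist G Y h g \<le> word_dist G Y g h" if gh: "g \<in> carrier G" "h \<in> carrier G" for g h
  proof -
    have "inv g \<otimes> h \<in> word_ball G Y (word_dist G Y g h)" using gh word_dist_le_iff by blast
    from word_ball_inv[OF Y this] show ?thesis
      using gh by (simp add: word_dist_le_iff inv_mult_group)
  qed
  then show ?thesis using gh by (simp add: antisym)
qed

lemma word_dist_triangle: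
  assumes "x \<in> carrier G" "y \<in> carrier G" "z \<in> carrier G"
  shows "word_dist G Y x z \<le> word_dist G Y x y + word_dist G Y y z"
proof -
  have "inv x \<otimes> y \<in> word_ball G Y (word_dist G Y x y)"
    "inv y \<otimes> z \<in> word_ball G Y (word_dist G Y y z)"
    using assms word_dist_le_iff by blast+
  from word_ball_mult[OF Y this]
  have "inv x \<otimes> y \<otimes> (inv y \<otimes> z) \<in> word_ball G Y (word_dist G Y x y + word_dist G Y y z)" .
  moreover have "inv x \<otimes> y \<otimes> (inv y \<otimes> z) = inv x \<otimes> z"
    using assms by (metis inv_closed inv_solve_left m_assoc m_closed)
  ultimately show ?thesis using assms by (simp add: word_dist_le_iff)
qed

lemma word_dist_geodesic_point:
  assumes xy: "x \<in> carrier G" "y \<in> carrier G" and n: "n \<le> word_dist G Y x y"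
  shows "\<exists>u\<in>carrier G. word_dist G Y x u = n \<and> word_dist G Y x u + word_dist G Y u y = word_dist G Y x y"
proof -
  define m where "m = word_dist G Y x y - n"
  have "inv x \<otimes> y \<in> word_ball G Y (n + m)"
    using xy n word_dist_le_iff[of x y "n + m"] by (simp add: m_def)
  then obtain a b where ab: "a \<in> word_ball G Y n" "b \<in> word_ball G Y m" "inv x \<otimes> y = a \<otimes> b"
    using word_ball_split[OF Y] by blast
  then have G: "a \<in> carrier G" "b \<in> carrier G" using word_ball_carrier[OF Y] by auto
  have y: "y = (x \<otimes> a) \<otimes> b"
    using ab(3) xy G by (metis inv_closed inv_solve_left m_assoc m_closed)
  have 1: "word_dist G Y x (x \<otimes> a) \<le> n"
    using xy G ab by (simp add: word_dist_mult_right word_length_le_iff)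
  have 2: "word_dist G Y (x \<otimes> a) y \<le> m"
    unfolding y using xy G ab by (simp add: word_dist_mult_right word_length_le_iff)
  have "word_dist G Y x y \<le> word_dist G Y x (x \<otimes> a) + word_dist G Y (x \<otimes> a) y"
    using word_dist_triangle xy G by simp
  then show ?thesis using 1 2 n xy G by (intro bexI[of _ "x \<otimes> a"]) (auto simp: m_def)
qed

end

context
  fixes Y
  assumes Y: "Y \<subseteq> carrier G" and genY: "generate G Y = carrier G"
begin

lemma Cayley_one_verts: "verts (Cayley G Y {\<one>}) = (\<lambda>g. {g}) ` carrier G"
  by (auto simp: Cayley_def mk_lgraph_def RCOSETS_def r_coset_def)

lemma Cayley_one_arcs:
  "arcs (Cayley G Y {\<one>}) = {({g}, x, {g \<otimes> x}) | g x. g \<in> carrier G \<and> x \<in> sym_gens G Y}"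
proof -
  have one: "{\<one>} #> g = {g}" if "g \<in> carrier G" for g using that by (simp add: r_coset_def)
  then have "({\<one>} #> g, x, {\<one>} #> (g \<otimes> x)) = ({g}, x, {g \<otimes> x})"
    if "g \<in> carrier G" "x \<in> sym_gens G Y" for g x using that sym_gens_closed[OF Y] by simp
  then show ?thesis unfolding Cayley_def mk_lgraph_def by (auto, blast+)
qed

lemma Cayley_one_ends: "tail (Cayley G Y {\<one>}) = fst" "head (Cayley G Y {\<one>}) = snd \<circ> snd"
  by (simp_all add: Cayley_def mk_lgraph_def)

lemma awalk_imp_word_ball:
  assumes "pre_digraph.awalk (Cayley G Y {\<one>}) {g} p V" "g \<in> carrier G"
  shows "\<exists>h\<in>carrier G. V = {h} \<and> inv g \<otimes> h \<in> word_ball G Y (length p)"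
  using assms
proof (induction p arbitrary: g)
  case Nil
  then show ?case
    using wf_digraph.awalk_Nil_iff[OF wf_digraph_Cayley[OF Y]] by auto
next
  case (Cons e p)
  have 1: "e \<in> arcs (Cayley G Y {\<one>})" "fst e = {g}"
    and 2: "pre_digraph.awalk (Cayley G Y {\<one>}) (snd (snd e)) p V"
    using Cons.prems wf_digraph.awalk_Cons_iff[OF wf_digraph_Cayley[OF Y]]
    by (auto simp: Cayley_one_ends)
  obtain x where x: "x \<in> sym_gens G Y" "e = ({g}, x, {g \<otimes> x})" using 1 Cayley_one_arcs by auto
  have xG: "x \<in> carrier G" using sym_gens_closed[OF Y x(1)] .
  then obtain h where h: "h \<in> carrier G" "V = {h}" "inv (g \<otimes> x) \<otimes> h \<in> word_ball G Y (length p)"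
    using Cons.IH[of "g \<otimes> x"] 2 x Cons.prems(2) by auto
  have "x \<otimes> (inv (g \<otimes> x) \<otimes> h) \<in> word_ball G Y (Suc 0 + length p)"
    using word_ball_mult[OF Y sym_gens_word_ball[OF Y x(1)] h(3)] .
  moreover have "x \<otimes> (inv (g \<otimes> x) \<otimes> h) = inv g \<otimes> h"
    using xG h(1) Cons.prems(2) by (simp add: inv_mult_group m_assoc[symmetric])
  ultimately show ?case using h by auto
qed

lemma word_ball_imp_awalk:
  assumes "b \<in> word_ball G Y n" "g \<in> carrier G"
  shows "\<exists>p. pre_digraph.awalk (Cayley G Y {\<one>}) {g} p {g \<otimes> b} \<and> length p \<le> n"
proof -
  interpret C: wf_digraph "Cayley G Y {\<one>}" using wf_digraph_Cayley[OF Y] .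
  show ?thesis using assms(1)
  proof (induction n arbitrary: b)
    case 0
    then show ?case
      using assms(2) by (intro exI[of _ "[]"]) (auto simp: C.awalk_Nil_iff Cayley_one_verts)
  next
    case (Suc n)
    from Suc.prems consider "b \<in> word_ball G Y n"
      | c x where "b = c \<otimes> x" "c \<in> word_ball G Y n" "x \<in> sym_gens G Y" by auto
    then show ?case
    proof cases
      case 1
      then show ?thesis using Suc.IH le_SucI by blast
    next
      case 2
      have G: "c \<in> carrier G" "x \<in> carrier G"
        using 2 word_ball_closed[OF Y] sym_gens_closed[OF Y] by blast+
      obtain p where p: "C.awalk {g} p {g \<otimes> c}" "length p \<le> n" using Suc.IH[OF 2(2)] by blast
      have "({g \<otimes> c}, x, {g \<otimes> b}) \<in> arcs (Cayley G Y {\<one>})"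
        using 2 G assms(2) m_assoc[of g c x] by (force simp: Cayley_one_arcs)
      from C.arc_implies_awalk[OF this]
      have "C.awalk {g} (p @ [({g \<otimes> c}, x, {g \<otimes> b})]) {g \<otimes> b}"
        using p by (auto simp: Cayley_one_ends intro: C.awalk_appendI)
      then show ?thesis using p by (intro exI[of _ "p @ [({g \<otimes> c}, x, {g \<otimes> b})]"]) auto
    qed
  qed
qed

lemma awalk_word_dist:
  assumes "g \<in> carrier G" "h \<in> carrier G"
  shows "(\<exists>p. pre_digraph.awalk (Cayley G Y {\<one>}) {g} p {h} \<and> length p \<le> n) \<longleftrightarrow> word_dist G Y g h \<le> n"
proof
  assume "\<exists>p. pre_digraph.awalk (Cayley G Y {\<one>}) {g} p {h} \<and> length p \<le> n"
  then obtain p where "pre_digraph.awalk (Cayley G Y {\<one>}) {g} p {h}" "length p \<le> n" by blast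
  then show "word_dist G Y g h \<le> n"
    using awalk_imp_word_ball[of g p "{h}"] assms word_ball_mono[of "length p" n G Y]
    by (auto simp: word_dist_le_iff[OF Y genY])
next
  assume "word_dist G Y g h \<le> n"
  then have "inv g \<otimes> h \<in> word_ball G Y n" using assms by (simp add: word_dist_le_iff[OF Y genY])
  from word_ball_imp_awalk[OF this assms(1)]
  show "\<exists>p. pre_digraph.awalk (Cayley G Y {\<one>}) {g} p {h} \<and> length p \<le> n"
    using assms by (simp add: m_assoc[symmetric])
qed

lemma geodesic_iff_word_dist:
  assumes "g \<in> carrier G" "h \<in> carrier G"
  shows "geodesic (Cayley G Y {\<one>}) {g} p {h} \<longleftrightarrow>
    pre_digraph.awalk (Cayley G Y {\<one>}) {g} p {h} \<and> length p = word_dist G Y g h"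
proof -
  have ub: "\<exists>q. pre_digraph.awalk (Cayley G Y {\<one>}) {g} q {h} \<and> length q \<le> word_dist G Y g h"
    using awalk_word_dist[OF assms] by simp
  have lb: "word_dist G Y g h \<le> length q" if "pre_digraph.awalk (Cayley G Y {\<one>}) {g} q {h}" for q
    using awalk_word_dist[OF assms, of "length q"] that by auto
  show ?thesis
  proof
    assume geo: "geodesic (Cayley G Y {\<one>}) {g} p {h}"
    then have "length p \<le> word_dist G Y g h" using ub by (auto simp: geodesic_def)
    then show "pre_digraph.awalk (Cayley G Y {\<one>}) {g} p {h} \<and> length p = word_dist G Y g h"
      using geo lb by (simp add: geodesic_def le_antisym)
  qed (simp add: geodesic_def lb)
qed

lemma geodesic_exists:
  assumes "g \<in> carrier G" "h \<in> carrier G"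
  shows "\<exists>p. geodesic (Cayley G Y {\<one>}) {g} p {h}"
proof -
  obtain p where p: "pre_digraph.awalk (Cayley G Y {\<one>}) {g} p {h}" "length p \<le> word_dist G Y g h"
    using awalk_word_dist[OF assms] by blast
  then have "word_dist G Y g h \<le> length p" using awalk_word_dist[OF assms] by blast
  then show ?thesis using p geodesic_iff_word_dist[OF assms] by auto
qed

text \<open>The vertices of geodesics are the points where the triangle inequality is an equality.\<close>

lemma geodesic_vertex_dist:
  assumes "g \<in> carrier G" "h \<in> carrier G" "geodesic (Cayley G Y {\<one>}) {g} p {h}"
    and "V \<in> path_verts (Cayley G Y {\<one>}) {g} p"
  shows "\<exists>u\<in>carrier G. V = {u} \<and> word_dist G Y g u + word_dist G Y u h = word_dist G Y g h"
proof -
  interpret C: wf_digraph "Cayley G Y {\<one>}" using wf_digraph_Cayley[OF Y] .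
  have p: "C.awalk {g} p {h}" "length p = word_dist G Y g h"
    using assms geodesic_iff_word_dist by auto
  obtain q r where qr: "p = q @ r" "C.awalk {g} q V" "C.awalk V r {h}"
    using C.awalk_decomp[OF p(1)] assms(4) unfolding path_verts_def by blast
  obtain u where u: "u \<in> carrier G" "V = {u}" using awalk_imp_word_ball[OF qr(2) assms(1)] by blast
  have "word_dist G Y g u \<le> length q" "word_dist G Y u h \<le> length r"
    using qr u assms awalk_word_dist by blast+
  moreover have "word_dist G Y g h \<le> word_dist G Y g u + word_dist G Y u h"
    using word_dist_triangle[OF Y genY] assms u by blast
  ultimately show ?thesis using u p qr by auto
qed

lemma geodesic_through:
  assumes G: "g \<in> carrier G" "h \<in> carrier G" "u \<in> carrier G"
    and u: "word_dist G Y g u + word_dist G Y u h = word_dist G Y g h"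
  shows "\<exists>p. geodesic (Cayley G Y {\<one>}) {g} p {h} \<and> {u} \<in> path_verts (Cayley G Y {\<one>}) {g} p"
proof -
  interpret C: wf_digraph "Cayley G Y {\<one>}" using wf_digraph_Cayley[OF Y] .
  obtain p where p: "C.awalk {g} p {u}" "length p = word_dist G Y g u"
    using geodesic_exists[OF G(1,3)] geodesic_iff_word_dist[OF G(1,3)] by blast
  obtain q where q: "C.awalk {u} q {h}" "length q = word_dist G Y u h"
    using geodesic_exists[OF G(3,2)] geodesic_iff_word_dist[OF G(3,2)] by blast
  have pq: "C.awalk {g} (p @ q) {h}" using C.awalk_appendI p q by blast
  then have "geodesic (Cayley G Y {\<one>}) {g} (p @ q) {h}"
    using p q u geodesic_iff_word_dist[OF G(1,2)] by simp
  moreover have "{u} \<in> set (C.awalk_verts {g} (p @ q))"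
  proof -
    have "{u} \<in> set (C.awalk_verts {g} p)"
      using p(1) last_in_set[OF C.awalk_verts_non_Nil, of "{g}" p] by (elim C.awalkE') simp
    then show ?thesis using C.set_awalk_verts_append[OF p(1) q(1)] by auto
  qed
  ultimately show ?thesis by (auto simp: path_verts_def)
qed

lemma neighborhood_iff_word_dist:
  assumes "g \<in> carrier G" "A \<subseteq> (\<lambda>h. {h}) ` carrier G"
  shows "{g} \<in> neighborhood (Cayley G Y {\<one>}) K A \<longleftrightarrow> (\<exists>h. {h} \<in> A \<and> word_dist G Y h g \<le> K)"
proof -
  have "(\<exists>p. pre_digraph.awalk (Cayley G Y {\<one>}) {h} p {g} \<and> length p \<le> K) \<longleftrightarrow> word_dist G Y h g \<le> K"
    if "{h} \<in> A" for h
  proof -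
    have "h \<in> carrier G" using that assms(2) by blast
    then show ?thesis by (rule awalk_word_dist[OF _ assms(1)])
  qed
  moreover have "{g} \<in> neighborhood (Cayley G Y {\<one>}) K A \<longleftrightarrow>
    (\<exists>h. {h} \<in> A \<and> (\<exists>p. pre_digraph.awalk (Cayley G Y {\<one>}) {h} p {g} \<and> length p \<le> K))"
  proof
    assume "{g} \<in> neighborhood (Cayley G Y {\<one>}) K A"
    then obtain V p where V: "V \<in> A" "pre_digraph.awalk (Cayley G Y {\<one>}) V p {g}" "length p \<le> K"
      by (auto simp: neighborhood_def)
    moreover obtain h where "V = {h}" using V(1) assms(2) by blast
    ultimately show "\<exists>h. {h} \<in> A \<and>
        (\<exists>p. pre_digraph.awalk (Cayley G Y {\<one>}) {h} p {g} \<and> length p \<le> K)" by blast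
  qed (unfold neighborhood_def, blast)
  ultimately show ?thesis by blast
qed

text \<open>Negative curvature and quasiconvexity speak of geodesic paths in the Cayley graph; in terms of the
  word metric they become slimness and quasiconvexity in the sense of \<open>slim_space\<close>.\<close>

lemma negatively_curved_slim:
  assumes "negatively_curved G Y"
  shows "\<exists>\<delta>. slim_space (carrier G) (word_dist G Y) \<delta>"
proof -
  let ?C = "Cayley G Y {\<one>}" and ?d = "word_dist G Y"
  obtain \<delta> where \<delta>: "\<forall>a b c p q r. geodesic ?C a p b \<and> geodesic ?C b q c \<and> geodesic ?C c r a \<longrightarrow>
      path_verts ?C a p \<subseteq> neighborhood ?C \<delta> (path_verts ?C b q \<union> path_verts ?C c r)"
    using assms unfolding negatively_curved_def Let_def by (elim exE)
  have "\<exists>v\<in>carrier G. ?d u v \<le> \<delta> \<and> (?d x v + ?d v z = ?d x z \<or> ?d z v + ?d v y = ?d z y)"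
    if G: "x \<in> carrier G" "y \<in> carrier G" "z \<in> carrier G" "u \<in> carrier G"
      and u: "?d x u + ?d u y = ?d x y" for x y z u
  proof -
    obtain p where p: "geodesic ?C {x} p {y}" "{u} \<in> path_verts ?C {x} p"
      using geodesic_through[OF G(1,2,4) u] by blast
    obtain q where q: "geodesic ?C {y} q {z}" using geodesic_exists[OF G(2,3)] by blast
    obtain r where r: "geodesic ?C {z} r {x}" using geodesic_exists[OF G(3,1)] by blast
    have sub: "path_verts ?C {y} q \<union> path_verts ?C {z} r \<subseteq> (\<lambda>h. {h}) ` carrier G"
      using geodesic_vertex_dist[OF G(2,3) q] geodesic_vertex_dist[OF G(3,1) r] by fast
    have "{u} \<in> neighborhood ?C \<delta> (path_verts ?C {y} q \<union> path_verts ?C {z} r)"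
      using \<delta>[rule_format, OF conjI[OF p(1) conjI[OF q r]]] p(2) by (rule subsetD)
    then obtain v where v: "{v} \<in> path_verts ?C {y} q \<union> path_verts ?C {z} r" "?d v u \<le> \<delta>"
      using neighborhood_iff_word_dist[OF G(4) sub] by blast
    have vG: "v \<in> carrier G" using v sub by blast
    from v(1) have "?d y v + ?d v z = ?d y z \<or> ?d z v + ?d v x = ?d z x"
      using geodesic_vertex_dist[OF G(2,3) q, of "{v}"] geodesic_vertex_dist[OF G(3,1) r, of "{v}"]
      by auto
    then have "?d x v + ?d v z = ?d x z \<or> ?d z v + ?d v y = ?d z y"
      using word_dist_sym[OF Y genY G(1) vG] word_dist_sym[OF Y genY G(2) vG]
        word_dist_sym[OF Y genY G(3) vG] word_dist_sym[OF Y genY G(1,3)]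
        word_dist_sym[OF Y genY G(2,3)] by linarith
    moreover have "?d u v \<le> \<delta>" using v(2) word_dist_sym[OF Y genY G(4) vG] by simp
    ultimately show ?thesis using vG by blast
  qed
  then have "slim_space (carrier G) ?d \<delta>"
    by (intro slim_space.intro word_dist_self[OF Y genY] word_dist_sym[OF Y genY]
      word_dist_triangle[OF Y genY] word_dist_geodesic_point[OF Y genY])
  then show ?thesis by blast
qed

lemma quasiconvex_word_dist:
  assumes "quasiconvex G Y H" "H \<subseteq> carrier G"
  shows "\<exists>K. \<forall>a\<in>H. \<forall>b\<in>H. \<forall>u\<in>carrier G.
    word_dist G Y a u + word_dist G Y u b = word_dist G Y a b \<longrightarrow> (\<exists>h\<in>H. word_dist G Y u h \<le> K)"
proof -
  let ?C = "Cayley G Y {\<one>}" and ?d = "word_dist G Y"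
  have VH: "(\<lambda>h. {\<one>} #> h) ` H = (\<lambda>h. {h}) ` H"
    using assms(2) by (intro image_cong) (auto simp: r_coset_def)
  obtain K where "\<forall>a\<in>(\<lambda>h. {h}) ` H. \<forall>b\<in>(\<lambda>h. {h}) ` H. \<forall>p. geodesic ?C a p b \<longrightarrow>
      path_verts ?C a p \<subseteq> neighborhood ?C K ((\<lambda>h. {h}) ` H)"
    using assms(1) unfolding quasiconvex_def Let_def VH by (elim exE)
  then have K: "\<And>a b p. a \<in> H \<Longrightarrow> b \<in> H \<Longrightarrow> geodesic ?C {a} p {b} \<Longrightarrow>
      path_verts ?C {a} p \<subseteq> neighborhood ?C K ((\<lambda>h. {h}) ` H)" by simp
  have "\<exists>h\<in>H. ?d u h \<le> K"
    if ab: "a \<in> H" "b \<in> H" and u: "u \<in> carrier G" "?d a u + ?d u b = ?d a b" for a b u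
  proof -
    obtain p where p: "geodesic ?C {a} p {b}" "{u} \<in> path_verts ?C {a} p"
      using geodesic_through[OF _ _ u] ab assms(2) by blast
    have "{u} \<in> neighborhood ?C K ((\<lambda>h. {h}) ` H)" using K[OF ab p(1)] p(2) by (rule subsetD)
    moreover have "(\<lambda>h. {h}) ` H \<subseteq> (\<lambda>h. {h}) ` carrier G" using assms(2) by (rule image_mono)
    ultimately obtain h where "h \<in> H" "?d h u \<le> K"
      using neighborhood_iff_word_dist[OF u(1)] by auto
    then show ?thesis using word_dist_sym[OF Y genY u(1), of h] assms(2) by (metis subsetD)
  qed
  then show ?thesis by blast
qed

end

end

section \<open>Coarse intersections of subgroups\<close>

context group
begin

context
  fixes Y
  assumes Y: "Y \<subseteq> carrier G" and genY: "generate G Y = carrier G" and finY: "finite Y"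
begin

text \<open>If \<open>h \<in> H1\<close> and \<open>h b \<in> H2\<close>, then \<open>h\<close> differs by an element of \<open>H1 \<inter> H2\<close> from any other
  \<open>h' \<in> H1\<close> with \<open>h' b \<in> H2\<close>; so one \<open>h'\<close> for each \<open>b\<close> in a ball bounds all distances.\<close>

lemma coarse_intersection:
  assumes H1: "subgroup H1 G" and H2: "subgroup H2 G"
  shows "\<exists>r'. \<forall>h\<in>H1. (\<exists>k\<in>H2. word_dist G Y h k \<le> r) \<longrightarrow> (\<exists>e\<in>H1 \<inter> H2. word_dist G Y h e \<le> r')"
proof -
  \<comment> \<open>\<open>c b\<close> is only meaningful if some \<open>h \<in> H1\<close> satisfies \<open>h b \<in> H2\<close>; other values can only enlarge \<open>r'\<close>.\<close>
  define c where "c b = (SOME h. h \<in> H1 \<and> h \<otimes> b \<in> H2)" for b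
  define r' where "r' = Max ((\<lambda>b. word_length G Y (inv (c b))) ` word_ball G Y r)"
  have "\<exists>e\<in>H1 \<inter> H2. word_dist G Y h e \<le> r'"
    if h: "h \<in> H1" and k: "k \<in> H2" and hk: "word_dist G Y h k \<le> r" for h k
  proof -
    have G: "h \<in> carrier G" "k \<in> carrier G"
      using h k subgroup.mem_carrier[OF H1] subgroup.mem_carrier[OF H2] by auto
    define b where "b = inv h \<otimes> k"
    have b: "b \<in> word_ball G Y r" "b \<in> carrier G" "h \<otimes> b = k"
      using hk G word_dist_le_iff[OF Y genY] by (auto simp: b_def m_assoc[symmetric])
    then have c: "c b \<in> H1" "c b \<otimes> b \<in> H2"
      using someI_ex[of "\<lambda>h. h \<in> H1 \<and> h \<otimes> b \<in> H2"] h k unfolding c_def by blast+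
    have cG: "c b \<in> carrier G" using subgroup.mem_carrier[OF H1 c(1)] .
    have "h \<otimes> inv (c b) = k \<otimes> inv (c b \<otimes> b)"
      using G cG b(2) unfolding b(3)[symmetric] by (simp add: group_normalize)
    then have "h \<otimes> inv (c b) \<in> H1 \<inter> H2"
      using h k c H1 H2 by (metis IntI subgroup.m_closed subgroup.m_inv_closed)
    moreover have "word_dist G Y h (h \<otimes> inv (c b)) \<le> r'"
      using G cG b(1) finite_word_ball[OF finY] unfolding r'_def
      by (simp add: word_dist_mult_right[OF Y genY])
    ultimately show ?thesis by blast
  qed
  then show ?thesis by blast
qed

text \<open>For \<open>u \<notin> H\<close> and any \<open>v\<close>, malnormality leaves at most one \<open>h \<in> H\<close> with \<open>h v \<in> u H\<close>: two of them
  would have their quotient in \<open>H \<inter> u H u\<^sup>-\<^sup>1\<close>.\<close>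

lemma malnormal_bounded_intersection:
  assumes H: "subgroup H G" and mal: "malnormal G H"
  shows "\<exists>B. \<forall>g\<in>carrier G - H. \<forall>p\<in>H. \<forall>q\<in>H. \<forall>a\<in>H. \<forall>b\<in>H.
    word_dist G Y p (g \<otimes> a) \<le> r \<and> word_dist G Y q (g \<otimes> b) \<le> r \<longrightarrow> word_dist G Y p q \<le> B"
proof -
  note HG = subgroup.mem_carrier[OF H]
  define E where "E u v = {h \<in> H. \<exists>k\<in>H. h \<otimes> v = u \<otimes> k}" for u v
  define U where "U = (\<Union>u\<in>word_ball G Y r - H. \<Union>v\<in>word_ball G Y r. E u v)"
  have "h = h'" if u: "u \<in> carrier G - H" and v: "v \<in> carrier G" and hh': "h \<in> E u v" "h' \<in> E u v" for u v h h'
  proof -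
    obtain k k' where k: "k \<in> H" "k' \<in> H" "h \<otimes> v = u \<otimes> k" "h' \<otimes> v = u \<otimes> k'" "h \<in> H" "h' \<in> H"
      using hh' by (auto simp: E_def)
    have G: "h \<in> carrier G" "h' \<in> carrier G" "k \<in> carrier G" "k' \<in> carrier G" "u \<in> carrier G"
      using HG k u by auto
    have "h \<otimes> inv h' = (h \<otimes> v) \<otimes> inv (h' \<otimes> v)"
      using G v by (simp add: group_normalize)
    also have "\<dots> = u \<otimes> (k \<otimes> inv k') \<otimes> inv u"
      using k G by (simp add: group_normalize)
    finally have "h \<otimes> inv h' \<in> (u <# H) #> inv u"
      using k H by (auto simp: l_coset_def r_coset_def subgroup.m_closed subgroup.m_inv_closed)
    moreover have "h \<otimes> inv h' \<in> H" using k H by (simp add: subgroup.m_closed subgroup.m_inv_closed)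
    ultimately have "h \<otimes> inv h' = \<one>" using mal u unfolding malnormal_def by blast
    then show ?thesis using G by (metis inv_closed inv_equality inv_inv)
  qed
  note unique = this
  have finE: "finite (E u v)" if "u \<in> carrier G - H" "v \<in> carrier G" for u v
  proof (cases "E u v = {}")
    case False
    then obtain h where "h \<in> E u v" by blast
    then have "E u v \<subseteq> {h}" using that unique by blast
    then show ?thesis using finite_subset by blast
  qed simp
  have "finite U" unfolding U_def
    using finite_word_ball[OF finY] word_ball_closed[OF Y] finE by blast
  have "word_dist G Y p q \<le> Max (word_length G Y ` U)"
    if g: "g \<in> carrier G - H" and pq: "p \<in> H" "q \<in> H" and ab: "a \<in> H" "b \<in> H"
      and r: "word_dist G Y p (g \<otimes> a) \<le> r" "word_dist G Y q (g \<otimes> b) \<le> r" for g p q a b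
  proof -
    have G: "p \<in> carrier G" "q \<in> carrier G" "a \<in> carrier G" "b \<in> carrier G" "g \<in> carrier G"
      using HG pq ab g by auto
    define u v where "u = inv p \<otimes> (g \<otimes> a)" and "v = inv q \<otimes> (g \<otimes> b)"
    have uv: "u \<in> word_ball G Y r" "v \<in> word_ball G Y r"
      using r G word_dist_le_iff[OF Y genY] by (auto simp: u_def v_def)
    have "u \<notin> H"
    proof
      assume "u \<in> H"
      then have "p \<otimes> u \<otimes> inv a \<in> H" using pq ab H by (simp add: subgroup.m_closed subgroup.m_inv_closed)
      moreover have "p \<otimes> u \<otimes> inv a = g"
        using G by (simp add: u_def group_normalize)
      ultimately show False using g by simp
    qed
    moreover have "inv p \<otimes> q \<otimes> v = u \<otimes> (inv a \<otimes> b)"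
      using G by (simp add: u_def v_def group_normalize)
    moreover have "inv p \<otimes> q \<in> H" "inv a \<otimes> b \<in> H"
      using pq ab H by (simp_all add: subgroup.m_closed subgroup.m_inv_closed)
    ultimately have "inv p \<otimes> q \<in> U" unfolding U_def E_def using uv by blast
    then show ?thesis unfolding word_dist_def using \<open>finite U\<close> by (intro Max_ge) auto
  qed
  then show ?thesis by blast
qed

text \<open>Points on a geodesic from \<open>\<one>\<close> to \<open>h \<in> H1 \<inter> H2\<close> are near \<open>H1\<close> and near \<open>H2\<close>, hence near
  \<open>H1 \<inter> H2\<close>; the elements met along the way differ by boundedly long elements of \<open>H1 \<inter> H2\<close>.\<close>

lemma fg_subgroup_Int:
  assumes H1: "subgroup H1 G" "quasiconvex G Y H1" and H2: "subgroup H2 G" "quasiconvex G Y H2"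
  shows "fg_subgroup G (H1 \<inter> H2)"
proof -
  let ?d = "word_dist G Y" and ?I = "H1 \<inter> H2"
  note sym = word_dist_sym[OF Y genY] and tri = word_dist_triangle[OF Y genY]
  have I: "subgroup ?I G" using subgroups_Inter_pair[OF H1(1) H2(1)] .
  note IG = subgroup.mem_carrier[OF I] and HG = subgroup.mem_carrier[OF H1(1)] subgroup.mem_carrier[OF H2(1)]
  obtain K1 where K1: "\<And>a b u. a \<in> H1 \<Longrightarrow> b \<in> H1 \<Longrightarrow> u \<in> carrier G \<Longrightarrow> ?d a u + ?d u b = ?d a b \<Longrightarrow>
      \<exists>h\<in>H1. ?d u h \<le> K1"
    using quasiconvex_word_dist[OF Y genY H1(2) subgroup.subset[OF H1(1)]] by blast
  obtain K2 where K2: "\<And>a b u. a \<in> H2 \<Longrightarrow> b \<in> H2 \<Longrightarrow> u \<in> carrier G \<Longrightarrow> ?d a u + ?d u b = ?d a b \<Longrightarrow>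
      \<exists>h\<in>H2. ?d u h \<le> K2"
    using quasiconvex_word_dist[OF Y genY H2(2) subgroup.subset[OF H2(1)]] by blast
  obtain r' where r': "\<And>h k. h \<in> H1 \<Longrightarrow> k \<in> H2 \<Longrightarrow> ?d h k \<le> K1 + K2 \<Longrightarrow> \<exists>e\<in>?I. ?d h e \<le> r'"
    using coarse_intersection[OF H1(1) H2(1), of "K1 + K2"] by blast
  \<comment> \<open>Consecutive points of the geodesic are at distance 1, so the elements of \<open>H1 \<inter> H2\<close> within \<open>R\<close> of
    them are at distance at most \<open>2 * R + 1\<close>.\<close>
  define R where "R = K1 + r'"
  define Z where "Z = ?I \<inter> word_ball G Y (2 * R + 1)"
  have finZ: "finite Z" using finite_word_ball[OF finY] unfolding Z_def by blast
  have step: "e' \<in> generate G Z"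
    if "e \<in> ?I" "e \<in> generate G Z" "e' \<in> ?I" "?d e e' \<le> 2 * R + 1" for e e'
  proof -
    have G: "e \<in> carrier G" "e' \<in> carrier G" using that IG by blast+
    have "inv e \<otimes> e' \<in> Z"
      using that(4) word_dist_le_iff[OF Y genY G] unfolding Z_def
      by (meson IntI subgroup.m_closed[OF I] subgroup.m_inv_closed[OF I] that(1,3))
    then have "e \<otimes> (inv e \<otimes> e') \<in> generate G Z" using that by (blast intro: generate.intros)
    then show ?thesis using G by (simp add: m_assoc[symmetric])
  qed
  have near: "\<exists>e\<in>?I. ?d u e \<le> R"
    if h: "h \<in> ?I" and u: "u \<in> carrier G" "?d \<one> u + ?d u h = ?d \<one> h" for u h
  proof -
    have "\<one> \<in> H1" "\<one> \<in> H2" using H1 H2 subgroup.one_closed by auto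
    then obtain a b where ab: "a \<in> H1" "?d u a \<le> K1" "b \<in> H2" "?d u b \<le> K2"
      using K1[OF _ _ u] K2[OF _ _ u] h by blast
    have G: "a \<in> carrier G" "b \<in> carrier G" using ab HG by auto
    have "?d a b \<le> K1 + K2" using tri[OF G(1) u(1) G(2)] ab sym[OF u(1) G(1)] by simp
    then obtain e where e: "e \<in> ?I" "?d a e \<le> r'" using r' ab by blast
    have "?d u e \<le> R" using tri[OF u(1) G(1) IG[OF e(1)]] ab e by (simp add: R_def)
    then show ?thesis using e by blast
  qed
  have walk: "\<exists>e\<in>?I. e \<in> generate G Z \<and> ?d u e \<le> R"
    if h: "h \<in> ?I" and u: "u \<in> carrier G" "?d \<one> u + ?d u h = ?d \<one> h" for u h
    using u
  proof (induction "?d \<one> u" arbitrary: u)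
    case 0
    have "u = \<one>" using 0 word_dist_le_iff[OF Y genY, of \<one> u 0] by simp
    then show ?case
      using subgroup.one_closed[OF I] generate.one word_dist_self[OF Y genY one_closed]
      by (intro bexI[of _ \<one>]) auto
  next
    case (Suc n)
    have hG: "h \<in> carrier G" using IG[OF h] .
    obtain u' where u': "u' \<in> carrier G" "?d \<one> u' = n" "?d \<one> u' + ?d u' u = ?d \<one> u"
      using word_dist_geodesic_point[OF Y genY one_closed Suc.prems(1), of n] Suc.hyps(2) by auto
    then have 1: "?d u' u = 1" using Suc.hyps(2) by simp
    have "?d \<one> u' + ?d u' h = ?d \<one> h"
      using tri[OF u'(1) Suc.prems(1) hG] tri[OF one_closed u'(1) hG] Suc.prems(2) u' 1 Suc.hyps(2)
      by simp
    then obtain e' where e': "e' \<in> ?I" "e' \<in> generate G Z" "?d u' e' \<le> R"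
      using Suc.hyps(1)[of u'] u' by blast
    obtain e where e: "e \<in> ?I" "?d u e \<le> R" using near[OF h Suc.prems] by blast
    have G: "e \<in> carrier G" "e' \<in> carrier G" using e e' IG by blast+
    have "?d e' e \<le> ?d e' u' + ?d u' e" "?d u' e \<le> ?d u' u + ?d u e"
      using tri G u' Suc.prems(1) by blast+
    then have "?d e' e \<le> 2 * R + 1" using e e' 1 sym[OF G(2) u'(1)] by simp
    then show ?case using step[OF e'(1,2) e(1)] e by blast
  qed
  have "?I \<subseteq> generate G Z"
  proof
    fix h assume h: "h \<in> ?I"
    then have hG: "h \<in> carrier G" using IG by blast
    then obtain e where e: "e \<in> ?I" "e \<in> generate G Z" "?d h e \<le> R"
      using walk[OF h hG] word_dist_self[OF Y genY hG] by auto
    then have "?d e h \<le> 2 * R + 1" using sym[OF hG IG[OF e(1)]] by simp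
    then show "h \<in> generate G Z" using step e h by blast
  qed
  moreover have "generate G Z \<subseteq> ?I" using generate_subgroup_incl[OF _ I, of Z] by (auto simp: Z_def)
  ultimately show ?thesis unfolding fg_subgroup_def using I finZ by (intro conjI exI[of _ Z]) (auto simp: Z_def)
qed

end

lemma fg_subgroup_conjugate:
  assumes S: "fg_subgroup G S" and g: "g \<in> carrier G"
  shows "fg_subgroup G ((\<lambda>s. inv g \<otimes> s \<otimes> g) ` S)"
proof -
  let ?c = "\<lambda>s. inv g \<otimes> s \<otimes> g"
  have sS: "subgroup S G" using S by (simp add: fg_subgroup_def)
  obtain Z where Z: "finite Z" "Z \<subseteq> S" "generate G Z = S" using S by (auto simp: fg_subgroup_def)
  have "?c \<in> hom G G" using g by (intro homI) (simp_all add: group_normalize)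
  then have hom: "group_hom G G ?c" by (intro group_hom.intro group_hom_axioms.intro is_group)
  have "Z \<subseteq> carrier G" using Z subgroup.subset[OF sS] by simp
  from group_hom.generate_img[OF hom this] have "generate G (?c ` Z) = ?c ` S" unfolding Z(3) .
  moreover have "subgroup (?c ` S) G" using group_hom.subgroup_img_is_subgroup[OF hom sS] .
  ultimately show ?thesis unfolding fg_subgroup_def
    using Z(1,2) by (intro conjI exI[of _ "?c ` Z"] finite_imageI image_mono)
qed

end

section \<open>Projections to the cosets of a malnormal subgroup\<close>

text \<open>In the application \<open>H\<close> is \<open>G0\<close>, and \<open>S\<close> is one of the two subgroups that meet it in \<open>D\<close>.\<close>

locale malnormal_quasiconvex = group G + slim_space "carrier G" "word_dist G Y" \<delta>
  for G (structure) and Y \<delta> +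
  fixes H S :: "'a set" and K KS :: nat
  assumes Y: "Y \<subseteq> carrier G" and genY: "generate G Y = carrier G" and finY: "finite Y"
    and H: "subgroup H G" and S: "subgroup S G" and mal: "malnormal G H"
    and qH: "qconvex K H" and qS: "qconvex KS S"
begin

abbreviation dist_G where "dist_G \<equiv> word_dist G Y"

abbreviation D where "D \<equiv> S \<inter> H"

lemmas closed [simp, intro] = subgroup.mem_carrier[OF H] subgroup.mem_carrier[OF S]

lemma D: "subgroup D G"
  by (rule subgroups_Inter_pair[OF S H])

lemma mult_H: "a \<in> H \<Longrightarrow> b \<in> H \<Longrightarrow> a \<otimes> b \<in> H" and inv_H: "a \<in> H \<Longrightarrow> inv a \<in> H"
  and mult_S: "a \<in> S \<Longrightarrow> b \<in> S \<Longrightarrow> a \<otimes> b \<in> S" and inv_S: "a \<in> S \<Longrightarrow> inv a \<in> S"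
  and one_H: "\<one> \<in> H" and one_S: "\<one> \<in> S"
  using H S by (simp_all add: subgroup.m_closed subgroup.m_inv_closed subgroup.one_closed)

lemma mult_mem_H_iff:
  assumes "a \<in> carrier G" "h \<in> H"
  shows "a \<otimes> h \<in> H \<longleftrightarrow> a \<in> H" "h \<otimes> a \<in> H \<longleftrightarrow> a \<in> H"
proof -
  have "a \<otimes> h \<otimes> inv h = a" "inv h \<otimes> (h \<otimes> a) = a" using assms by (simp_all add: group_normalize)
  then show "a \<otimes> h \<in> H \<longleftrightarrow> a \<in> H" "h \<otimes> a \<in> H \<longleftrightarrow> a \<in> H"
    using assms mult_H inv_H by metis+
qed

lemma translate: "k \<in> carrier G \<Longrightarrow> g \<in> carrier G \<Longrightarrow> h \<in> carrier G \<Longrightarrow>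
    dist_G (k \<otimes> g) (k \<otimes> h) = dist_G g h"
  by (rule word_dist_translate[OF Y genY])

lemma mem_coset: "x \<in> g <# H \<longleftrightarrow> (\<exists>h\<in>H. x = g \<otimes> h)"
  by (auto simp: l_coset_def)

lemma qconvex_coset:
  assumes g: "g \<in> carrier G"
  shows "qconvex K (g <# H)"
  unfolding qconvex_def
proof (intro conjI ballI allI impI)
  show "g <# H \<subseteq> carrier G" using g by (auto simp: mem_coset)
  fix x y u assume xy: "x \<in> g <# H" "y \<in> g <# H" and u: "between x u y"
  obtain a b where ab: "a \<in> H" "b \<in> H" "x = g \<otimes> a" "y = g \<otimes> b" using xy by (auto simp: mem_coset)
  have uG: "u \<in> carrier G" using u by (simp add: between_def)
  define v where "v = inv g \<otimes> u"
  have v: "v \<in> carrier G" "u = g \<otimes> v" using uG g by (auto simp: v_def group_normalize)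
  have "between a v b" using u ab v g by (auto simp: between_def translate)
  then obtain h where "h \<in> H" "dist_G v h \<le> K" using qH ab unfolding qconvex_def by blast
  then show "\<exists>h\<in>g <# H. dist_G u h \<le> K"
    using v g by (intro bexI[of _ "g \<otimes> h"]) (auto simp: mem_coset translate)
qed

lemma nearest_coset:
  assumes "g \<in> carrier G" "x \<in> carrier G" "p \<in> H"
  shows "nearest (g <# H) (g \<otimes> x) (g \<otimes> p) \<longleftrightarrow> nearest H x p"
proof -
  have "(\<forall>y\<in>g <# H. dist_G (g \<otimes> x) (g \<otimes> p) \<le> dist_G (g \<otimes> x) y) \<longleftrightarrow>
    (\<forall>h\<in>H. dist_G (g \<otimes> x) (g \<otimes> p) \<le> dist_G (g \<otimes> x) (g \<otimes> h))"
    by (auto simp: l_coset_def)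
  then show ?thesis using assms by (auto simp: nearest_def mem_coset translate)
qed

lemma nearest_closed: "nearest H x p \<Longrightarrow> p \<in> H"
  by (simp add: nearest_def)

text \<open>If two points of \<open>g H\<close> had distant projections to \<open>H\<close>, the geodesic between them would stay
  near \<open>g H\<close> and pass near both projections, so these would lie in the bounded coarse intersection of
  \<open>H\<close> and \<open>g H\<close>.\<close>

lemma coset_projection_bounded:
  "\<exists>B. \<forall>g\<in>carrier G - H. \<forall>a\<in>H. \<forall>b\<in>H. \<forall>p q. nearest H (g \<otimes> a) p \<longrightarrow> nearest H (g \<otimes> b) q \<longrightarrow>
     dist_G p q \<le> B"
proof -
  define r where "r = fellow K + K"
  obtain B where B: "\<And>g p q a b. g \<in> carrier G - H \<Longrightarrow> p \<in> H \<Longrightarrow> q \<in> H \<Longrightarrow> a \<in> H \<Longrightarrow> b \<in> H \<Longrightarrow>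
      dist_G p (g \<otimes> a) \<le> r \<Longrightarrow> dist_G q (g \<otimes> b) \<le> r \<Longrightarrow> dist_G p q \<le> B"
    using malnormal_bounded_intersection[OF Y genY finY H mal, of r] by blast
  have near: "\<exists>c\<in>H. dist_G p (g \<otimes> c) \<le> r"
    if g: "g \<in> carrier G - H" and ab: "a \<in> H" "b \<in> H"
      and pq: "nearest H (g \<otimes> a) p" "nearest H (g \<otimes> b) q" and far: "jump K \<le> dist_G p q" for g a b p q
  proof -
    have G: "g \<otimes> a \<in> carrier G" "g \<otimes> b \<in> carrier G" "p \<in> carrier G"
      using g ab nearest_closed[OF pq(1)] by auto
    obtain v where v: "between (g \<otimes> a) v (g \<otimes> b)" "dist_G p v \<le> fellow K"
      using projections_far_apart[OF qH pq G(1,2) far] by blast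
    have "g \<otimes> a \<in> g <# H" "g \<otimes> b \<in> g <# H" using ab by (auto simp: mem_coset)
    then obtain x where x: "x \<in> g <# H" "dist_G v x \<le> K"
      using v(1) qconvex_coset[of g] g unfolding qconvex_def by blast
    then obtain c where c: "c \<in> H" "x = g \<otimes> c" by (auto simp: mem_coset)
    have "v \<in> carrier G" "x \<in> carrier G" using v c g by (auto simp: between_def)
    then have "dist_G p x \<le> dist_G p v + dist_G v x" using dist_triangle G by blast
    then have "dist_G p x \<le> r" using x v by (simp add: r_def)
    then show ?thesis using c by blast
  qed
  have "dist_G p q \<le> max (jump K) B"
    if g: "g \<in> carrier G - H" and ab: "a \<in> H" "b \<in> H"
      and pq: "nearest H (g \<otimes> a) p" "nearest H (g \<otimes> b) q" for g a b p q
  proof (cases "jump K \<le> dist_G p q")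
    case True
    have "dist_G q p = dist_G p q" using dist_sym nearest_closed pq by blast
    then obtain c c' where "c \<in> H" "dist_G p (g \<otimes> c) \<le> r" "c' \<in> H" "dist_G q (g \<otimes> c') \<le> r"
      using near[OF g ab pq True] near[OF g ab(2,1) pq(2,1)] True by auto
    then show ?thesis using B[OF g nearest_closed[OF pq(1)] nearest_closed[OF pq(2)]] by fastforce
  qed simp
  then show ?thesis by blast
qed

text \<open>A geodesic from \<open>\<one>\<close> to \<open>s a\<close> stays near \<open>S\<close>. If the projection of \<open>s a\<close> to \<open>H\<close> is far from
  \<open>\<one>\<close>, the geodesic passes near it, so the projection is near \<open>S\<close> and \<open>H\<close>, and hence near \<open>D\<close>.\<close>

lemma projection_near_intersection:
  assumes A: "finite A" "A \<subseteq> carrier G"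
  shows "\<exists>C. \<forall>s\<in>S. \<forall>a\<in>A. \<forall>p. nearest H (s \<otimes> a) p \<longrightarrow> (\<exists>e\<in>D. dist_G p e \<le> C)"
proof -
  define m where "m = Max (insert 0 (word_length G Y ` A))"
  define r where "r = fellow K + \<delta> + KS + m"
  obtain C where C: "\<And>h k. h \<in> H \<Longrightarrow> k \<in> S \<Longrightarrow> dist_G h k \<le> r \<Longrightarrow> \<exists>e\<in>H \<inter> S. dist_G h e \<le> C"
    using coarse_intersection[OF Y genY finY H S, of r] by blast
  have "\<exists>e\<in>D. dist_G p e \<le> max (jump K) C"
    if s: "s \<in> S" and a: "a \<in> A" and p: "nearest H (s \<otimes> a) p" for s a p
  proof -
    have G: "s \<in> carrier G" "a \<in> carrier G" "p \<in> carrier G" "p \<in> H" "s \<otimes> a \<in> carrier G"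
      using s a A p nearest_closed by auto
    have one: "nearest H \<one> \<one>" using one_H dist_self[OF one_closed] by (auto simp: nearest_def)
    show ?thesis
    proof (cases "jump K \<le> dist_G p \<one>")
      case True
      obtain v where v: "between (s \<otimes> a) v \<one>" "dist_G p v \<le> fellow K"
        using projections_far_apart[OF qH p one G(5) one_closed True] by blast
      obtain w where w: "dist_G v w \<le> \<delta>" "between (s \<otimes> a) w s \<or> between s w \<one>"
        using between_slim[OF v(1) G(1)] by blast
      have wG: "w \<in> carrier G" "v \<in> carrier G" using w v by (auto simp: between_def)
      have "\<exists>k\<in>S. dist_G w k \<le> KS + m"
        using w(2)
      proof
        assume "between (s \<otimes> a) w s"
        then have "dist_G w s \<le> dist_G s (s \<otimes> a)"
          using dist_sym[OF G(1,5)] by (simp add: between_def)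
        also have "\<dots> = word_length G Y a" using G by (simp add: word_dist_mult_right[OF Y genY])
        also have "\<dots> \<le> m" using A a unfolding m_def by (intro Max_ge) auto
        finally show ?thesis using s trans_le_add2 by blast
      next
        assume "between s w \<one>"
        then obtain k where "k \<in> S" "dist_G w k \<le> KS" using qS s one_S unfolding qconvex_def by blast
        then show ?thesis by (intro bexI[of _ k]) auto
      qed
      then obtain k where k: "k \<in> S" "dist_G w k \<le> KS + m" by blast
      have "dist_G p k \<le> dist_G p v + dist_G v k" "dist_G v k \<le> dist_G v w + dist_G w k"
        using dist_triangle G wG k by blast+
      then have "dist_G p k \<le> r" using v w k by (simp add: r_def)
      then obtain e where "e \<in> D" "dist_G p e \<le> C" using C[OF G(4) k(1)] by blast
      then show ?thesis using max.coboundedI2 by blast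
    next
      case False
      then show ?thesis using one_H one_S by (intro bexI[of _ \<one>]) auto
    qed
  qed
  then show ?thesis by blast
qed

text \<open>The coset \<open>s a H\<close> has a bounded projection if it differs from \<open>H\<close>, so all of its points project
  near the projection of \<open>s a\<close>, and the bound does not depend on \<open>s\<close>.\<close>

lemma coset_projection_near_intersection:
  assumes A: "finite A" "A \<subseteq> carrier G"
  shows "\<exists>C. \<forall>s\<in>S. \<forall>a\<in>A. s \<otimes> a \<notin> H \<longrightarrow>
    (\<forall>h\<in>H. \<forall>p. nearest H (s \<otimes> a \<otimes> h) p \<longrightarrow> (\<exists>e\<in>D. dist_G p e \<le> C))"
proof -
  obtain B where B: "\<And>g a b p q. g \<in> carrier G - H \<Longrightarrow> a \<in> H \<Longrightarrow> b \<in> H \<Longrightarrow> nearest H (g \<otimes> a) p \<Longrightarrow>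
      nearest H (g \<otimes> b) q \<Longrightarrow> dist_G p q \<le> B"
    using coset_projection_bounded by blast
  obtain C where C: "\<And>s a p. s \<in> S \<Longrightarrow> a \<in> A \<Longrightarrow> nearest H (s \<otimes> a) p \<Longrightarrow> \<exists>e\<in>D. dist_G p e \<le> C"
    using projection_near_intersection[OF A] by blast
  have "\<exists>e\<in>D. dist_G p e \<le> B + C"
    if s: "s \<in> S" and a: "a \<in> A" and sa: "s \<otimes> a \<notin> H" and h: "h \<in> H" and p: "nearest H (s \<otimes> a \<otimes> h) p"
    for s a h p
  proof -
    have G: "s \<otimes> a \<in> carrier G" using s a A by auto
    obtain q where q: "nearest H (s \<otimes> a) q" using nearest_exists one_H by blast
    have "dist_G p q \<le> B" using B[of "s \<otimes> a" h \<one> p q] G sa h p q one_H by simp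
    moreover obtain e where e: "e \<in> D" "dist_G q e \<le> C" using C[OF s a q] by blast
    moreover have "dist_G p e \<le> dist_G p q + dist_G q e"
      using dist_triangle nearest_closed p q e by blast
    ultimately show ?thesis by (intro bexI[of _ e]) auto
  qed
  then show ?thesis by blast
qed

end

section \<open>The subgroup generated by \<open>S\<close> and a deep subgroup of \<open>H\<close>\<close>

text \<open>The products \<open>l1 s1 ... ln sn\<close> with \<open>li \<in> L - S\<close> and \<open>si \<in> S - L\<close>, except that the last letter may be
  any element of \<open>S\<close>. Letters are added on the left, which is the side on which \<open>G\<close> acts on cosets.\<close>

inductive_set alternating :: "('a, 'm) monoid_scheme \<Rightarrow> 'a set \<Rightarrow> 'a set \<Rightarrow> 'a set" for G (structure) and S L where
  base: "l \<in> L - S \<Longrightarrow> s \<in> S \<Longrightarrow> l \<otimes> s \<in> alternating G S L"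
| step: "l \<in> L - S \<Longrightarrow> s \<in> S - L \<Longrightarrow> w \<in> alternating G S L \<Longrightarrow> l \<otimes> (s \<otimes> w) \<in> alternating G S L"

context group
begin

lemma alternating_closed:
  assumes "subgroup S G" "subgroup L G" "w \<in> alternating G S L"
  shows "w \<in> carrier G"
  using assms(3)
proof induction
  case (base l s)
  then show ?case using subgroup.mem_carrier[OF assms(1)] subgroup.mem_carrier[OF assms(2)] by simp
next
  case (step l s w)
  then show ?case using subgroup.mem_carrier[OF assms(1)] subgroup.mem_carrier[OF assms(2)] by simp
qed

text \<open>A letter from \<open>S \<inter> L\<close> can be absorbed into its neighbours; so the set on the right is closed under
  left multiplication by \<open>S\<close> and by \<open>L\<close>.\<close>

lemma generate_Un_alternating:
  assumes S: "subgroup S G" and L: "subgroup L G"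
  shows "generate G (S \<union> L) \<subseteq> S \<union> {s \<otimes> w | s w. s \<in> S \<and> w \<in> alternating G S L}"
proof -
  define N where "N = S \<union> {s \<otimes> w | s w. s \<in> S \<and> w \<in> alternating G S L}"
  have SG: "s \<in> carrier G" if "s \<in> S" for s using subgroup.mem_carrier[OF S that] .
  have LG: "l \<in> carrier G" if "l \<in> L" for l using subgroup.mem_carrier[OF L that] .
  have AG: "w \<in> carrier G" if "w \<in> alternating G S L" for w using alternating_closed[OF S L that] .
  note multSS = subgroup.m_closed[OF S] and multLL = subgroup.m_closed[OF L]
  have SN: "s \<in> N" if "s \<in> S" for s using that by (simp add: N_def)
  have NI: "s \<otimes> w \<in> N" if "s \<in> S" "w \<in> alternating G S L" for s w
    using that unfolding N_def by blast
  have NE: thesis if "k \<in> N" "k \<in> S \<Longrightarrow> thesis"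
      "\<And>s w. k = s \<otimes> w \<Longrightarrow> s \<in> S \<Longrightarrow> w \<in> alternating G S L \<Longrightarrow> thesis" for k thesis
    using that unfolding N_def by blast
  have NG: "k \<in> carrier G" if "k \<in> N" for k
    using that by (rule NE) (simp_all add: SG AG)
  have one: "\<one> \<in> S" using S by (rule subgroup.one_closed)
  have altN: "w \<in> N" if "w \<in> alternating G S L" for w
    using NI[OF one that] AG[OF that] by simp
  have multS: "s \<otimes> k \<in> N" if s: "s \<in> S" and k: "k \<in> N" for s k
    using k
  proof (rule NE)
    assume "k \<in> S"
    then show ?thesis using SN multSS s by blast
  next
    fix s' w assume k: "k = s' \<otimes> w" "s' \<in> S" "w \<in> alternating G S L"
    then have "s \<otimes> k = (s \<otimes> s') \<otimes> w" using s SG AG by (simp add: m_assoc)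
    then show ?thesis using NI[OF multSS[OF s k(2)] k(3)] by simp
  qed
  have multL_alt: "l \<otimes> w \<in> N" if l: "l \<in> L" and w: "w \<in> alternating G S L" for l w
    using w
  proof cases
    case (base l' s)
    have e: "l \<otimes> w = (l \<otimes> l') \<otimes> s" using base l SG LG by (simp add: m_assoc)
    have "l \<otimes> l' \<in> L" using l base multLL by blast
    show ?thesis
    proof (cases "l \<otimes> l' \<in> S")
      case True
      then show ?thesis unfolding e using SN multSS base by blast
    next
      case False
      then show ?thesis
        unfolding e using base \<open>l \<otimes> l' \<in> L\<close> by (intro altN alternating.base) auto
    qed
  next
    case (step l' s w')
    have e: "l \<otimes> w = (l \<otimes> l') \<otimes> (s \<otimes> w')" using step l SG LG AG by (simp add: m_assoc)
    have "l \<otimes> l' \<in> L" using l step multLL by blast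
    show ?thesis
    proof (cases "l \<otimes> l' \<in> S")
      case True
      have "l \<otimes> w = (l \<otimes> l' \<otimes> s) \<otimes> w'" using step l SG LG AG e by (simp add: m_assoc)
      then show ?thesis using NI[OF multSS[OF True] step(4), of s] step by simp
    next
      case False
      then show ?thesis
        unfolding e using step \<open>l \<otimes> l' \<in> L\<close> by (intro altN alternating.step) auto
    qed
  qed
  have multL: "l \<otimes> k \<in> N" if l: "l \<in> L" and k: "k \<in> N" for l k
  proof (cases "l \<in> S")
    case True
    then show ?thesis using multS k by blast
  next
    case lS: False
    from k show ?thesis
    proof (rule NE)
      assume "k \<in> S"
      then show ?thesis using altN[OF alternating.base[of l L S k]] lS l by simp
    next
      fix s w assume k: "k = s \<otimes> w" "s \<in> S" "w \<in> alternating G S L"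
      show ?thesis
      proof (cases "s \<in> L")
        case True
        have "l \<otimes> k = (l \<otimes> s) \<otimes> w" using k l SG LG AG by (simp add: m_assoc)
        then show ?thesis using multL_alt[OF multLL[OF l True] k(3)] by simp
      next
        case False
        then show ?thesis unfolding k(1) using k lS l by (intro altN alternating.step) auto
      qed
    qed
  qed
  have genG: "generate G (S \<union> L) \<subseteq> carrier G"
    using generate_incl[of "S \<union> L"] subgroup.subset[OF S] subgroup.subset[OF L] by blast
  have gen: "\<forall>k\<in>N. g \<otimes> k \<in> N" if "g \<in> generate G (S \<union> L)" for g
    using that
  proof induction
    case one
    then show ?case using NG by simp
  next
    case (incl h)
    then show ?case using multS multL by blast
  next
    case (inv h)
    then have "inv h \<in> S \<or> inv h \<in> L"
      using subgroup.m_inv_closed[OF S] subgroup.m_inv_closed[OF L] by blast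
    then show ?case using multS multL by blast
  next
    case (eng g h)
    then have "g \<in> carrier G" "h \<in> carrier G" using genG by blast+
    then have "g \<otimes> h \<otimes> k = g \<otimes> (h \<otimes> k)" if "k \<in> N" for k using NG[OF that] by (simp add: m_assoc)
    then show ?case using eng.IH by simp
  qed
  have "generate G (S \<union> L) \<subseteq> N"
  proof
    fix g assume g: "g \<in> generate G (S \<union> L)"
    then have "g \<otimes> \<one> \<in> N" using gen SN[OF one] by blast
    then show "g \<in> N" using g genG by auto
  qed
  then show ?thesis by (simp add: N_def)
qed

end

context malnormal_quasiconvex
begin

text \<open>The ping-pong argument. Call \<open>z\<close> far if it lies outside \<open>H\<close> and projects to \<open>H\<close> far from \<open>D\<close>.
  If \<open>z\<close> is far and \<open>s \<in> S - D\<close>, then \<open>s\<^sup>-\<^sup>1 H\<close> projects to \<open>H\<close> near \<open>D\<close>, so Behrstock's inequality for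
  \<open>H\<close>, \<open>s\<^sup>-\<^sup>1 H\<close> and \<open>z\<close> forces \<open>s z\<close> to project to \<open>H\<close> near \<open>D\<close>; a long element of \<open>L - D\<close> then makes it
  far again. For \<open>a = \<one>\<close> the products that collapse into \<open>L\<close> have to be left out, since they do not leave \<open>H\<close>.\<close>

lemma alternating_avoids:
  assumes A: "finite A" "A \<subseteq> carrier G" "\<one> \<in> A"
  shows "\<exists>n. \<forall>L. subgroup L G \<and> D \<subseteq> L \<and> L \<subseteq> H \<and> (\<forall>l\<in>L - D. n < word_length G Y l) \<longrightarrow>
    (\<forall>w\<in>alternating G S L. \<forall>a\<in>A. (\<forall>s\<in>S. s \<otimes> a \<notin> H) \<or> a = \<one> \<and> w \<notin> L \<longrightarrow>
       (\<forall>s\<in>S. \<forall>b\<in>A. \<forall>h\<in>H. w \<otimes> a \<noteq> s \<otimes> b \<otimes> h))"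
proof -
  obtain C where C: "\<And>s a h p. s \<in> S \<Longrightarrow> a \<in> A \<Longrightarrow> s \<otimes> a \<notin> H \<Longrightarrow> h \<in> H \<Longrightarrow>
      nearest H (s \<otimes> a \<otimes> h) p \<Longrightarrow> \<exists>e\<in>D. dist_G p e \<le> C"
    using coset_projection_near_intersection[OF A(1,2)] by blast
  \<comment> \<open>The error \<open>4 * fellow K\<close> of Behrstock's inequality comes on top of the distance \<open>C\<close> of the
    projection of a coset \<open>s a H\<close> from \<open>D\<close>.\<close>
  define R where "R = C + 4 * fellow K"
  define far where "far z \<longleftrightarrow> z \<in> carrier G \<and> z \<notin> H \<and> (\<forall>p. nearest H z p \<longrightarrow> (\<forall>e\<in>D. R < dist_G p e))" for z
  define near where "near z \<longleftrightarrow> z \<in> carrier G \<and> z \<notin> H \<and> (\<forall>p. nearest H z p \<longrightarrow> (\<exists>e\<in>D. dist_G p e \<le> R))" for z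
  have disjoint: False if "far z" "near z" for z
    using that nearest_exists[of H z] one_H unfolding far_def near_def by (metis empty_iff not_le)
  have nearI: "near (s \<otimes> b \<otimes> h)" if s: "s \<in> S" and b: "b \<in> A" and h: "h \<in> H" and sb: "s \<otimes> b \<notin> H" for s b h
  proof -
    have G: "s \<otimes> b \<in> carrier G" using s b A by auto
    then have "s \<otimes> b \<otimes> h \<in> carrier G" "s \<otimes> b \<otimes> h \<notin> H" using h sb mult_mem_H_iff(1) by auto
    moreover have "\<exists>e\<in>D. dist_G p e \<le> R" if "nearest H (s \<otimes> b \<otimes> h) p" for p
      using C[OF s b sb h that] trans_le_add1 unfolding R_def by blast
    ultimately show ?thesis by (auto simp: near_def)
  qed
  have farD: "z \<noteq> s \<otimes> b \<otimes> h" if "far z" "s \<in> S" "b \<in> A" "h \<in> H" for z s b h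
  proof
    assume z: "z = s \<otimes> b \<otimes> h"
    have "s \<otimes> b \<in> carrier G" using that A by auto
    then have "s \<otimes> b \<notin> H" using that z mult_mem_H_iff(1) by (auto simp: far_def)
    then show False using nearI[of s b h] disjoint that z by blast
  qed
  have swing: "near (s \<otimes> z)" if z: "far z" and s: "s \<in> S" "s \<notin> H" for s z
  proof -
    have G: "z \<in> carrier G" "s \<in> carrier G" using z s by (auto simp: far_def)
    have invs: "inv s \<in> S" "inv s \<otimes> \<one> \<notin> H" "inv s \<in> carrier G"
      using s G inv_S inv_H[of "inv s"] by auto
    have sz: "s \<otimes> z \<notin> H"
    proof
      assume "s \<otimes> z \<in> H"
      moreover have "z = inv s \<otimes> \<one> \<otimes> (s \<otimes> z)" using G by (simp add: group_normalize)
      ultimately show False using farD[OF z invs(1) A(3)] by blast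
    qed
    have "\<exists>e\<in>D. dist_G p' e \<le> R" if p': "nearest H (s \<otimes> z) p'" for p'
    proof -
      have p'H: "p' \<in> H" using nearest_closed[OF p'] .
      define q where "q = inv s \<otimes> p'"
      have q: "nearest (inv s <# H) z q"
        using nearest_coset[OF invs(3), of "s \<otimes> z" p'] p' p'H G by (simp add: q_def group_normalize)
      obtain p where p: "nearest H z p" using nearest_exists one_H by blast
      obtain u where u: "nearest H q u" using nearest_exists one_H by blast
      obtain w' where w': "nearest H (s \<otimes> p) w'" using nearest_exists one_H by blast
      have pH: "p \<in> H" "u \<in> H" "w' \<in> H" using nearest_closed p u w' by auto
      have w: "nearest (inv s <# H) p (inv s \<otimes> w')"
        using nearest_coset[OF invs(3), of "s \<otimes> p" w'] w' pH G by (simp add: group_normalize)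
      have "nearest H (inv s \<otimes> \<one> \<otimes> p') u" using u G by (simp add: q_def)
      then obtain e where e: "e \<in> D" "dist_G u e \<le> C" using C[OF invs(1) A(3) invs(2) p'H] by blast
      have "dist_G p e \<le> dist_G p u + dist_G u e" using dist_triangle pH e by blast
      moreover have "R < dist_G p e" using z p e by (auto simp: far_def)
      ultimately have "\<not> dist_G p u \<le> 4 * fellow K" using e by (simp add: R_def)
      then have "dist_G q (inv s \<otimes> w') \<le> 4 * fellow K"
        using behrstock[OF qH qconvex_coset[OF invs(3)] G(1) p q u w] by blast
      then have 1: "dist_G p' w' \<le> 4 * fellow K" using translate invs(3) p'H pH by (simp add: q_def)
      have "nearest H (s \<otimes> \<one> \<otimes> p) w'" "s \<otimes> \<one> \<notin> H" using w' G s by auto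
      then obtain e' where e': "e' \<in> D" "dist_G w' e' \<le> C" using C[OF s(1) A(3) _ pH(1)] by blast
      have "dist_G p' e' \<le> dist_G p' w' + dist_G w' e'" using dist_triangle pH p'H e' by blast
      then show ?thesis using 1 e' by (intro bexI[of _ e']) (auto simp: R_def)
    qed
    then show ?thesis using sz G by (auto simp: near_def)
  qed
  \<comment> \<open>A point within \<open>R\<close> of both \<open>D\<close> and \<open>l D\<close> yields an element of \<open>D l D\<close> of length at most \<open>2 * R\<close>.\<close>
  show ?thesis
  proof (intro exI[of _ "2 * R"] allI impI, elim conjE)
    fix L assume L: "subgroup L G" and DL: "D \<subseteq> L" and LH: "L \<subseteq> H"
      and long: "\<forall>l\<in>L - D. 2 * R < word_length G Y l"
    have push: "far (l \<otimes> z)" if z: "near z" and l: "l \<in> L" "l \<notin> S" for z l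
    proof -
      have G: "z \<in> carrier G" "l \<in> carrier G" "l \<in> H" using z l LH by (auto simp: near_def)
      have "R < dist_G p e'" if p: "nearest H (l \<otimes> z) p" and e': "e' \<in> D" for p e'
      proof (rule ccontr)
        assume le: "\<not> R < dist_G p e'"
        have pH: "p \<in> H" using nearest_closed[OF p] .
        have HH: "inv l <# H = H" using G coset_join3[OF _ H] inv_H by simp
        have "nearest (inv l <# H) (inv l \<otimes> (l \<otimes> z)) (inv l \<otimes> p)"
          using nearest_coset[of "inv l" "l \<otimes> z" p] p pH G by simp
        then have "nearest H z (inv l \<otimes> p)" unfolding HH using G by (simp add: group_normalize)
        then obtain e where e: "e \<in> D" "dist_G (inv l \<otimes> p) e \<le> R" using z by (auto simp: near_def)
        have eG: "e \<in> carrier G" "e' \<in> carrier G" "p \<in> carrier G" using e e' pH by auto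
        have "dist_G p (l \<otimes> e) \<le> R"
          using translate[of l "inv l \<otimes> p" e] e eG G by (simp add: group_normalize)
        then have "dist_G (l \<otimes> e) e' \<le> 2 * R"
          using dist_triangle[of "l \<otimes> e" p e'] dist_sym[of "l \<otimes> e" p] eG G le by simp
        then have "word_length G Y (inv (l \<otimes> e) \<otimes> e') \<le> 2 * R" by (simp add: word_dist_def)
        moreover have "inv (l \<otimes> e) \<otimes> e' \<in> L"
          using L l DL e e' by (auto intro!: subgroup.m_closed subgroup.m_inv_closed)
        moreover have "inv (l \<otimes> e) \<otimes> e' \<notin> S"
        proof
          assume "inv (l \<otimes> e) \<otimes> e' \<in> S"
          then have "e' \<otimes> inv (inv (l \<otimes> e) \<otimes> e') \<otimes> inv e \<in> S"
            using e e' mult_S inv_S by blast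
          moreover have "e' \<otimes> inv (inv (l \<otimes> e) \<otimes> e') \<otimes> inv e = l"
            using eG G by (simp add: group_normalize)
          ultimately show False using l by simp
        qed
        ultimately show False using long by (auto dest!: bspec[of _ _ "inv (l \<otimes> e) \<otimes> e'"])
      qed
      moreover have "l \<otimes> z \<notin> H" using mult_mem_H_iff G z by (simp add: near_def)
      ultimately show ?thesis using G by (auto simp: far_def)
    qed
    have SL: "s \<notin> H" if "s \<in> S - L" for s using that DL by blast
    have main: "far (w \<otimes> a)"
      if w: "w \<in> alternating G S L" and a: "a \<in> A" "(\<forall>s\<in>S. s \<otimes> a \<notin> H) \<or> a = \<one> \<and> w \<notin> L" for w a
      using w a(2)
    proof induction
      case (base l s)
      have G: "l \<in> carrier G" "s \<in> carrier G" "a \<in> carrier G" using base a A L subgroup.mem_carrier by auto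
      have "s \<otimes> a \<notin> H"
      proof (cases "a = \<one> \<and> l \<otimes> s \<notin> L")
        case True
        then have "s \<notin> D" using base DL subgroup.m_closed[OF L] by blast
        then show ?thesis using True base G by simp
      qed (use base in blast)
      then have "near (s \<otimes> a)" using nearI[of s a \<one>] base a one_H G by simp
      then show ?case using push[of "s \<otimes> a" l] base G by (simp add: m_assoc)
    next
      case (step l s w)
      have G: "l \<in> carrier G" "s \<in> carrier G" "a \<in> carrier G" "w \<in> carrier G"
        using step a A L subgroup.mem_carrier alternating_closed[OF S L] by auto
      have "near (s \<otimes> (w \<otimes> a))"
      proof (cases "a = \<one> \<and> w \<in> L")
        case True
        then show ?thesis using nearI[of s \<one> w] A(3) step.hyps SL[OF step.hyps(2)] LH G by auto
      next
        case False
        then have "far (w \<otimes> a)" using step.IH step.prems by blast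
        then show ?thesis using swing step.hyps SL[OF step.hyps(2)] by blast
      qed
      then show ?case using push[of "s \<otimes> (w \<otimes> a)" l] step.hyps G by (simp add: m_assoc)
    qed
    show "\<forall>w\<in>alternating G S L. \<forall>a\<in>A. (\<forall>s\<in>S. s \<otimes> a \<notin> H) \<or> a = \<one> \<and> w \<notin> L \<longrightarrow>
       (\<forall>s\<in>S. \<forall>b\<in>A. \<forall>h\<in>H. w \<otimes> a \<noteq> s \<otimes> b \<otimes> h)"
      using main farD by blast
  qed
qed

text \<open>Write \<open>k \<in> \<langle>S, L\<rangle> - S\<close> as \<open>s w\<close> with \<open>w\<close> alternating. Then \<open>k a \<in> b H\<close> puts \<open>w a\<close> into the coset
  \<open>s\<^sup>-\<^sup>1 b H\<close>, which \<open>w a\<close> avoids unless \<open>S a\<close> meets \<open>H\<close>; in that case \<open>a\<close> can be replaced by \<open>\<one>\<close>, and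
  \<open>S b\<close> has to meet \<open>H\<close> as well.\<close>

theorem combination:
  assumes A: "finite A" "A \<subseteq> carrier G"
  shows "\<exists>n. \<forall>L. subgroup L G \<and> D \<subseteq> L \<and> L \<subseteq> H \<and> (\<forall>l\<in>L - D. n < word_length G Y l) \<longrightarrow>
    generate G (S \<union> L) \<inter> H = L \<and>
    (\<forall>k\<in>generate G (S \<union> L) - S. \<forall>a\<in>A. \<forall>b\<in>A. \<forall>h\<in>H. k \<otimes> a = b \<otimes> h \<longrightarrow>
       (\<exists>s\<in>S. s \<otimes> a \<in> H) \<and> (\<exists>s\<in>S. s \<otimes> b \<in> H))"
proof -
  have "finite (insert \<one> A)" "insert \<one> A \<subseteq> carrier G" "\<one> \<in> insert \<one> A" using A by auto
  from alternating_avoids[OF this] obtain n where n: "\<forall>L. subgroup L G \<and> D \<subseteq> L \<and> L \<subseteq> H \<and>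
      (\<forall>l\<in>L - D. n < word_length G Y l) \<longrightarrow>
      (\<forall>w\<in>alternating G S L. \<forall>a\<in>insert \<one> A. (\<forall>s\<in>S. s \<otimes> a \<notin> H) \<or> a = \<one> \<and> w \<notin> L \<longrightarrow>
         (\<forall>s\<in>S. \<forall>b\<in>insert \<one> A. \<forall>h\<in>H. w \<otimes> a \<noteq> s \<otimes> b \<otimes> h))"
    by (elim exE)
  show ?thesis
  proof (intro exI[of _ n] allI impI, elim conjE)
    fix L assume L: "subgroup L G" and DL: "D \<subseteq> L" and LH: "L \<subseteq> H"
      and long: "\<forall>l\<in>L - D. n < word_length G Y l"
    have sep: "w \<otimes> a \<noteq> s \<otimes> b \<otimes> h"
      if "w \<in> alternating G S L" "a \<in> insert \<one> A" "(\<forall>s\<in>S. s \<otimes> a \<notin> H) \<or> a = \<one> \<and> w \<notin> L"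
        "s \<in> S" "b \<in> insert \<one> A" "h \<in> H" for w a s b h
      using n[rule_format, of L] L DL LH long that by simp
    let ?K = "generate G (S \<union> L)"
    have "S \<union> L \<subseteq> carrier G" using subgroup.subset L by auto
    then have K: "subgroup ?K G" by (rule generate_is_subgroup)
    have SL: "S \<subseteq> ?K" "L \<subseteq> ?K" by (auto intro: generate.incl)
    have form: "\<exists>s\<in>S. \<exists>w\<in>alternating G S L. k = s \<otimes> w" if "k \<in> ?K" "k \<notin> S" for k
      using generate_Un_alternating[OF S L] that by blast
    have altG: "w \<in> carrier G" if "w \<in> alternating G S L" for w using alternating_closed[OF S L that] .
    have "k \<in> L" if k: "k \<in> ?K" "k \<in> H" for k
    proof (cases "k \<in> S")
      case False
      then obtain s w where sw: "s \<in> S" "w \<in> alternating G S L" "k = s \<otimes> w" using form k by blast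
      have G: "s \<in> carrier G" "w \<in> carrier G" using sw altG by auto
      have "w \<otimes> \<one> = inv s \<otimes> \<one> \<otimes> k" using sw(3) G by (simp add: group_normalize)
      then have "w \<in> L" using sep[OF sw(2), of \<one> "inv s" \<one> k] inv_S[OF sw(1)] k by auto
      then have "k \<otimes> inv w \<in> H" using k LH mult_H inv_H by blast
      then have "s \<in> H" using sw G by (simp add: m_assoc)
      then show ?thesis using sw DL \<open>w \<in> L\<close> subgroup.m_closed[OF L] by blast
    qed (use k DL in blast)
    then have "?K \<inter> H = L" using SL LH by blast
    moreover have "(\<exists>s\<in>S. s \<otimes> a \<in> H) \<and> (\<exists>s\<in>S. s \<otimes> b \<in> H)"
      if k: "k \<in> ?K" "k \<notin> S" and ab: "a \<in> A" "b \<in> A" and h: "h \<in> H" and eq: "k \<otimes> a = b \<otimes> h" for k a b h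
    proof -
      have G: "a \<in> carrier G" "b \<in> carrier G" "k \<in> carrier G" "h \<in> carrier G"
        using ab A h k subgroup.mem_carrier[OF K] by auto
      obtain s w where sw: "s \<in> S" "w \<in> alternating G S L" "k = s \<otimes> w" using form k by blast
      have swG: "s \<in> carrier G" "w \<in> carrier G" using sw altG by auto
      have "inv s \<otimes> (k \<otimes> a) = w \<otimes> a" using sw(3) G swG by (simp add: group_normalize)
      then have "w \<otimes> a = inv s \<otimes> b \<otimes> h" using eq G swG by (simp add: m_assoc)
      then obtain s1 where s1: "s1 \<in> S" "s1 \<otimes> a \<in> H"
        using sep[OF sw(2), of a "inv s" b h] ab h inv_S[OF sw(1)] by blast
      \<comment> \<open>Passing from \<open>k\<close> to \<open>k s1\<^sup>-\<^sup>1\<close> replaces \<open>a\<close> by \<open>\<one>\<close>.\<close>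
      have "\<exists>s\<in>S. s \<otimes> b \<in> H"
      proof (rule ccontr)
        assume nb: "\<not> ?thesis"
        define k' h' where "k' = k \<otimes> inv s1" and "h' = h \<otimes> inv (s1 \<otimes> a)"
        have h': "h' \<in> H" using h s1 mult_H inv_H by (simp add: h'_def)
        have "k' = k \<otimes> a \<otimes> inv (s1 \<otimes> a)" using G s1 by (simp add: k'_def group_normalize)
        then have k': "k' = b \<otimes> h'" using eq G s1 by (simp add: h'_def m_assoc)
        have k'K: "k' \<in> ?K"
          unfolding k'_def using k s1 SL by (intro subgroup.m_closed[OF K] subgroup.m_inv_closed[OF K]) auto
        have bH: "inv t \<otimes> b \<notin> H" if "t \<in> S" for t using nb inv_S that by blast
        have "k' \<notin> S"
        proof
          assume "k' \<in> S"
          moreover have "inv k' \<otimes> b = inv h'" using k' G h' by (simp add: group_normalize)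
          ultimately show False using bH[of k'] h' inv_H by simp
        qed
        then obtain t v where tv: "t \<in> S" "v \<in> alternating G S L" "k' = t \<otimes> v" using form k'K by blast
        have tvG: "t \<in> carrier G" "v \<in> carrier G" using tv altG by auto
        have "inv t \<otimes> k' = v \<otimes> \<one>" using tv(3) tvG by (simp add: group_normalize)
        then have v: "v \<otimes> \<one> = inv t \<otimes> b \<otimes> h'" using k' tvG G h' by (simp add: m_assoc)
        then have "v \<in> L" using sep[OF tv(2), of \<one> "inv t" b h'] ab h' inv_S[OF tv(1)] by auto
        then have "inv t \<otimes> b \<otimes> h' \<in> H" using v tvG LH by auto
        then show False using bH[OF tv(1)] mult_mem_H_iff(1)[of "inv t \<otimes> b", OF _ h'] tvG G by simp
      qed
      then show ?thesis using s1 by blast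
    qed
    ultimately show "?K \<inter> H = L \<and> (\<forall>k\<in>?K - S. \<forall>a\<in>A. \<forall>b\<in>A. \<forall>h\<in>H. k \<otimes> a = b \<otimes> h \<longrightarrow>
       (\<exists>s\<in>S. s \<otimes> a \<in> H) \<and> (\<exists>s\<in>S. s \<otimes> b \<in> H))" by blast
  qed
qed

end

section \<open>Separating a closed subgroup from finitely many elements\<close>

context group
begin

text \<open>If \<open>f N\<close> misses \<open>D\<close>, then \<open>f\<^sup>-\<^sup>1\<close> lies outside \<open>N D\<close>, a union of right cosets of \<open>N\<close>. Its
  stabiliser under right multiplication has finite index, contains \<open>D\<close> and omits \<open>f\<close>.\<close>

lemma closed_subgroup_separated:
  assumes D: "subgroup D G" and cl: "closedin (profinite_topology G) D" and f: "f \<in> carrier G - D"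
  shows "\<exists>M. finite_index G M \<and> D \<subseteq> M \<and> f \<notin> M"
proof -
  have DG: "d \<in> carrier G" if "d \<in> D" for d using subgroup.mem_carrier[OF D that] .
  have "carrier G \<subseteq> topspace (profinite_topology G)"
    using profinite_base_at_one(1)[OF finite_index_carrier] by (rule openin_subset)
  moreover have "openin (profinite_topology G) (topspace (profinite_topology G) - D)"
    using cl by (simp add: closedin_def)
  ultimately obtain N where N: "finite_index G N" "f <# N \<subseteq> topspace (profinite_topology G) - D"
    using profinite_nhd[of "topspace (profinite_topology G) - D" f] f by blast
  have sN: "subgroup N G" using N by (simp add: finite_index_def)
  have NG: "n \<in> carrier G" if "n \<in> N" for n using subgroup.mem_carrier[OF sN that] .
  define U where "U = N <#> D"
  have UG: "U \<subseteq> carrier G" using NG DG by (auto simp: U_def set_mult_def)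
  define M where "M = {g \<in> carrier G. U #> g = U}"
  have M: "subgroup M G"
  proof (rule subgroupI)
    show "M \<subseteq> carrier G" by (auto simp: M_def)
    have "\<one> \<in> M" using UG by (simp add: M_def coset_mult_one)
    then show "M \<noteq> {}" by blast
    fix a assume a: "a \<in> M"
    then have aG: "a \<in> carrier G" and "U #> inv a = U #> a #> inv a" by (simp_all add: M_def)
    note this(2)
    also have "\<dots> = U" using aG UG by (simp add: coset_mult_assoc coset_mult_one)
    finally show "inv a \<in> M" using a by (simp add: M_def)
    fix b assume "b \<in> M"
    then show "a \<otimes> b \<in> M" using a UG by (simp add: M_def coset_mult_assoc[symmetric])
  qed
  have "D \<subseteq> M"
  proof
    fix d assume d: "d \<in> D"
    have "U #> d = N <#> (D #> d)"
      unfolding U_def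
      using setmult_rcos_assoc[OF subgroup.subset[OF sN] subgroup.subset[OF D] DG[OF d]] by simp
    then show "d \<in> M" using d DG coset_join2[OF _ D d] by (simp add: M_def U_def)
  qed
  moreover have "f \<notin> M"
  proof
    assume "f \<in> M"
    then have "inv f \<in> M" using subgroup.m_inv_closed[OF M] by blast
    moreover have "\<one> \<in> U"
      using subgroup.one_closed[OF sN] subgroup.one_closed[OF D] unfolding U_def set_mult_def by force
    ultimately have "\<one> \<otimes> inv f \<in> U" unfolding M_def r_coset_def by blast
    then obtain n d where nd: "n \<in> N" "d \<in> D" "inv f = n \<otimes> d"
      using f by (auto simp: U_def set_mult_def)
    have "f = inv (n \<otimes> d)" using nd(3) f by (metis DiffD1 inv_inv)
    then have "f \<otimes> n = inv d" using nd NG DG by (simp add: group_normalize)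
    then have "f \<otimes> n \<in> D" using nd D by (simp add: subgroup.m_inv_closed)
    moreover have "f \<otimes> n \<in> f <# N" using nd by (auto simp: l_coset_def)
    ultimately show False using N by blast
  qed
  moreover have "finite (rcosets M)"
  proof (rule finite_subset)
    show "rcosets M \<subseteq> (\<lambda>V. {x \<in> carrier G. U #> x = V}) ` (Union ` Pow (rcosets N))"
    proof
      fix C assume "C \<in> rcosets M"
      then obtain g where g: "g \<in> carrier G" "C = M #> g" by (auto simp: RCOSETS_def)
      have "C = {x \<in> carrier G. U #> x = U #> g}"
      proof (intro equalityI subsetI)
        fix x assume "x \<in> C"
        then obtain m where "m \<in> M" "x = m \<otimes> g" using g by (auto simp: r_coset_def)
        then show "x \<in> {x \<in> carrier G. U #> x = U #> g}"
          using g(1) UG by (simp add: M_def coset_mult_assoc[symmetric])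
      next
        fix x assume x: "x \<in> {x \<in> carrier G. U #> x = U #> g}"
        then have "U #> (x \<otimes> inv g) = U"
          using g(1) UG coset_mult_assoc[of U x "inv g"] coset_mult_assoc[of U g "inv g"]
          by (simp add: coset_mult_one)
        then have "x \<otimes> inv g \<in> M" using x g by (simp add: M_def)
        moreover have "x = x \<otimes> inv g \<otimes> g" using x g by (simp add: m_assoc)
        ultimately show "x \<in> C" unfolding g r_coset_def by blast
      qed
      moreover have "U #> g = \<Union> ((\<lambda>d. N #> (d \<otimes> g)) ` D)"
        using NG DG g(1) by (auto simp: U_def set_mult_def r_coset_def m_assoc)
      moreover have "(\<lambda>d. N #> (d \<otimes> g)) ` D \<in> Pow (rcosets N)"
        using DG g(1) by (auto simp: RCOSETS_def)
      ultimately show "C \<in> (\<lambda>V. {x \<in> carrier G. U #> x = V}) ` (Union ` Pow (rcosets N))" by blast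
    qed
    show "finite ((\<lambda>V. {x \<in> carrier G. U #> x = V}) ` (Union ` Pow (rcosets N)))"
      using N by (simp add: finite_index_def)
  qed
  ultimately show ?thesis using M by (auto simp: finite_index_def)
qed

lemma closed_subgroup_separated_finite:
  assumes D: "subgroup D G" "closedin (profinite_topology G) D" and F: "finite F" "F \<subseteq> carrier G - D"
  shows "\<exists>M. finite_index G M \<and> D \<subseteq> M \<and> M \<inter> F = {}"
  using F
proof induction
  case empty
  then show ?case using finite_index_carrier subgroup.subset[OF D(1)] by blast
next
  case (insert f F)
  then obtain M where M: "finite_index G M" "D \<subseteq> M" "M \<inter> F = {}" by blast
  obtain M' where M': "finite_index G M'" "D \<subseteq> M'" "f \<notin> M'"
    using closed_subgroup_separated[OF D, of f] insert.prems by blast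
  show ?case using finite_index_Int[OF M(1) M'(1)] M M' by blast
qed

end

section \<open>Components of subgraphs of covers\<close>

context group
begin

lemma Cayley_verts: "verts (Cayley G X T) = rcosets T"
  by (simp add: Cayley_def mk_lgraph_def)

lemma mk_lgraph_simps [simp]:
  "verts (mk_lgraph V E) = V" "arcs (mk_lgraph V E) = E"
  "tail (mk_lgraph V E) = fst" "head (mk_lgraph V E) = snd \<circ> snd"
  by (simp_all add: mk_lgraph_def)

lemma sym_gens_mono: "X1 \<subseteq> X \<Longrightarrow> sym_gens G X1 \<subseteq> sym_gens G X"
  by (auto simp: sym_gens_def)

context
  fixes X T
  assumes T: "subgroup T G" and X: "X \<subseteq> carrier G"
begin

lemma Cayley_arc_iff:
  "(V, x, W) \<in> arcs (Cayley G X T) \<longleftrightarrow> V \<in> rcosets T \<and> x \<in> sym_gens G X \<and> W = V #> x"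
proof -
  have "T #> (g \<otimes> x) = T #> g #> x" if "g \<in> carrier G" "x \<in> sym_gens G X" for g x
    using that sym_gens_closed[OF X] subgroup.subset[OF T] by (simp add: coset_mult_assoc)
  then show ?thesis by (auto simp: Cayley_def mk_lgraph_def RCOSETS_def)
qed

lemma vert_carrier: "V \<in> rcosets T \<Longrightarrow> V \<subseteq> carrier G"
  by (rule subgroup.rcosets_carrier[OF T is_group])

lemma vert_mult: "V \<in> rcosets T \<Longrightarrow> g \<in> carrier G \<Longrightarrow> V #> g \<in> rcosets T"
  using subgroup.subset[OF T] by (auto simp: RCOSETS_def coset_mult_assoc)

text \<open>As all edges can be reversed, a graph is connected once one vertex is joined to every other.\<close>

lemma strongly_connected_mk_lgraph:
  assumes E: "\<And>v x w. (v, x, w) \<in> E \<Longrightarrow> v \<in> V \<and> w \<in> V \<and> (w, inv x, v) \<in> E"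
    and b: "b \<in> V" and reach: "\<And>v. v \<in> V \<Longrightarrow> (b, v) \<in> {(v, w). \<exists>x. (v, x, w) \<in> E}\<^sup>*"
  shows "wf_digraph (mk_lgraph V E)" "strongly_connected (mk_lgraph V E)"
proof -
  show wf: "wf_digraph (mk_lgraph V E)"
    by unfold_locales (use E in auto)
  let ?R = "{(v, w). \<exists>x. (v, x, w) \<in> E}"
  have "sym ?R" using E by (auto intro!: symI)
  then have sym: "sym (?R\<^sup>*)" by (rule sym_rtrancl)
  have ends: "arcs_ends (mk_lgraph V E) = ?R"
    by (force simp: arcs_ends_def arc_to_ends_def)
  have "reachable (mk_lgraph V E) u v" if "u \<in> V" "v \<in> V" for u v
  proof -
    have "(u, b) \<in> ?R\<^sup>*" "(b, v) \<in> ?R\<^sup>*" using reach that sym by (auto elim: symE)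
    then have "(u, v) \<in> ?R\<^sup>*" by (rule rtrancl_trans)
    then show ?thesis unfolding reachable_def ends
      by (rule rtrancl_consistent_rtrancl_on) (use that E in auto)
  qed
  then show "strongly_connected (mk_lgraph V E)" using b by (auto simp: strongly_connected_def)
qed

lemma lsubgraph_mk_lgraph:
  assumes V: "V \<subseteq> rcosets T" and EC: "E \<subseteq> arcs (Cayley G X T)"
    and E: "\<And>v x w. (v, x, w) \<in> E \<Longrightarrow> v \<in> V \<and> w \<in> V \<and> (w, inv x, v) \<in> E"
    and b: "b \<in> V" and reach: "\<And>v. v \<in> V \<Longrightarrow> (b, v) \<in> {(v, w). \<exists>x. (v, x, w) \<in> E}\<^sup>*"
  shows "lsubgraph G (mk_lgraph V E) (Cayley G X T)"
proof -
  have "compatible (Cayley G X T) (mk_lgraph V E)" by (simp add: compatible_def Cayley_def)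
  then have "subgraph (mk_lgraph V E) (Cayley G X T)"
    using V EC wf_digraph_Cayley[OF X] strongly_connected_mk_lgraph(1)[OF E b reach]
    by (simp add: subgraph_def Cayley_verts)
  then show ?thesis
    using strongly_connected_mk_lgraph(2)[OF E b reach] E by (simp add: lsubgraph_def)
qed

lemma lsubgraph_verts:
  assumes "lsubgraph G \<Gamma> (Cayley G X T)"
  shows "verts \<Gamma> \<subseteq> rcosets T"
  using assms by (auto simp: lsubgraph_def subgraph_def Cayley_verts)

lemma lsubgraph_arcs:
  assumes "lsubgraph G \<Gamma> (Cayley G X T)"
  shows "arcs \<Gamma> \<subseteq> arcs (Cayley G X T)"
  using assms by (auto simp: lsubgraph_def subgraph_def)

lemma lsubgraph_connected:
  assumes \<Gamma>: "lsubgraph G \<Gamma> (Cayley G X T)" and uv: "u \<in> verts \<Gamma>" "v \<in> verts \<Gamma>"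
  shows "(u, v) \<in> {(v, w). \<exists>x. (v, x, w) \<in> arcs \<Gamma>}\<^sup>*"
proof -
  have "reachable \<Gamma> u v" using \<Gamma> uv by (auto simp: lsubgraph_def strongly_connected_def)
  then have "(u, v) \<in> (arcs_ends \<Gamma>)\<^sup>*" by (rule reachable_rtranclI)
  moreover have "arcs_ends \<Gamma> = {(v, w). \<exists>x. (v, x, w) \<in> arcs \<Gamma>}"
    using lsubgraph_ends[OF T X \<Gamma>] by (force simp: arcs_ends_def arc_to_ends_def)
  ultimately show ?thesis by simp
qed

context
  fixes X1 \<Gamma>
  assumes X1: "X1 \<subseteq> X" and \<Gamma>: "lsubgraph G \<Gamma> (Cayley G X T)"
begin

lemma X1_carrier: "X1 \<subseteq> carrier G"
  using X X1 by blast

lemma sym_labelled_edges: "sym ({(v, u). \<exists>x\<in>sym_gens G X1. (v, x, u) \<in> arcs \<Gamma>}\<^sup>*)"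
proof (intro sym_rtrancl symI)
  fix v u assume "(v, u) \<in> {(v, u). \<exists>x\<in>sym_gens G X1. (v, x, u) \<in> arcs \<Gamma>}"
  then obtain x where "x \<in> sym_gens G X1" "(v, x, u) \<in> arcs \<Gamma>" by blast
  then have "inv x \<in> sym_gens G X1" "(u, inv x, v) \<in> arcs \<Gamma>"
    using lsubgraph_arcD(5)[OF T X \<Gamma>] sym_gens_inv[OF X1_carrier] by blast+
  then show "(u, v) \<in> {(v, u). \<exists>x\<in>sym_gens G X1. (v, x, u) \<in> arcs \<Gamma>}" by blast
qed

lemma label_component_verts:
  assumes "w \<in> verts \<Gamma>"
  shows "verts (label_component G X1 \<Gamma> w) =
    {v. (w, v) \<in> {(v, u). \<exists>x\<in>sym_gens G X1. (v, x, u) \<in> arcs \<Gamma>}\<^sup>*}"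
proof -
  let ?R = "{(v, u). \<exists>x\<in>sym_gens G X1. (v, x, u) \<in> arcs \<Gamma>}"
  let ?\<Gamma>1 = "\<Gamma>\<lparr>arcs := {e \<in> arcs \<Gamma>. lab e \<in> sym_gens G X1}\<rparr>"
  note arc = lsubgraph_arcD[OF T X \<Gamma>]
  have ends: "arcs_ends ?\<Gamma>1 = ?R"
    using lsubgraph_ends[OF T X \<Gamma>] by (force simp: arcs_ends_def arc_to_ends_def lab_def)
  note sym = sym_labelled_edges
  have inV: "v \<in> verts \<Gamma>" if "(w, v) \<in> ?R\<^sup>*" for v
    using that assms arc(7) by (induction rule: rtrancl_induct) auto
  have reach: "reachable ?\<Gamma>1 u v \<longleftrightarrow> (u, v) \<in> ?R\<^sup>*" if "u \<in> verts \<Gamma>" "v \<in> verts \<Gamma>" for u v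
  proof
    assume "(u, v) \<in> ?R\<^sup>*"
    then show "reachable ?\<Gamma>1 u v" unfolding reachable_def ends
      by (rule rtrancl_consistent_rtrancl_on) (use that arc(7) in auto)
  qed (use reachable_rtranclI[of ?\<Gamma>1 u v] ends in simp)
  have "v \<in> pre_digraph.scc_of ?\<Gamma>1 w \<longleftrightarrow> (w, v) \<in> ?R\<^sup>*" for v
  proof
    assume "v \<in> pre_digraph.scc_of ?\<Gamma>1 w"
    then have wv: "reachable ?\<Gamma>1 w v" by (simp add: pre_digraph.scc_of_def)
    then have "v \<in> verts \<Gamma>" by (rule reachable_in_vertsE) simp
    then show "(w, v) \<in> ?R\<^sup>*" using wv reach[OF assms] by blast
  next
    assume wv: "(w, v) \<in> ?R\<^sup>*"
    then have "(v, w) \<in> ?R\<^sup>*" by (rule symD[OF sym])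
    then show "v \<in> pre_digraph.scc_of ?\<Gamma>1 w"
      using wv reach inV[OF wv] assms by (simp add: pre_digraph.scc_of_def)
  qed
  then show ?thesis by (auto simp: label_component_def Let_def)
qed

lemma label_component_self: "w \<in> verts \<Gamma> \<Longrightarrow> w \<in> verts (label_component G X1 \<Gamma> w)"
  by (simp add: label_component_verts)

lemma label_component_subset:
  assumes "w \<in> verts \<Gamma>"
  shows "verts (label_component G X1 \<Gamma> w) \<subseteq> verts \<Gamma>"
proof
  fix v assume "v \<in> verts (label_component G X1 \<Gamma> w)"
  then have "(w, v) \<in> {(v, u). \<exists>x\<in>sym_gens G X1. (v, x, u) \<in> arcs \<Gamma>}\<^sup>*"
    using label_component_verts[OF assms] by simp
  then show "v \<in> verts \<Gamma>"
    using assms lsubgraph_arcD(7)[OF T X \<Gamma>] by (induction rule: rtrancl_induct) auto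
qed

lemma label_component_arcs:
  "(v, x, u) \<in> arcs (label_component G X1 \<Gamma> w) \<longleftrightarrow>
    (v, x, u) \<in> arcs \<Gamma> \<and> x \<in> sym_gens G X1 \<and> v \<in> verts (label_component G X1 \<Gamma> w) \<and>
    u \<in> verts (label_component G X1 \<Gamma> w)"
  using lsubgraph_ends[OF T X \<Gamma>] by (auto simp: label_component_def Let_def lab_def)

lemma label_component_step:
  assumes "w \<in> verts \<Gamma>" "v \<in> verts (label_component G X1 \<Gamma> w)" "(v, x, u) \<in> arcs \<Gamma>" "x \<in> sym_gens G X1"
  shows "u \<in> verts (label_component G X1 \<Gamma> w)" "(v, x, u) \<in> arcs (label_component G X1 \<Gamma> w)"
proof -
  show u: "u \<in> verts (label_component G X1 \<Gamma> w)"
    using assms by (auto simp: label_component_verts intro: rtrancl_into_rtrancl)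
  show "(v, x, u) \<in> arcs (label_component G X1 \<Gamma> w)" using assms u by (simp add: label_component_arcs)
qed

lemma label_component_eq:
  assumes "w \<in> verts \<Gamma>" "v \<in> verts (label_component G X1 \<Gamma> w)"
  shows "label_component G X1 \<Gamma> v = label_component G X1 \<Gamma> w"
proof -
  let ?R = "{(v, u). \<exists>x\<in>sym_gens G X1. (v, x, u) \<in> arcs \<Gamma>}"
  have v: "v \<in> verts \<Gamma>" using label_component_subset assms by blast
  have wv: "(w, v) \<in> ?R\<^sup>*" using assms label_component_verts by simp
  then have vw: "(v, w) \<in> ?R\<^sup>*" using symD[OF sym_labelled_edges] by blast
  have "(v, u) \<in> ?R\<^sup>* \<longleftrightarrow> (w, u) \<in> ?R\<^sup>*" for u
    using rtrancl_trans[OF wv] rtrancl_trans[OF vw] by blast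
  then have "verts (label_component G X1 \<Gamma> v) = verts (label_component G X1 \<Gamma> w)"
    using label_component_verts assms v by simp
  then have "pre_digraph.scc_of (\<Gamma>\<lparr>arcs := {e \<in> arcs \<Gamma>. lab e \<in> sym_gens G X1}\<rparr>) v =
    pre_digraph.scc_of (\<Gamma>\<lparr>arcs := {e \<in> arcs \<Gamma>. lab e \<in> sym_gens G X1}\<rparr>) w"
    by (simp add: label_component_def Let_def)
  then show ?thesis by (simp add: label_component_def Let_def)
qed

text \<open>Components are themselves connected subgraphs of the cover, so what holds for labels of paths in
  such subgraphs applies to them.\<close>

lemma lsubgraph_label_component:
  assumes w: "w \<in> verts \<Gamma>"
  shows "lsubgraph G (label_component G X1 \<Gamma> w) (Cayley G X T)"
proof -
  let ?C = "label_component G X1 \<Gamma> w"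
  let ?R = "{(v, u). \<exists>x\<in>sym_gens G X1. (v, x, u) \<in> arcs \<Gamma>}"
  have "?C = mk_lgraph (verts ?C) (arcs ?C)"
    using lsubgraph_ends[OF T X \<Gamma>]
    by (simp add: mk_lgraph_def label_component_def Let_def induce_subgraph_def)
  moreover have "lsubgraph G (mk_lgraph (verts ?C) (arcs ?C)) (Cayley G X T)"
  proof (rule lsubgraph_mk_lgraph)
    show "verts ?C \<subseteq> rcosets T" using label_component_subset[OF w] lsubgraph_verts[OF \<Gamma>] by blast
    show "arcs ?C \<subseteq> arcs (Cayley G X T)" using lsubgraph_arcs[OF \<Gamma>] label_component_arcs by auto
    show "w \<in> verts ?C" using w by (rule label_component_self)
    show "v \<in> verts ?C \<and> u \<in> verts ?C \<and> (u, inv x, v) \<in> arcs ?C" if "(v, x, u) \<in> arcs ?C" for v x u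
      using that lsubgraph_arcD(5)[OF T X \<Gamma>] sym_gens_inv[OF X1_carrier] by (simp add: label_component_arcs)
    fix v assume "v \<in> verts ?C"
    then have "(w, v) \<in> ?R\<^sup>*" using label_component_verts[OF w] by simp
    then show "(w, v) \<in> {(v, u). \<exists>x. (v, x, u) \<in> arcs ?C}\<^sup>*"
    proof (induction rule: rtrancl_induct)
      case (step u v)
      then have "u \<in> verts ?C" using label_component_verts[OF w] by simp
      then have "(u, v) \<in> {(v, u). \<exists>x. (v, x, u) \<in> arcs ?C}"
        using step(2) label_component_step(2)[OF w] by blast
      then show ?case using step.IH by (rule rtrancl_into_rtrancl[rotated])
    qed simp
  qed
  ultimately show ?thesis by simp
qed

lemma label_component_path_labels:
  assumes w: "w \<in> verts \<Gamma>" and g: "g \<in> path_labels G (label_component G X1 \<Gamma> w) u v"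
  shows "g \<in> generate G X1"
  using g
proof (induction rule: path_labels_induct[OF T X lsubgraph_label_component[OF w], consumes 1, case_names refl step])
  case (step u x v g z)
  then have "x \<in> sym_gens G X1" using label_component_arcs by blast
  then have "x \<in> generate G X1" by (auto simp: sym_gens_def intro: generate.intros)
  then show ?case using step by (blast intro: generate.eng)
qed (rule generate.one)

lemma label_component_orbit:
  assumes w: "w \<in> verts \<Gamma>" and v: "v \<in> verts (label_component G X1 \<Gamma> w)"
  shows "\<exists>g\<in>generate G X1. v = w #> g"
proof -
  note C = lsubgraph_label_component[OF w]
  obtain g where g: "g \<in> path_labels G (label_component G X1 \<Gamma> w) w v"
    using path_labels_nonempty[OF T X C label_component_self[OF w] v] by blast
  then show ?thesis using path_labels_carrier[OF T X C g] label_component_path_labels[OF w g] by blast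
qed

lemma label_component_full_orbit:
  assumes w: "w \<in> verts \<Gamma>"
    and full: "\<And>h x. h \<in> generate G X1 \<Longrightarrow> x \<in> sym_gens G X1 \<Longrightarrow> (w #> h, x, w #> h #> x) \<in> arcs \<Gamma>"
  shows "verts (label_component G X1 \<Gamma> w) = {w #> h | h. h \<in> generate G X1}"
proof
  have wG: "w \<subseteq> carrier G" using w lsubgraph_verts[OF \<Gamma>] vert_carrier by blast
  have "w #> b \<in> verts (label_component G X1 \<Gamma> w)" if "b \<in> word_ball G X1 n" for n b
    using that
  proof (induction n arbitrary: b)
    case 0
    then show ?case using label_component_self[OF w] wG by (simp add: coset_mult_one)
  next
    case (Suc n)
    from Suc.prems consider "b \<in> word_ball G X1 n"
      | c x where "b = c \<otimes> x" "c \<in> word_ball G X1 n" "x \<in> sym_gens G X1" by auto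
    then show ?case
    proof cases
      case 2
      then have "c \<in> generate G X1" using generate_word_ball[OF X1_carrier] by blast
      then have "w #> c #> x \<in> verts (label_component G X1 \<Gamma> w)"
        using label_component_step(1)[OF w Suc.IH[OF 2(2)] full] 2 by blast
      then show ?thesis
        using 2 wG word_ball_closed[OF X1_carrier] sym_gens_closed[OF X1_carrier]
        by (simp add: coset_mult_assoc)
    qed (use Suc.IH in blast)
  qed
  then show "{w #> h | h. h \<in> generate G X1} \<subseteq> verts (label_component G X1 \<Gamma> w)"
    using generate_word_ball[OF X1_carrier] by blast
qed (use label_component_orbit[OF w] in blast)

end

end

end

section \<open>Enlarging a finite subgraph along its orbits\<close>

context group
begin

lemma map_edges_rtrancl:
  assumes "(u, v) \<in> {(v, w). \<exists>x. (v, x, w) \<in> E}\<^sup>*" "map_edge f ` E \<subseteq> E'"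
  shows "(f u, f v) \<in> {(v, w). \<exists>x. (v, x, w) \<in> E'}\<^sup>*"
  using assms(1)
proof (induction rule: rtrancl_induct)
  case (step v w)
  then obtain x where "(v, x, w) \<in> E" by blast
  then have "(f v, x, f w) \<in> E'" using assms(2) by (force simp: map_edge_def)
  then show ?case using step.IH by (blast intro: rtrancl_into_rtrancl)
qed simp

lemma word_ball_rtrancl:
  assumes X0: "X0 \<subseteq> carrier G" and u: "u \<subseteq> carrier G"
    and E: "\<And>m b x. m < n \<Longrightarrow> b \<in> word_ball G X0 m \<Longrightarrow> x \<in> sym_gens G X0 \<Longrightarrow> (u #> b, x, u #> b #> x) \<in> E"
    and b: "b \<in> word_ball G X0 n"
  shows "(u, u #> b) \<in> {(v, w). \<exists>x. (v, x, w) \<in> E}\<^sup>*"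
proof -
  have "(u, u #> b) \<in> {(v, w). \<exists>x. (v, x, w) \<in> E}\<^sup>*" if "b \<in> word_ball G X0 m" "m \<le> n" for m b
    using that
  proof (induction m arbitrary: b)
    case 0
    then show ?case using u by (simp add: coset_mult_one)
  next
    case (Suc m)
    from Suc.prems consider "b \<in> word_ball G X0 m"
      | c x where "b = c \<otimes> x" "c \<in> word_ball G X0 m" "x \<in> sym_gens G X0" by auto
    then show ?case
    proof cases
      case 1
      then show ?thesis using Suc by simp
    next
      case 2
      have "u #> c #> x = u #> b"
        using 2 u word_ball_closed[OF X0] sym_gens_closed[OF X0] by (simp add: coset_mult_assoc)
      then have "(u #> c, x, u #> b) \<in> E" using E[of m c x] 2 Suc.prems by simp
      moreover have "(u, u #> c) \<in> {(v, w). \<exists>x. (v, x, w) \<in> E}\<^sup>*" using Suc 2 by simp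
      ultimately show ?thesis by (blast intro: rtrancl_into_rtrancl)
    qed
  qed
  then show ?thesis using b by blast
qed

context
  fixes X T
  assumes T: "subgroup T G" and X: "X \<subseteq> carrier G"
begin

lemma path_labels_arc:
  assumes "lsubgraph G \<Gamma> (Cayley G X T)" "(u, x, w) \<in> arcs \<Gamma>"
  shows "x \<in> path_labels G \<Gamma> u w"
  using path_labels_step[OF T X assms path_labels_one[OF T X assms(1)]] lsubgraph_arcD[OF T X assms] by simp

lemma word_ball_path_labels:
  assumes \<Gamma>: "lsubgraph G \<Gamma> (Cayley G X T)" and u: "u \<in> verts \<Gamma>" and X0: "X0 \<subseteq> carrier G"
    and arcs: "\<And>m b x. m < n \<Longrightarrow> b \<in> word_ball G X0 m \<Longrightarrow> x \<in> sym_gens G X0 \<Longrightarrow>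
      u #> b \<in> verts \<Gamma> \<Longrightarrow> (u #> b, x, u #> b #> x) \<in> arcs \<Gamma>"
    and b: "b \<in> word_ball G X0 n"
  shows "b \<in> path_labels G \<Gamma> u (u #> b)"
proof -
  have uG: "u \<subseteq> carrier G" using lsubgraph_vertD[OF T X \<Gamma> u] .
  have "b \<in> path_labels G \<Gamma> u (u #> b)" if "b \<in> word_ball G X0 m" "m \<le> n" for m b
    using that
  proof (induction m arbitrary: b)
    case 0
    then show ?case using path_labels_one[OF T X \<Gamma> u] uG by (simp add: coset_mult_one)
  next
    case (Suc m)
    from Suc.prems consider "b \<in> word_ball G X0 m"
      | c x where "b = c \<otimes> x" "c \<in> word_ball G X0 m" "x \<in> sym_gens G X0" by auto
    then show ?case
    proof cases
      case 1
      then show ?thesis using Suc by simp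
    next
      case 2
      have c: "c \<in> path_labels G \<Gamma> u (u #> c)" using Suc.IH[OF 2(2)] Suc.prems by simp
      have "(u #> c, x, u #> c #> x) \<in> arcs \<Gamma>"
        using arcs[of m c x] 2 Suc.prems(2) path_labels_carrier[OF T X \<Gamma> c] by simp
      then have "c \<otimes> x \<in> path_labels G \<Gamma> u (u #> c #> x)"
        using path_labels_trans[OF T X \<Gamma> c] path_labels_arc[OF \<Gamma>] by blast
      moreover have "u #> c #> x = u #> b"
        using 2 uG word_ball_closed[OF X0] sym_gens_closed[OF X0] by (simp add: coset_mult_assoc)
      ultimately show ?thesis using 2 by simp
    qed
  qed
  then show ?thesis using b by blast
qed

lemma path_labels_map:
  assumes \<Gamma>: "lsubgraph G \<Gamma> (Cayley G X T)" and T': "subgroup T' G"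
    and \<Gamma>': "lsubgraph G \<Gamma>' (Cayley G X T')"
    and f: "f ` verts \<Gamma> \<subseteq> verts \<Gamma>'" "map_edge f ` arcs \<Gamma> \<subseteq> arcs \<Gamma>'"
    and g: "g \<in> path_labels G \<Gamma> u w"
  shows "g \<in> path_labels G \<Gamma>' (f u) (f w)"
  using g
proof (induction rule: path_labels_induct[OF T X \<Gamma>, consumes 1, case_names refl step])
  case (refl u)
  then show ?case using path_labels_one[OF T' X \<Gamma>'] f(1) by blast
next
  case (step u x w g z)
  have "(f u, x, f w) \<in> arcs \<Gamma>'" using step(1) f(2) by (force simp: map_edge_def)
  then show ?case using path_labels_step[OF T' X \<Gamma>'] step by blast
qed

end

text \<open>In the whole cover, the paths from \<open>u\<close> to \<open>w\<close> can carry any label that takes \<open>u\<close> to \<open>w\<close>, and the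
  \<open>X1*\<close>-components are the orbits of the subgroup generated by \<open>X1\<close>.\<close>

context
  fixes X T
  assumes T: "subgroup T G" and X: "X \<subseteq> carrier G" and genX: "generate G X = carrier G"
begin

lemma mem_word_ball: "g \<in> carrier G \<Longrightarrow> \<exists>n. g \<in> word_ball G X n"
  using generate_word_ball[OF X] genX by auto

lemma base_vertex: "T \<in> rcosets T"
  using subgroup.subset[OF T] by (auto simp: RCOSETS_def intro!: bexI[of _ \<one>] coset_mult_one[symmetric])

lemma lsubgraph_Cayley: "lsubgraph G (Cayley G X T) (Cayley G X T)"
proof -
  let ?E = "arcs (Cayley G X T)"
  note arc = Cayley_arc_iff[OF T X]
  have "lsubgraph G (mk_lgraph (rcosets T) ?E) (Cayley G X T)"
  proof (rule lsubgraph_mk_lgraph[OF T X subset_refl subset_refl _ base_vertex])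
    fix v x w assume e: "(v, x, w) \<in> ?E"
    then show "v \<in> rcosets T \<and> w \<in> rcosets T \<and> (w, inv x, v) \<in> ?E"
      using Cayley_arcs_inv[OF X e] arc by blast
  next
    fix v assume "v \<in> rcosets T"
    then obtain g where g1: "g \<in> carrier G" "v = T #> g" by (auto simp: RCOSETS_def)
    then obtain n where g: "v = T #> g" "g \<in> word_ball G X n" using mem_word_ball by blast
    show "(T, v) \<in> {(v, w). \<exists>x. (v, x, w) \<in> ?E}\<^sup>*"
      unfolding g(1)
    proof (rule word_ball_rtrancl[OF X subgroup.subset[OF T] _ g(2)])
      fix m b x assume "b \<in> word_ball G X m" "x \<in> sym_gens G X"
      then show "(T #> b, x, T #> b #> x) \<in> ?E"
        using word_ball_closed[OF X] by (auto simp: arc RCOSETS_def)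
    qed
  qed
  then show ?thesis by (simp add: Cayley_def mk_lgraph_def)
qed

lemma path_labels_Cayley:
  assumes u: "u \<in> rcosets T"
  shows "path_labels G (Cayley G X T) u w = {g \<in> carrier G. w = u #> g}"
proof (intro equalityI subsetI)
  fix g assume "g \<in> path_labels G (Cayley G X T) u w"
  then show "g \<in> {g \<in> carrier G. w = u #> g}" using path_labels_carrier[OF T X lsubgraph_Cayley] by blast
next
  fix g assume "g \<in> {g \<in> carrier G. w = u #> g}"
  then obtain n where g: "w = u #> g" "g \<in> word_ball G X n" using mem_word_ball by blast
  have "(u #> b, x, u #> b #> x) \<in> arcs (Cayley G X T)"
    if "u #> b \<in> verts (Cayley G X T)" "x \<in> sym_gens G X" for b x
    using that by (simp add: Cayley_arc_iff[OF T X] Cayley_verts)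
  then show "g \<in> path_labels G (Cayley G X T) u w"
    using word_ball_path_labels[OF T X lsubgraph_Cayley _ X _ g(2)] u g(1) by (simp add: Cayley_verts)
qed

lemma label_component_Cayley:
  assumes u: "u \<in> rcosets T" and X1: "X1 \<subseteq> X"
  shows "verts (label_component G X1 (Cayley G X T) u) = {u #> h | h. h \<in> generate G X1}"
proof (rule label_component_full_orbit[OF T X X1 lsubgraph_Cayley])
  show "u \<in> verts (Cayley G X T)" using u by (simp add: Cayley_verts)
  fix h x assume h: "h \<in> generate G X1" and x: "x \<in> sym_gens G X1"
  have "h \<in> carrier G" using h generate_in_carrier[of X1] X X1 by blast
  then show "(u #> h, x, u #> h #> x) \<in> arcs (Cayley G X T)"
    using vert_mult[OF T X u] sym_gens_mono[OF X1] x by (auto simp: Cayley_arc_iff[OF T X])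
qed

end

lemma finite_subset_word_ball:
  assumes X1: "X1 \<subseteq> carrier G" and F: "finite F" "F \<subseteq> generate G X1"
  shows "\<exists>n. F \<subseteq> word_ball G X1 n"
  using F
proof induction
  case (insert g F)
  then obtain m n where "F \<subseteq> word_ball G X1 n" "g \<in> word_ball G X1 m"
    using generate_word_ball[OF X1] by auto
  then have "insert g F \<subseteq> word_ball G X1 (max m n)"
    using word_ball_mono[of m "max m n" G X1] word_ball_mono[of n "max m n" G X1] by auto
  then show ?case by blast
qed simp

text \<open>The points of the orbit of \<open>u\<close> correspond to the cosets of its stabiliser.\<close>

lemma finite_orbit:
  assumes u: "u \<subseteq> carrier G" and H: "subgroup H G" and D: "D = {g \<in> H. u #> g = u}"
    and fin: "finite_index (G\<lparr>carrier := H\<rparr>) D"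
  shows "finite {u #> h | h. h \<in> H}"
proof (rule finite_subset)
  have HG: "h \<in> carrier G" if "h \<in> H" for h using subgroup.mem_carrier[OF H that] .
  have cosets: "rcosets\<^bsub>G\<lparr>carrier := H\<rparr>\<^esub> D = {D #> h | h. h \<in> H}"
    by (auto simp: RCOSETS_def r_coset_def)
  show "finite ((\<lambda>C. u #> (SOME h. h \<in> C)) ` {D #> h | h. h \<in> H})"
    using fin unfolding finite_index_def cosets by blast
  show "{u #> h | h. h \<in> H} \<subseteq> (\<lambda>C. u #> (SOME h. h \<in> C)) ` {D #> h | h. h \<in> H}"
  proof
    fix w assume "w \<in> {u #> h | h. h \<in> H}"
    then obtain h where h: "h \<in> H" "w = u #> h" by blast
    have "\<one> \<in> D" using u subgroup.one_closed[OF H] by (simp add: D coset_mult_one)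
    then have "\<one> \<otimes> h \<in> D #> h" unfolding r_coset_def by blast
    then have "(SOME g. g \<in> D #> h) \<in> D #> h" by (rule someI)
    then obtain d where "d \<in> D" "(SOME g. g \<in> D #> h) = d \<otimes> h" by (auto simp: r_coset_def)
    moreover from this have d: "u #> d = u" "d \<in> carrier G" using HG by (simp_all add: D)
    moreover have "u #> (d \<otimes> h) = u #> d #> h" using u HG[OF h(1)] d(2) by (simp add: coset_mult_assoc)
    ultimately have "w = u #> (SOME g. g \<in> D #> h)" using h by simp
    then show "w \<in> (\<lambda>C. u #> (SOME h. h \<in> C)) ` {D #> h | h. h \<in> H}" using h by blast
  qed
qed

text \<open>Add to \<open>\<Gamma>\<close> all vertices reached from it by \<open>X1*\<close>-words of length at most \<open>n\<close>, and all
  \<open>X1*\<close>-edges between vertices. For large \<open>n\<close> these words include generators of the finitely generated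
  stabilisers, connections between the vertices of \<open>\<Gamma>\<close> in one orbit, and all of the finite orbits.\<close>

lemma orbit_neighbourhood:
  assumes T: "subgroup T G" and X: "X \<subseteq> carrier G" and genX: "generate G X = carrier G"
    and X1: "X1 \<subseteq> X" "finite X1" and G0: "generate G X1 = G0"
    and \<Gamma>: "finite_lsubgraph G \<Gamma> (Cayley G X T)"
    and fg: "\<And>w. w \<in> verts \<Gamma> \<Longrightarrow> fg_subgroup G {g \<in> G0. w #> g = w}"
  shows "\<exists>\<Gamma>'. finite_lsubgraph G \<Gamma>' (Cayley G X T) \<and> subgraph \<Gamma> \<Gamma>' \<and>
    property4 G G0 X1 \<Gamma>' (Cayley G X T) \<and> property5 G G0 X1 \<Gamma>' (Cayley G X T) \<and>
    property7 G G0 X1 \<Gamma>' (Cayley G X T)"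
proof -
  let ?C = "Cayley G X T"
  have X1G: "X1 \<subseteq> carrier G" using X X1 by blast
  have G0s: "subgroup G0 G" unfolding G0[symmetric] using generate_is_subgroup[OF X1G] .
  have G0G: "g \<in> carrier G" if "g \<in> G0" for g using subgroup.mem_carrier[OF G0s that] .
  have ball: "word_ball G X1 n \<subseteq> G0" for n using G0 generate_word_ball[OF X1G] by blast
  have symG0: "x \<in> G0" if "x \<in> sym_gens G X1" for x
    using sym_gens_word_ball[OF X1G that] ball by blast
  have l\<Gamma>: "lsubgraph G \<Gamma> ?C" and fin: "finite (verts \<Gamma>)" "finite (arcs \<Gamma>)"
    using \<Gamma> by (auto simp: finite_lsubgraph_def)
  have vR: "w \<in> rcosets T" if "w \<in> verts \<Gamma>" for w using lsubgraph_verts[OF T X l\<Gamma>] that by blast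
  have RG: "w \<subseteq> carrier G" if "w \<in> rcosets T" for w using vert_carrier[OF T X that] .
  \<comment> \<open>The finitely many elements of \<open>G0\<close> that the words of length \<open>n\<close> have to include.\<close>
  define stab where "stab w = {g \<in> G0. w #> g = w}" for w
  obtain Z where Z: "\<And>w. w \<in> verts \<Gamma> \<Longrightarrow> finite (Z w) \<and> Z w \<subseteq> stab w \<and> generate G (Z w) = stab w"
  proof -
    have "\<forall>w\<in>verts \<Gamma>. \<exists>Z. finite Z \<and> Z \<subseteq> stab w \<and> generate G Z = stab w"
      using fg unfolding fg_subgroup_def stab_def by blast
    from bchoice[OF this] obtain Z where "\<forall>w\<in>verts \<Gamma>. finite (Z w) \<and> Z w \<subseteq> stab w \<and>
      generate G (Z w) = stab w" ..
    then show ?thesis by (intro that[of Z]) (rule bspec)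
  qed
  define c where "c w w' = (SOME h. h \<in> G0 \<and> w' = w #> h)" for w w'
  have c: "c w w' \<in> G0 \<and> w' = w #> c w w'" if "\<exists>h\<in>G0. w' = w #> h" for w w'
    using that someI_ex[of "\<lambda>h. h \<in> G0 \<and> w' = w #> h"] unfolding c_def by blast
  define orbit where "orbit w = {w #> h | h. h \<in> G0}" for w
  define P where "P w = (orbit w \<inter> verts \<Gamma>) \<union> (if finite (orbit w) then orbit w else {})" for w
  define F where "F = (\<Union>w\<in>verts \<Gamma>. Z w) \<union> (\<Union>w\<in>verts \<Gamma>. c w ` P w)"
  have "finite F" unfolding F_def P_def using fin(1) Z by auto
  moreover have "F \<subseteq> generate G X1"
  proof -
    have "P w \<subseteq> orbit w" for w by (auto simp: P_def)
    then have "c w ` P w \<subseteq> G0" for w using c unfolding orbit_def by blast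
    moreover have "Z w \<subseteq> G0" if "w \<in> verts \<Gamma>" for w using Z[OF that] by (auto simp: stab_def)
    ultimately show ?thesis unfolding F_def G0 by blast
  qed
  ultimately obtain n where n: "F \<subseteq> word_ball G X1 n" using finite_subset_word_ball[OF X1G] by blast
  have reach: "w' \<in> (\<lambda>b. w #> b) ` word_ball G X1 n" if "w \<in> verts \<Gamma>" "w' \<in> P w" for w w'
  proof -
    have "w' \<in> orbit w" using that by (auto simp: P_def split: if_splits)
    then have "w' = w #> c w w'" using c by (auto simp: orbit_def)
    moreover have "c w w' \<in> F" using that by (auto simp: F_def)
    ultimately show ?thesis using n by blast
  qed
  define V where "V = (\<Union>w\<in>verts \<Gamma>. (\<lambda>b. w #> b) ` word_ball G X1 n)"
  define E1 where "E1 = {(v, x, v #> x) | v x. v \<in> V \<and> v #> x \<in> V \<and> x \<in> sym_gens G X1}"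
  define \<Gamma>' where "\<Gamma>' = mk_lgraph V (arcs \<Gamma> \<union> E1)"
  have VR: "v \<in> rcosets T" if "v \<in> V" for v
    using that vR vert_mult[OF T X] word_ball_closed[OF X1G] by (auto simp: V_def)
  have one: "\<one> \<in> word_ball G X1 n" using word_ball_mono[of 0 n G X1] by auto
  have \<Gamma>V: "w \<in> V" if "w \<in> verts \<Gamma>" for w
  proof -
    have "w = w #> \<one>" using RG[OF vR[OF that]] by (simp add: coset_mult_one)
    then show ?thesis unfolding V_def using that one by blast
  qed
  have VI: "w #> b \<in> V" if "w \<in> verts \<Gamma>" "b \<in> word_ball G X1 m" "m \<le> n" for w b m
    using that word_ball_mono[OF that(3), of G X1] unfolding V_def by blast
  have step: "(w #> b, x, w #> b #> x) \<in> E1"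
    if "w \<in> verts \<Gamma>" "m < n" "b \<in> word_ball G X1 m" "x \<in> sym_gens G X1" for w m b x
  proof -
    have "b \<otimes> x \<in> word_ball G X1 (Suc m)" using that by auto
    then have "w #> (b \<otimes> x) \<in> V" using VI[OF that(1), of "b \<otimes> x" "Suc m"] that by simp
    moreover have "w #> (b \<otimes> x) = w #> b #> x"
      using RG[OF vR[OF that(1)]] word_ball_closed[OF X1G that(3)] sym_gens_closed[OF X1G that(4)]
      by (simp add: coset_mult_assoc)
    moreover have "w #> b \<in> V" using VI[OF that(1,3)] that by simp
    ultimately show ?thesis using that unfolding E1_def by auto
  qed
  obtain b0 where b0: "b0 \<in> verts \<Gamma>"
    using l\<Gamma> by (auto simp: lsubgraph_def strongly_connected_def)
  have l\<Gamma>': "lsubgraph G \<Gamma>' ?C"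
    unfolding \<Gamma>'_def
  proof (rule lsubgraph_mk_lgraph[OF T X _ _ _ \<Gamma>V[OF b0]])
    show "V \<subseteq> rcosets T" using VR by blast
    show "arcs \<Gamma> \<union> E1 \<subseteq> arcs ?C"
      using lsubgraph_arcs[OF T X l\<Gamma>] VR sym_gens_mono[OF X1(1)]
      by (auto simp: E1_def Cayley_arc_iff[OF T X])
    fix v x w assume "(v, x, w) \<in> arcs \<Gamma> \<union> E1"
    then show "v \<in> V \<and> w \<in> V \<and> (w, inv x, v) \<in> arcs \<Gamma> \<union> E1"
    proof
      assume "(v, x, w) \<in> arcs \<Gamma>"
      then show ?thesis using lsubgraph_arcD(5-7)[OF T X l\<Gamma>] \<Gamma>V by simp
    next
      assume "(v, x, w) \<in> E1"
      then have e: "v \<in> V" "w \<in> V" "w = v #> x" "x \<in> sym_gens G X1" by (auto simp: E1_def)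
      then have "v = w #> inv x"
        using RG[OF VR[OF e(1)]] sym_gens_closed[OF X1G e(4)] by (simp add: coset_mult_assoc coset_mult_one)
      then show ?thesis using e sym_gens_inv[OF X1G e(4)] unfolding E1_def by auto
    qed
  next
    let ?R = "{(v, w). \<exists>x. (v, x, w) \<in> arcs \<Gamma> \<union> E1}"
    fix v assume "v \<in> V"
    then obtain w b where wb: "w \<in> verts \<Gamma>" "b \<in> word_ball G X1 n" "v = w #> b" by (auto simp: V_def)
    have "(b0, w) \<in> {(v, w). \<exists>x. (v, x, w) \<in> arcs \<Gamma>}\<^sup>*"
      using lsubgraph_connected[OF T X l\<Gamma> b0 wb(1)] .
    then have "(b0, w) \<in> ?R\<^sup>*" by (rule rtrancl_mono[THEN subsetD, rotated]) auto
    moreover have "(w, v) \<in> ?R\<^sup>*"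
      unfolding wb(3) using step[OF wb(1)]
      by (intro word_ball_rtrancl[OF X1G RG[OF vR[OF wb(1)]] _ wb(2)]) blast
    ultimately show "(b0, v) \<in> ?R\<^sup>*" by (rule rtrancl_trans)
  qed
  have \<Gamma>'s: "verts \<Gamma>' = V" "arcs \<Gamma>' = arcs \<Gamma> \<union> E1" by (simp_all add: \<Gamma>'_def)
  have "finite V" unfolding V_def using fin finite_word_ball[OF X1(2)] by blast
  moreover have "E1 \<subseteq> (\<lambda>(v, x). (v, x, v #> x)) ` (V \<times> sym_gens G X1)" by (auto simp: E1_def)
  moreover have "finite (sym_gens G X1)" using X1(2) by (simp add: sym_gens_def)
  ultimately have "finite (verts \<Gamma>')" "finite (arcs \<Gamma>')"
    using fin finite_subset[of E1] by (auto simp: \<Gamma>'s)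
  then have fin\<Gamma>': "finite_lsubgraph G \<Gamma>' ?C" using l\<Gamma>' by (simp add: finite_lsubgraph_def)
  have sub: "subgraph \<Gamma> \<Gamma>'"
    using lsubgraph_wf[OF T X l\<Gamma>] lsubgraph_wf[OF T X l\<Gamma>'] \<Gamma>V lsubgraph_ends[OF T X l\<Gamma>]
    by (auto simp: subgraph_def compatible_def \<Gamma>'_def)
  \<comment> \<open>Each vertex \<open>w b\<close> of \<open>\<Gamma>'\<close> is joined to the vertex \<open>w\<close> of \<open>\<Gamma>\<close> by an \<open>X1*\<close>-path with label \<open>b\<close>.\<close>
  have comp: "b \<in> path_labels G (label_component G X1 \<Gamma>' w) w (w #> b)"
    if w: "w \<in> verts \<Gamma>" and b: "b \<in> word_ball G X1 n" for w b
  proof -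
    have wV: "w \<in> verts \<Gamma>'" using \<Gamma>V[OF w] \<Gamma>'s by simp
    note C = lsubgraph_label_component[OF T X X1(1) l\<Gamma>' wV]
    show ?thesis
    proof (rule word_ball_path_labels[OF T X C _ X1G _ b])
      show "w \<in> verts (label_component G X1 \<Gamma>' w)" using label_component_self[OF T X X1(1) l\<Gamma>' wV] .
      fix m b x assume "m < n" "b \<in> word_ball G X1 m" "x \<in> sym_gens G X1"
        and v: "w #> b \<in> verts (label_component G X1 \<Gamma>' w)"
      then show "(w #> b, x, w #> b #> x) \<in> arcs (label_component G X1 \<Gamma>' w)"
        using label_component_step(2)[OF T X X1(1) l\<Gamma>' wV v] step[OF w] \<Gamma>'s by blast
    qed
  qed
  have compV: "w #> b \<in> verts (label_component G X1 \<Gamma>' w)"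
    "label_component G X1 \<Gamma>' (w #> b) = label_component G X1 \<Gamma>' w"
    if w: "w \<in> verts \<Gamma>" and b: "b \<in> word_ball G X1 n" for w b
  proof -
    have wV: "w \<in> verts \<Gamma>'" using \<Gamma>V[OF w] \<Gamma>'s by simp
    show v: "w #> b \<in> verts (label_component G X1 \<Gamma>' w)"
      using path_labels_carrier[OF T X lsubgraph_label_component[OF T X X1(1) l\<Gamma>' wV] comp[OF w b]] by blast
    show "label_component G X1 \<Gamma>' (w #> b) = label_component G X1 \<Gamma>' w"
      using label_component_eq[OF T X X1(1) l\<Gamma>' wV v] .
  qed
  have VE: thesis if "v \<in> V" "\<And>w b. w \<in> verts \<Gamma> \<Longrightarrow> b \<in> word_ball G X1 n \<Longrightarrow> v = w #> b \<Longrightarrow> thesis" for v thesis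
    using that unfolding V_def by blast
  have p4: "property4 G G0 X1 \<Gamma>' ?C"
    unfolding property4_def
  proof (intro ballI)
    fix v g assume "v \<in> verts \<Gamma>'" and g: "g \<in> Lab G ?C v \<inter> G0"
    then obtain w b where wb: "w \<in> verts \<Gamma>" "b \<in> word_ball G X1 n" "v = w #> b" using VE \<Gamma>'s by metis
    have wV: "w \<in> verts \<Gamma>'" using \<Gamma>V[OF wb(1)] \<Gamma>'s by simp
    let ?W = "label_component G X1 \<Gamma>' w"
    note C = lsubgraph_label_component[OF T X X1(1) l\<Gamma>' wV]
    have bG0: "b \<in> G0" using wb(2) ball by blast
    have G: "b \<in> carrier G" "g \<in> carrier G" "w \<subseteq> carrier G"
      using bG0 g G0G RG[OF vR[OF wb(1)]] by auto
    have vR': "v \<in> rcosets T" using VR wb(3) VI[OF wb(1,2)] by simp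
    have vg: "v #> g = v" using g path_labels_Cayley[OF T X genX vR'] by (auto simp: Lab_def)
    have "w #> (b \<otimes> g \<otimes> inv b) = v #> g #> inv b"
      using G wb(3) by (simp add: coset_mult_assoc m_assoc)
    also have "\<dots> = w" unfolding vg using wb(3) G by (simp add: coset_mult_assoc coset_mult_one)
    finally have "b \<otimes> g \<otimes> inv b \<in> stab w"
      using bG0 g G0s by (simp add: stab_def subgroup.m_closed subgroup.m_inv_closed)
    moreover have "Z w \<subseteq> Lab G ?W w"
    proof
      fix z assume z: "z \<in> Z w"
      have "z \<in> word_ball G X1 n" "w #> z = w"
        using z n wb(1) Z[OF wb(1)] by (auto simp: F_def stab_def)
      then show "z \<in> Lab G ?W w" using comp[OF wb(1), of z] by (simp add: Lab_def)
    qed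
    then have "generate G (Z w) \<subseteq> Lab G ?W w"
      using subgroup_Lab[OF T X C label_component_self[OF T X X1(1) l\<Gamma>' wV]] by (rule generate_subgroup_incl)
    ultimately have loop: "b \<otimes> g \<otimes> inv b \<in> path_labels G ?W w w" using Z[OF wb(1)] by (auto simp: Lab_def)
    have b: "b \<in> path_labels G ?W w v" using comp[OF wb(1,2)] wb(3) by simp
    have "inv b \<otimes> (b \<otimes> g \<otimes> inv b \<otimes> b) \<in> path_labels G ?W v v"
      using path_labels_trans[OF T X C path_labels_inv[OF T X C b] path_labels_trans[OF T X C loop b]] .
    moreover have "inv b \<otimes> (b \<otimes> g \<otimes> inv b \<otimes> b) = g" using G by (simp add: group_normalize)
    ultimately have "g \<in> path_labels G (label_component G X1 \<Gamma>' v) v v"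
      using compV(2)[OF wb(1,2)] wb(3) by simp
    then show "\<exists>p. pre_digraph.awalk (label_component G X1 \<Gamma>' v) v p v \<and> path_label G p = g"
      by (auto simp: path_labels_def)
  qed
  have p5: "property5 G G0 X1 \<Gamma>' ?C"
    unfolding property5_def
  proof (intro ballI)
    fix u v assume uv: "u \<in> verts \<Gamma>'" "v \<in> verts \<Gamma>'"
    have uR: "u \<in> rcosets T" using uv VR \<Gamma>'s by simp
    have "(\<exists>p. pre_digraph.awalk ?C u p v \<and> path_label G p \<in> G0) \<longleftrightarrow> (\<exists>g\<in>G0. g \<in> path_labels G ?C u v)"
      unfolding path_labels_def by blast
    also have "\<dots> \<longleftrightarrow> (\<exists>g\<in>G0. v = u #> g)" using path_labels_Cayley[OF T X genX uR] G0G by blast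
    also have "\<dots> \<longleftrightarrow> v \<in> verts (label_component G X1 \<Gamma>' u)"
    proof
      assume "v \<in> verts (label_component G X1 \<Gamma>' u)"
      then show "\<exists>g\<in>G0. v = u #> g" using label_component_orbit[OF T X X1(1) l\<Gamma>' uv(1)] G0 by blast
    next
      assume "\<exists>g\<in>G0. v = u #> g"
      then obtain g where g: "g \<in> G0" "v = u #> g" by blast
      obtain w b where wb: "w \<in> verts \<Gamma>" "b \<in> word_ball G X1 n" "u = w #> b" using uv(1) VE \<Gamma>'s by metis
      obtain w' b' where wb': "w' \<in> verts \<Gamma>" "b' \<in> word_ball G X1 n" "v = w' #> b'" using uv(2) VE \<Gamma>'s by metis
      have G: "b \<in> G0" "b' \<in> G0" "w \<subseteq> carrier G" "w' \<subseteq> carrier G"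
        using wb wb' ball RG[OF vR] by auto
      have "w' = v #> inv b'" using wb'(3) G G0G by (simp add: coset_mult_assoc coset_mult_one)
      also have "\<dots> = w #> (b \<otimes> g \<otimes> inv b')"
        unfolding g(2) wb(3) using G G0G g(1) by (simp add: coset_mult_assoc m_assoc)
      finally have "w' \<in> orbit w"
        using G g(1) G0s unfolding orbit_def by (blast intro: subgroup.m_closed subgroup.m_inv_closed)
      then obtain d where "d \<in> word_ball G X1 n" "w' = w #> d"
        using reach[OF wb(1), of w'] wb'(1) by (auto simp: P_def)
      then have "label_component G X1 \<Gamma>' w' = label_component G X1 \<Gamma>' w" using compV(2)[OF wb(1)] by simp
      then show "v \<in> verts (label_component G X1 \<Gamma>' u)"
        using compV(1)[OF wb'(1,2)] compV(2)[OF wb(1,2)] wb wb' by simp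
    qed
    finally show "(\<exists>p. pre_digraph.awalk ?C u p v \<and> path_label G p \<in> G0) \<longleftrightarrow>
      v \<in> verts (label_component G X1 \<Gamma>' u)" .
  qed
  have p7: "property7 G G0 X1 \<Gamma>' ?C"
    unfolding property7_def
  proof (intro ballI impI)
    fix v assume "v \<in> verts \<Gamma>'" and idx: "finite_index (G\<lparr>carrier := G0\<rparr>) (Lab G ?C v \<inter> G0)"
    then obtain w b where wb: "w \<in> verts \<Gamma>" "b \<in> word_ball G X1 n" "v = w #> b" using VE \<Gamma>'s by metis
    have vV: "v \<in> V" "v \<in> rcosets T" using VI[OF wb(1,2)] wb(3) VR by auto
    have G: "b \<in> G0" "w \<subseteq> carrier G" using wb ball RG[OF vR] by auto
    have "Lab G ?C v \<inter> G0 = {g \<in> G0. v #> g = v}"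
      unfolding Lab_def path_labels_Cayley[OF T X genX vV(2)] using G0G by auto
    then have fin_v: "finite {v #> h | h. h \<in> G0}"
      using finite_orbit[OF RG[OF vV(2)] G0s _ idx] by simp
    have orb: "orbit w \<subseteq> {v #> h | h. h \<in> G0}"
    proof
      fix u assume "u \<in> orbit w"
      then obtain h where h: "h \<in> G0" "u = w #> h" by (auto simp: orbit_def)
      have "u = v #> (inv b \<otimes> h)"
        using h wb(3) G G0G by (simp add: coset_mult_assoc group_normalize)
      moreover have "inv b \<otimes> h \<in> G0" using h G G0s by (simp add: subgroup.m_closed subgroup.m_inv_closed)
      ultimately show "u \<in> {v #> h | h. h \<in> G0}" by blast
    qed
    then have fin_w: "finite (orbit w)" using fin_v finite_subset by blast
    have orbV: "u \<in> V" if "u \<in> orbit w" for u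
      using reach[OF wb(1), of u] that fin_w VI[OF wb(1)] by (auto simp: P_def)
    show "saturated G X1 \<Gamma>' v"
      unfolding saturated_def
    proof
      fix s assume s: "s \<in> sym_gens G X1"
      have "v #> s = w #> (b \<otimes> s)" using wb(3) G G0G symG0[OF s] by (simp add: coset_mult_assoc)
      then have "v #> s \<in> V"
        using orbV[of "v #> s"] G symG0[OF s] subgroup.m_closed[OF G0s] unfolding orbit_def by blast
      then show "\<exists>u. (v, s, u) \<in> arcs \<Gamma>'" using s vV by (auto simp: \<Gamma>'s E1_def)
    qed
  qed
  show ?thesis using fin\<Gamma>' sub p4 p5 p7 by blast
qed

end

section \<open>Gluing in a finite cover of \<open>G0\<close>\<close>

context group
begin

lemma subgroup_absorb_left:
  assumes K: "subgroup K G" and S: "subgroup S G" and SK: "S \<subseteq> K" and g: "g \<in> carrier G"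
  shows "K <#> (S #> g) = K #> g"
proof -
  have KG: "k \<in> carrier G" if "k \<in> K" for k using subgroup.mem_carrier[OF K that] .
  have "K <#> S = K"
  proof
    show "K <#> S \<subseteq> K" using subgroup.m_closed[OF K] SK by (auto simp: set_mult_def)
    show "K \<subseteq> K <#> S"
    proof
      fix k assume k: "k \<in> K"
      then have "k = k \<otimes> \<one>" using KG by simp
      then show "k \<in> K <#> S" using k subgroup.one_closed[OF S] unfolding set_mult_def by blast
    qed
  qed
  then show ?thesis
    using setmult_rcos_assoc[OF subgroup.subset[OF K] subgroup.subset[OF S] g] by simp
qed

lemma rcos_eq_iff:
  assumes K: "subgroup K G" and gh: "g \<in> carrier G" "h \<in> carrier G"
  shows "K #> g = K #> h \<longleftrightarrow> g \<otimes> inv h \<in> K"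
proof
  assume "K #> g = K #> h"
  moreover have "g \<in> K #> g" using rcos_self[OF gh(1) K] .
  ultimately obtain k where "k \<in> K" "g = k \<otimes> h" by (auto simp: r_coset_def)
  then show "g \<otimes> inv h \<in> K" using gh subgroup.mem_carrier[OF K] by (simp add: m_assoc)
next
  assume k: "g \<otimes> inv h \<in> K"
  have "K #> g = K #> (g \<otimes> inv h) #> h"
    using gh subgroup.subset[OF K] by (simp add: coset_mult_assoc m_assoc)
  then show "K #> g = K #> h" using coset_join2[OF _ K k] gh by simp
qed

text \<open>The image of \<open>\<Gamma>'\<close> in \<open>Cayley G X K\<close> together with the orbit of the base vertex under \<open>G0\<close>. The
  last three assumptions say that passing from \<open>S\<close> to \<open>K\<close> identifies no vertices of \<open>\<Gamma>'\<close>, joins no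
  orbits of \<open>\<Gamma>'\<close>, and enlarges no stabiliser outside the base orbit.\<close>

lemma separating_extension_quotient:
  assumes X: "X \<subseteq> carrier G" and genX: "generate G X = carrier G"
    and X1: "X1 \<subseteq> X" "finite X1" and G0: "generate G X1 = G0"
    and T: "subgroup T G" and \<Gamma>: "lsubgraph G \<Gamma> (Cayley G X T)" and v: "v \<in> verts \<Gamma>"
    and S: "Lab G \<Gamma> v = S"
    and \<Gamma>': "finite_lsubgraph G \<Gamma>' (Cayley G X S)"
    and sub: "subgraph (map_lgraph (path_labels G \<Gamma> v) \<Gamma>) \<Gamma>'"
    and p: "property4 G G0 X1 \<Gamma>' (Cayley G X S)" "property5 G G0 X1 \<Gamma>' (Cayley G X S)"
      "property7 G G0 X1 \<Gamma>' (Cayley G X S)"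
    and L: "subgroup L G" and K: "generate G (S \<union> L) = K" and KL: "K \<inter> G0 = L"
    and fin: "finite {K #> h | h. h \<in> G0}"
    and inj: "inj_on (\<lambda>u. K <#> u) (verts \<Gamma>')"
    and orbits: "\<And>u w g. u \<in> verts \<Gamma>' \<Longrightarrow> w \<in> verts \<Gamma>' \<Longrightarrow> g \<in> G0 \<Longrightarrow> K <#> w = K <#> u #> g \<Longrightarrow>
      \<exists>h\<in>G0. w = u #> h"
    and stab: "\<And>u g. u \<in> verts \<Gamma>' \<Longrightarrow> g \<in> G0 \<Longrightarrow> u \<notin> {S #> h | h. h \<in> G0} \<Longrightarrow>
      K <#> u #> g = K <#> u \<Longrightarrow> u #> g = u"
  shows "\<exists>\<Delta> d f. separating_extension G G0 X1 X \<Gamma> v \<Gamma>' \<Delta> d f \<and> Lab G \<Delta> d \<inter> G0 = L"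
proof -
  have X1G: "X1 \<subseteq> carrier G" using X X1 by blast
  have G0s: "subgroup G0 G" unfolding G0[symmetric] using generate_is_subgroup[OF X1G] .
  have G0G: "g \<in> carrier G" if "g \<in> G0" for g using subgroup.mem_carrier[OF G0s that] .
  have symG0: "x \<in> G0" if "x \<in> sym_gens G X1" for x
    using sym_gens_word_ball[OF X1G that] G0 generate_word_ball[OF X1G] by blast
  have Ss: "subgroup S G" using subgroup_Lab[OF T X \<Gamma> v] S by simp
  have SLG: "S \<union> L \<subseteq> carrier G" using subgroup.subset Ss L by blast
  have Ks: "subgroup K G" unfolding K[symmetric] using generate_is_subgroup[OF SLG] .
  have SK: "S \<subseteq> K" "L \<subseteq> K" unfolding K[symmetric] by (auto intro: generate.incl)
  have KG: "K \<subseteq> carrier G" using subgroup.subset[OF Ks] .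
  define f where "f u = K <#> u" for u
  have f_mult: "f (u #> g) = f u #> g" if "u \<subseteq> carrier G" "g \<in> carrier G" for u g
    using setmult_rcos_assoc[OF KG that] by (simp add: f_def)
  have f_coset: "f (S #> g) = K #> g" if "g \<in> carrier G" for g
    using subgroup_absorb_left[OF Ks Ss SK(1) that] by (simp add: f_def)
  have K1: "K #> \<one> = K" and S1: "S #> \<one> = S" using KG subgroup.subset[OF Ss] by (simp_all add: coset_mult_one)
  have fS: "f S = K" using f_coset[of \<one>] K1 S1 by simp
  have l\<Gamma>': "lsubgraph G \<Gamma>' (Cayley G X S)" and fin\<Gamma>': "finite (verts \<Gamma>')" "finite (arcs \<Gamma>')"
    using \<Gamma>' by (auto simp: finite_lsubgraph_def)
  have R: "u \<in> rcosets S" if "u \<in> verts \<Gamma>'" for u using lsubgraph_verts[OF Ss X l\<Gamma>'] that by blast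
  have fR: "f u \<in> rcosets K" if "u \<in> rcosets S" for u
    using that f_coset by (auto simp: RCOSETS_def)
  have RG: "u \<subseteq> carrier G" if "u \<in> rcosets S" for u using vert_carrier[OF Ss X that] .
  have base: "path_labels G \<Gamma> v v = S" using S by (simp add: Lab_def)
  have S\<Gamma>': "S \<in> verts \<Gamma>'"
    using sub v base by (auto simp: subgraph_def map_lgraph_def)
  define Orb where "Orb = {K #> h | h. h \<in> G0}"
  have OrbR: "V \<in> rcosets K" if "V \<in> Orb" for V using that G0G by (auto simp: Orb_def RCOSETS_def)
  have Orb_mult: "V #> h \<in> Orb" if V: "V \<in> Orb" and h: "h \<in> G0" for V h
  proof -
    obtain h0 where h0: "h0 \<in> G0" "V = K #> h0" using V by (auto simp: Orb_def)
    then have "V #> h = K #> (h0 \<otimes> h)" using KG G0G h by (simp add: coset_mult_assoc)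
    then show ?thesis using subgroup.m_closed[OF G0s h0(1) h] by (auto simp: Orb_def)
  qed
  have KOrb: "K \<in> Orb" using K1 subgroup.one_closed[OF G0s] unfolding Orb_def by blast
  define E1 where "E1 = {(V, x, V #> x) | V x. V \<in> Orb \<and> x \<in> sym_gens G X1}"
  define \<Delta> where "\<Delta> = mk_lgraph (f ` verts \<Gamma>' \<union> Orb) (map_edge f ` arcs \<Gamma>' \<union> E1)"
  have \<Delta>s: "verts \<Delta> = f ` verts \<Gamma>' \<union> Orb" "arcs \<Delta> = map_edge f ` arcs \<Gamma>' \<union> E1"
    by (simp_all add: \<Delta>_def)
  have f_arc: "(f u, x, f w) \<in> arcs (Cayley G X K)" if "(u, x, w) \<in> arcs \<Gamma>'" for u x w
  proof -
    note a = lsubgraph_arcD[OF Ss X l\<Gamma>' that]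
    have "f w = f u #> x" unfolding a(4) using f_mult a(2,3) by blast
    then show ?thesis using a fR R by (simp add: Cayley_arc_iff[OF Ks X])
  qed
  have l\<Delta>: "lsubgraph G \<Delta> (Cayley G X K)"
    unfolding \<Delta>_def
  proof (rule lsubgraph_mk_lgraph[OF Ks X])
    show "f ` verts \<Gamma>' \<union> Orb \<subseteq> rcosets K" using fR R OrbR by blast
    show "map_edge f ` arcs \<Gamma>' \<union> E1 \<subseteq> arcs (Cayley G X K)"
      using f_arc OrbR sym_gens_mono[OF X1(1)]
      by (auto simp: E1_def map_edge_def Cayley_arc_iff[OF Ks X])
    show "K \<in> f ` verts \<Gamma>' \<union> Orb" using KOrb by blast
    fix V x W assume "(V, x, W) \<in> map_edge f ` arcs \<Gamma>' \<union> E1"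
    then show "V \<in> f ` verts \<Gamma>' \<union> Orb \<and> W \<in> f ` verts \<Gamma>' \<union> Orb \<and>
      (W, inv x, V) \<in> map_edge f ` arcs \<Gamma>' \<union> E1"
    proof
      assume "(V, x, W) \<in> map_edge f ` arcs \<Gamma>'"
      then obtain u w where uw: "(u, x, w) \<in> arcs \<Gamma>'" "V = f u" "W = f w" by (auto simp: map_edge_def)
      note a = lsubgraph_arcD[OF Ss X l\<Gamma>' uw(1)]
      have "(W, inv x, V) \<in> map_edge f ` arcs \<Gamma>'"
        using a(5) uw by (intro image_eqI[of _ _ "(w, inv x, u)"]) (auto simp: map_edge_def)
      then show ?thesis using a(6,7) uw by simp
    next
      assume "(V, x, W) \<in> E1"
      then have e: "V \<in> Orb" "x \<in> sym_gens G X1" "W = V #> x" by (auto simp: E1_def)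
      have "V \<subseteq> carrier G" using vert_carrier[OF Ks X OrbR[OF e(1)]] .
      then have "V = W #> inv x"
        using e(3) sym_gens_closed[OF X1G e(2)] by (simp add: coset_mult_assoc coset_mult_one)
      moreover have "W \<in> Orb" using e Orb_mult symG0 by blast
      ultimately show ?thesis using e sym_gens_inv[OF X1G e(2)] unfolding E1_def by auto
    qed
  next
    let ?R = "{(V, W). \<exists>x. (V, x, W) \<in> map_edge f ` arcs \<Gamma>' \<union> E1}"
    fix V assume "V \<in> f ` verts \<Gamma>' \<union> Orb"
    then show "(K, V) \<in> ?R\<^sup>*"
    proof
      assume "V \<in> f ` verts \<Gamma>'"
      then obtain u where u: "u \<in> verts \<Gamma>'" "V = f u" by blast
      show ?thesis
        using map_edges_rtrancl[OF lsubgraph_connected[OF Ss X l\<Gamma>' S\<Gamma>' u(1)], of f, OF Un_upper1]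
        unfolding fS u(2) by blast
    next
      assume "V \<in> Orb"
      then obtain h n where h: "h \<in> word_ball G X1 n" "V = K #> h"
        using G0 generate_word_ball[OF X1G] by (auto simp: Orb_def)
      show ?thesis
        unfolding h(2)
      proof (rule word_ball_rtrancl[OF X1G KG _ h(1)])
        fix m b x assume "b \<in> word_ball G X1 m" "x \<in> sym_gens G X1"
        moreover from this have "b \<in> G0" using G0 generate_word_ball[OF X1G] by blast
        ultimately show "(K #> b, x, K #> b #> x) \<in> map_edge f ` arcs \<Gamma>' \<union> E1"
          by (auto simp: E1_def Orb_def)
      qed
    qed
  qed
  have K\<Delta>: "K \<in> verts \<Delta>" using KOrb \<Delta>s by simp
  have E1\<Delta>: "(K #> h, x, K #> h #> x) \<in> arcs \<Delta>" if "h \<in> G0" "x \<in> sym_gens G X1" for h x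
    using that by (auto simp: \<Delta>s E1_def Orb_def)
  \<comment> \<open>The image of \<open>\<Gamma>'\<close> supplies the labels in \<open>S\<close>, the orbit of the base vertex those in \<open>L\<close>.\<close>
  have LabK: "Lab G \<Delta> K = K"
  proof
    show "Lab G \<Delta> K \<subseteq> K"
    proof
      fix g assume "g \<in> Lab G \<Delta> K"
      then have "g \<in> carrier G" "K #> g = K" using path_labels_carrier[OF Ks X l\<Delta>] by (auto simp: Lab_def)
      then show "g \<in> K" using rcos_eq_iff[OF Ks, of g \<one>] K1 by simp
    qed
    have LL: "L \<subseteq> Lab G \<Delta> K"
    proof
      fix h assume h: "h \<in> L"
      then have "h \<in> G0" "h \<in> K" using KL by auto
      then obtain n where n: "h \<in> word_ball G X1 n" using G0 generate_word_ball[OF X1G] by blast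
      have "h \<in> path_labels G \<Delta> K (K #> h)"
      proof (rule word_ball_path_labels[OF Ks X l\<Delta> K\<Delta> X1G _ n])
        fix m b x assume "b \<in> word_ball G X1 m" "x \<in> sym_gens G X1"
        moreover from this have "b \<in> G0" using G0 generate_word_ball[OF X1G] by blast
        ultimately show "(K #> b, x, K #> b #> x) \<in> arcs \<Delta>" by (intro E1\<Delta>)
      qed
      then show "h \<in> Lab G \<Delta> K" using coset_join2[OF _ Ks \<open>h \<in> K\<close>] KG \<open>h \<in> K\<close> by (auto simp: Lab_def)
    qed
    have SLab: "S \<subseteq> Lab G \<Delta> K"
    proof
      fix s assume "s \<in> S"
      then have "s \<in> path_labels G \<Gamma> v v" using base by simp
      moreover have "path_labels G \<Gamma> v ` verts \<Gamma> \<subseteq> verts \<Gamma>'" "map_edge (path_labels G \<Gamma> v) ` arcs \<Gamma> \<subseteq> arcs \<Gamma>'"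
        using sub by (auto simp: subgraph_def map_lgraph_def)
      ultimately have "s \<in> path_labels G \<Gamma>' S S"
        using path_labels_map[OF T X \<Gamma> Ss l\<Gamma>', of "path_labels G \<Gamma> v" s v v] base by simp
      then have "s \<in> path_labels G \<Delta> (f S) (f S)"
        by (rule path_labels_map[OF Ss X l\<Gamma>' Ks l\<Delta>, rotated 2]) (simp_all add: \<Delta>s)
      then show "s \<in> Lab G \<Delta> K" by (simp add: Lab_def fS)
    qed
    have "generate G (S \<union> L) \<subseteq> Lab G \<Delta> K"
      by (rule generate_subgroup_incl[OF _ subgroup_Lab[OF Ks X l\<Delta> K\<Delta>]]) (use LL SLab in blast)
    then show "K \<subseteq> Lab G \<Delta> K" using K by simp
  qed
  \<comment> \<open>So the canonical map from \<open>\<Delta>\<close> to \<open>tilde G X \<Delta> K\<close> is the inclusion.\<close>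
  have j: "path_labels G \<Delta> K V = V" if V: "V \<in> verts \<Delta>" for V
  proof -
    obtain g where g: "g \<in> path_labels G \<Delta> K V"
      using path_labels_nonempty[OF Ks X l\<Delta> K\<Delta> V] by blast
    then show ?thesis
      using path_labels_coset[OF Ks X l\<Delta> g] path_labels_carrier[OF Ks X l\<Delta> g] LabK by simp
  qed
  let ?O = "label_component G X1 \<Delta> K"
  have O_verts: "verts ?O = Orb"
    using label_component_full_orbit[OF Ks X X1(1) l\<Delta> K\<Delta>] E1\<Delta> G0 by (simp add: Orb_def)
  have O_arcs: "arcs ?O = E1"
  proof
    show "arcs ?O \<subseteq> E1"
    proof
      fix e assume e: "e \<in> arcs ?O"
      obtain V x W where vxw: "e = (V, x, W)" by (cases e)
      have "(V, x, W) \<in> arcs \<Delta>" "x \<in> sym_gens G X1" "V \<in> Orb"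
        using e O_verts label_component_arcs[OF Ks X X1(1) l\<Delta>] unfolding vxw by auto
      then show "e \<in> E1" using lsubgraph_arcD(4)[OF Ks X l\<Delta>] unfolding vxw E1_def by blast
    qed
    show "E1 \<subseteq> arcs ?O"
    proof
      fix e assume e: "e \<in> E1"
      then obtain V x where vx: "e = (V, x, V #> x)" "V \<in> Orb" "x \<in> sym_gens G X1" by (auto simp: E1_def)
      have "V #> x \<in> Orb" using Orb_mult vx symG0 by blast
      then show "e \<in> arcs ?O"
        using e vx O_verts label_component_arcs[OF Ks X X1(1) l\<Delta>] by (simp add: \<Delta>s)
    qed
  qed
  have finE1: "finite E1"
  proof (rule finite_subset)
    show "E1 \<subseteq> (\<lambda>(V, x). (V, x, V #> x)) ` (Orb \<times> sym_gens G X1)" by (auto simp: E1_def)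
    show "finite ((\<lambda>(V, x). (V, x, V #> x)) ` (Orb \<times> sym_gens G X1))"
      using fin X1(2) by (auto simp: Orb_def sym_gens_def)
  qed
  have fin\<Delta>: "finite_lsubgraph G \<Delta> (Cayley G X K)"
    using l\<Delta> fin\<Gamma>' fin finE1 by (simp add: finite_lsubgraph_def \<Delta>s Orb_def)
  have cover: "is_cover (G\<lparr>carrier := G0\<rparr>) X1 ?O"
  proof -
    let ?H = "G\<lparr>carrier := G0\<rparr>"
    have LG0: "L \<subseteq> G0" using KL by blast
    have Ls: "subgroup L ?H" using subgroup_incl[OF L G0s LG0] .
    \<comment> \<open>Intersecting with \<open>G0\<close> turns the cosets \<open>K h\<close> into the cosets \<open>L h\<close>.\<close>
    define \<phi> where "\<phi> V = V \<inter> G0" for V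
    have \<phi>: "\<phi> (K #> h) = L #> h" if h: "h \<in> G0" for h
    proof
      show "\<phi> (K #> h) \<subseteq> L #> h"
      proof
        fix g assume "g \<in> \<phi> (K #> h)"
        then obtain k where k: "k \<in> K" "g = k \<otimes> h" "g \<in> G0" by (auto simp: \<phi>_def r_coset_def)
        have "k = g \<otimes> inv h" using k G0G[OF h] KG by (auto simp: m_assoc)
        then have "k \<in> G0"
          using subgroup.m_closed[OF G0s k(3) subgroup.m_inv_closed[OF G0s h]] by simp
        then show "g \<in> L #> h" using k KL by (auto simp: r_coset_def)
      qed
      show "L #> h \<subseteq> \<phi> (K #> h)"
        using SK LG0 h subgroup.m_closed[OF G0s] by (auto simp: \<phi>_def r_coset_def)
    qed
    have cosetH: "A #>\<^bsub>?H\<^esub> g = A #> g" for A g by (simp add: r_coset_def)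
    have symH: "sym_gens ?H X1 = sym_gens G X1"
    proof -
      have "X1 \<subseteq> G0" using G0 by (auto intro: generate.incl)
      then have "m_inv ?H ` X1 = m_inv G ` X1"
        using m_inv_consistent[OF G0s] by (intro image_cong) auto
      then show ?thesis by (simp add: sym_gens_def)
    qed
    have "inj_on \<phi> Orb"
    proof (rule inj_onI)
      fix V W assume "V \<in> Orb" "W \<in> Orb" and eq: "\<phi> V = \<phi> W"
      then obtain h h' where h: "h \<in> G0" "V = K #> h" "h' \<in> G0" "W = K #> h'" by (auto simp: Orb_def)
      then have "L #> h = L #> h'" using eq \<phi> by simp
      then have "h \<otimes> inv h' \<in> L" using rcos_eq_iff[OF L] h G0G by blast
      then show "V = W" using rcos_eq_iff[OF Ks] h G0G SK by blast
    qed
    moreover have "\<phi> ` Orb = verts (Cayley ?H X1 L)"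
      using \<phi> by (force simp: Orb_def Cayley_def mk_lgraph_def RCOSETS_def cosetH)
    moreover have "map_edge \<phi> ` E1 = arcs (Cayley ?H X1 L)"
    proof -
      have "map_edge \<phi> (K #> h, x, K #> h #> x) = (L #> h, x, L #> (h \<otimes> x))"
        if "h \<in> G0" "x \<in> sym_gens G X1" for h x
      proof -
        have "K #> h #> x = K #> (h \<otimes> x)"
          using KG G0G that(1) sym_gens_closed[OF X1G that(2)] by (simp add: coset_mult_assoc)
        then show ?thesis
          using \<phi>[OF that(1)] \<phi>[of "h \<otimes> x"] subgroup.m_closed[OF G0s that(1) symG0[OF that(2)]]
          by (simp add: map_edge_def)
      qed
      note me = this
      have "E1 = (\<lambda>(h, x). (K #> h, x, K #> h #> x)) ` (G0 \<times> sym_gens G X1)"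
        by (auto simp: E1_def Orb_def)
      then have "map_edge \<phi> ` E1 = (\<lambda>(h, x). map_edge \<phi> (K #> h, x, K #> h #> x)) ` (G0 \<times> sym_gens G X1)"
        by (simp add: image_image case_prod_unfold)
      also have "\<dots> = (\<lambda>(h, x). (L #> h, x, L #> (h \<otimes> x))) ` (G0 \<times> sym_gens G X1)"
        using me by (intro image_cong) auto
      also have "\<dots> = arcs (Cayley ?H X1 L)"
        by (auto simp: Cayley_def mk_lgraph_def cosetH symH)
      finally show ?thesis .
    qed
    ultimately show ?thesis
      unfolding is_cover_def lgraph_iso_def using Ls O_verts O_arcs by auto
  qed
  have comp_S: "verts (label_component G X1 (Cayley G X S) u) = {u #> h | h. h \<in> G0}" if "u \<in> rcosets S" for u
    using label_component_Cayley[OF Ss X genX that X1(1)] G0 by simp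
  have comp_K: "verts (label_component G X1 (Cayley G X K) u) = {u #> h | h. h \<in> G0}" if "u \<in> rcosets K" for u
    using label_component_Cayley[OF Ks X genX that X1(1)] G0 by simp
  have Lab_S: "Lab G (Cayley G X S) u = {g \<in> carrier G. u #> g = u}" if "u \<in> rcosets S" for u
    using path_labels_Cayley[OF Ss X genX that, of u] by (auto simp: Lab_def)
  have Lab_K: "Lab G (Cayley G X K) u = {g \<in> carrier G. u #> g = u}" if "u \<in> rcosets K" for u
    using path_labels_Cayley[OF Ks X genX that, of u] by (auto simp: Lab_def)
  have "separating_extension G G0 X1 X \<Gamma> v \<Gamma>' \<Delta> K f"
    unfolding separating_extension_def Let_def tilde_def S LabK
  proof (intro conjI)
    show "finite_lsubgraph G \<Gamma>' (Cayley G X S)" "subgraph (map_lgraph (path_labels G \<Gamma> v) \<Gamma>) \<Gamma>'"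
      "property4 G G0 X1 \<Gamma>' (Cayley G X S)" "property5 G G0 X1 \<Gamma>' (Cayley G X S)"
      "property7 G G0 X1 \<Gamma>' (Cayley G X S)" "is_cover (G\<lparr>carrier := G0\<rparr>) X1 ?O" "f S = K"
      by fact+
    show "finite_cover_subgraph G X \<Delta> K"
      unfolding finite_cover_subgraph_def using fin\<Delta> Ks K\<Delta> by blast
    show "lgraph_embedding f \<Gamma>' \<Delta>"
      using inj unfolding lgraph_embedding_def \<Delta>s f_def by auto
    show "\<forall>e\<in>arcs \<Delta>. e \<notin> map_edge f ` arcs \<Gamma>' \<longrightarrow> e \<in> arcs ?O" using \<Delta>s O_arcs by blast
    show "\<forall>u\<in>verts \<Gamma>'. u \<notin> verts (label_component G X1 (Cayley G X S) S) \<longrightarrow>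
      Lab G (Cayley G X S) u \<inter> G0 = Lab G (Cayley G X K) (path_labels G \<Delta> K (f u)) \<inter> G0"
    proof (intro ballI impI)
      fix u assume u: "u \<in> verts \<Gamma>'" and "u \<notin> verts (label_component G X1 (Cayley G X S) S)"
      then have nu: "u \<notin> {S #> h | h. h \<in> G0}" using comp_S[OF R[OF S\<Gamma>']] by simp
      have ju: "path_labels G \<Delta> K (f u) = f u" using j u \<Delta>s by simp
      have "u #> g = u \<longleftrightarrow> f u #> g = f u" if "g \<in> G0" for g
        using stab[OF u that nu] f_mult[OF RG[OF R[OF u]] G0G[OF that]] by (auto simp: f_def)
      then show "Lab G (Cayley G X S) u \<inter> G0 = Lab G (Cayley G X K) (path_labels G \<Delta> K (f u)) \<inter> G0"
        unfolding ju Lab_S[OF R[OF u]] Lab_K[OF fR[OF R[OF u]]] by blast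
    qed
    show "\<forall>u\<in>verts \<Gamma>'. \<forall>w\<in>verts \<Gamma>'.
      path_labels G \<Delta> K (f w) \<in> verts (label_component G X1 (Cayley G X K) (path_labels G \<Delta> K (f u))) \<longleftrightarrow>
      w \<in> verts (label_component G X1 (Cayley G X S) u)"
    proof (intro ballI)
      fix u w assume u: "u \<in> verts \<Gamma>'" and w: "w \<in> verts \<Gamma>'"
      have ju: "path_labels G \<Delta> K (f u) = f u" "path_labels G \<Delta> K (f w) = f w" using j u w \<Delta>s by simp_all
      have "(\<exists>h\<in>G0. f w = f u #> h) \<longleftrightarrow> (\<exists>h\<in>G0. w = u #> h)"
        using orbits[OF u w] f_mult[OF RG[OF R[OF u]] G0G] unfolding f_def by metis
      then show "path_labels G \<Delta> K (f w) \<in> verts (label_component G X1 (Cayley G X K) (path_labels G \<Delta> K (f u))) \<longleftrightarrow>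
        w \<in> verts (label_component G X1 (Cayley G X S) u)"
        unfolding ju comp_S[OF R[OF u]] comp_K[OF fR[OF R[OF u]]] by blast
    qed
  qed
  then show ?thesis using LabK KL by blast
qed

end

section \<open>Strong separability\<close>

context group
begin

lemma finite_cosets_Int_finite_index:
  assumes K: "subgroup K G" and H: "subgroup H G" and M: "finite_index G M" and MHK: "M \<inter> H \<subseteq> K"
  shows "finite {K #> h | h. h \<in> H}"
proof (rule finite_subset)
  have HG: "h \<in> carrier G" if "h \<in> H" for h using subgroup.mem_carrier[OF H that] .
  have sM: "subgroup M G" using M by (simp add: finite_index_def)
  show "finite ((\<lambda>C. K #> (SOME h. h \<in> C \<inter> H)) ` (rcosets M))"
    using M by (simp add: finite_index_def)
  show "{K #> h | h. h \<in> H} \<subseteq> (\<lambda>C. K #> (SOME h. h \<in> C \<inter> H)) ` (rcosets M)"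
  proof
    fix V assume "V \<in> {K #> h | h. h \<in> H}"
    then obtain h where h: "h \<in> H" "V = K #> h" by blast
    define g where "g = (SOME g. g \<in> (M #> h) \<inter> H)"
    have "h \<in> (M #> h) \<inter> H" using rcos_self[OF HG[OF h(1)] sM] h(1) by blast
    then have g: "g \<in> M #> h" "g \<in> H" using someI[of "\<lambda>g. g \<in> (M #> h) \<inter> H" h] unfolding g_def by blast+
    then obtain m where m: "m \<in> M" "g = m \<otimes> h" by (auto simp: r_coset_def)
    have "m \<in> carrier G" using subgroup.mem_carrier[OF sM m(1)] .
    then have "g \<otimes> inv h = m" using m HG[OF h(1)] by (simp add: m_assoc)
    moreover have "g \<otimes> inv h \<in> H"
      using subgroup.m_closed[OF H g(2) subgroup.m_inv_closed[OF H h(1)]] .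
    ultimately have "g \<otimes> inv h \<in> K" using m(1) MHK by blast
    then have "V = K #> g" using rcos_eq_iff[OF K HG[OF g(2)] HG[OF h(1)]] h by simp
    moreover have "M #> h \<in> rcosets M" using HG[OF h(1)] by (auto simp: RCOSETS_def)
    ultimately show "V \<in> (\<lambda>C. K #> (SOME h. h \<in> C \<inter> H)) ` (rcosets M)" unfolding g_def by blast
  qed
qed

text \<open>The stabiliser of \<open>S a\<close> in \<open>G0\<close> is \<open>a\<^sup>-\<^sup>1 S a \<inter> G0\<close>, an intersection of quasiconvex subgroups.\<close>

lemma stabiliser_fg:
  assumes Y: "finite Y" "Y \<subseteq> carrier G" "generate G Y = carrier G" and lqc: "locally_quasiconvex G Y"
    and S: "fg_subgroup G S" and G0: "fg_subgroup G G0" and w: "w \<in> rcosets S"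
  shows "fg_subgroup G {g \<in> G0. w #> g = w}"
proof -
  obtain a where a: "a \<in> carrier G" "w = S #> a" using w by (auto simp: RCOSETS_def)
  have sS: "subgroup S G" and sG0: "subgroup G0 G" using S G0 by (simp_all add: fg_subgroup_def)
  let ?S = "(\<lambda>s. inv a \<otimes> s \<otimes> a) ` S"
  have fgS: "fg_subgroup G ?S" using fg_subgroup_conjugate[OF S a(1)] .
  have "w #> g = w \<longleftrightarrow> g \<in> ?S" if g: "g \<in> G0" for g
  proof -
    have gG: "g \<in> carrier G" using g subgroup.mem_carrier[OF sG0] by blast
    have "w #> g = w \<longleftrightarrow> S #> (a \<otimes> g) = S #> a"
      unfolding a(2) using a(1) gG subgroup.subset[OF sS] by (simp add: coset_mult_assoc)
    also have "\<dots> \<longleftrightarrow> a \<otimes> g \<otimes> inv a \<in> S" using rcos_eq_iff[OF sS] a(1) gG by simp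
    also have "\<dots> \<longleftrightarrow> g \<in> ?S"
    proof
      assume "a \<otimes> g \<otimes> inv a \<in> S"
      moreover have "g = inv a \<otimes> (a \<otimes> g \<otimes> inv a) \<otimes> a" using a(1) gG by (simp add: group_normalize)
      ultimately show "g \<in> ?S" by blast
    next
      assume "g \<in> ?S"
      then obtain s where s: "s \<in> S" "g = inv a \<otimes> s \<otimes> a" by blast
      then have "a \<otimes> g \<otimes> inv a = s" using a(1) subgroup.mem_carrier[OF sS s(1)] by (simp add: group_normalize)
      then show "a \<otimes> g \<otimes> inv a \<in> S" using s by simp
    qed
    finally show ?thesis .
  qed
  then have "{g \<in> G0. w #> g = w} = ?S \<inter> G0" by blast
  moreover have "fg_subgroup G (?S \<inter> G0)"
    using fg_subgroup_Int[OF Y(2,3,1)] fgS G0 lqc by (simp add: locally_quasiconvex_def fg_subgroup_def)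
  ultimately show ?thesis by simp
qed

end

context malnormal_quasiconvex
begin

text \<open>Here \<open>V\<close> is the set of vertices of \<open>\<Gamma>'\<close>. Those in the base orbit are represented by elements of
  \<open>H\<close>; to keep them apart, \<open>L\<close> also has to avoid the quotients of these representatives, so \<open>N\<close> may have
  to exceed the bound from the combination theorem.\<close>

lemma deep_subgroup_separates_vertices:
  assumes V: "finite V" "V \<subseteq> rcosets S"
  shows "\<exists>N. \<forall>L. subgroup L G \<and> D \<subseteq> L \<and> L \<subseteq> H \<and> (\<forall>l\<in>L - D. N < word_length G Y l) \<longrightarrow>
    generate G (S \<union> L) \<inter> H = L \<and>
    inj_on (\<lambda>u. generate G (S \<union> L) <#> u) V \<and>
    (\<forall>u\<in>V. \<forall>w\<in>V. \<forall>g\<in>H. generate G (S \<union> L) <#> w = generate G (S \<union> L) <#> u #> g \<longrightarrow>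
      (\<exists>h\<in>H. w = u #> h)) \<and>
    (\<forall>u\<in>V. \<forall>g\<in>H. u \<notin> {S #> h | h. h \<in> H} \<longrightarrow>
      generate G (S \<union> L) <#> u #> g = generate G (S \<union> L) <#> u \<longrightarrow> u #> g = u)"
proof -
  have "V \<subseteq> (\<lambda>a. S #> a) ` carrier G" using V(2) by (auto simp: RCOSETS_def)
  then obtain A where A: "A \<subseteq> carrier G" "finite A" "V = (\<lambda>a. S #> a) ` A"
    using finite_subset_image[OF V(1), of "\<lambda>a. S #> a" "carrier G"] by blast
  obtain n where n: "\<forall>L. subgroup L G \<and> D \<subseteq> L \<and> L \<subseteq> H \<and> (\<forall>l\<in>L - D. n < word_length G Y l) \<longrightarrow>
    generate G (S \<union> L) \<inter> H = L \<and>
    (\<forall>k\<in>generate G (S \<union> L) - S. \<forall>a\<in>A. \<forall>b\<in>A. \<forall>h\<in>H. k \<otimes> a = b \<otimes> h \<longrightarrow>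
       (\<exists>s\<in>S. s \<otimes> a \<in> H) \<and> (\<exists>s\<in>S. s \<otimes> b \<in> H))"
    using combination[OF A(2,1)] by (elim exE)
  define c where "c a = (SOME h. h \<in> H \<and> S #> a = S #> h)" for a
  have c: "c a \<in> H \<and> S #> a = S #> c a" if "a \<in> A" "s \<in> S" "s \<otimes> a \<in> H" for a s
  proof -
    have aG: "a \<in> carrier G" using that A(1) by blast
    then have "s \<otimes> a \<otimes> inv a \<in> S" using that(2) by (simp add: m_assoc)
    then have "S #> (s \<otimes> a) = S #> a" using rcos_eq_iff[OF S _ aG] that(2) aG by simp
    then have "\<exists>h. h \<in> H \<and> S #> a = S #> h" using that(3) by (intro exI[of _ "s \<otimes> a"]) simp
    then show ?thesis unfolding c_def by (rule someI_ex)
  qed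
  define N where "N = Max (insert n ((\<lambda>(a, b). word_length G Y (c a \<otimes> inv (c b))) ` (A \<times> A)))"
  have N: "n \<le> N" "\<And>a b. a \<in> A \<Longrightarrow> b \<in> A \<Longrightarrow> word_length G Y (c a \<otimes> inv (c b)) \<le> N"
    unfolding N_def using A(2) by (auto intro!: Max_ge)
  show ?thesis
  proof (intro exI[of _ N] allI impI, elim conjE)
    fix L assume L: "subgroup L G" and DL: "D \<subseteq> L" and LH: "L \<subseteq> H"
      and long: "\<forall>l\<in>L - D. N < word_length G Y l"
    let ?K = "generate G (S \<union> L)"
    have "\<forall>l\<in>L - D. n < word_length G Y l" using long le_less_trans[OF N(1)] by blast
    then have nL: "?K \<inter> H = L \<and> (\<forall>k\<in>?K - S. \<forall>a\<in>A. \<forall>b\<in>A. \<forall>h\<in>H. k \<otimes> a = b \<otimes> h \<longrightarrow>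
       (\<exists>s\<in>S. s \<otimes> a \<in> H) \<and> (\<exists>s\<in>S. s \<otimes> b \<in> H))"
      using n L DL LH by blast
    then have KH: "?K \<inter> H = L" by (rule conjunct1)
    have comb: "(\<exists>s\<in>S. s \<otimes> a \<in> H) \<and> (\<exists>s\<in>S. s \<otimes> b \<in> H)"
      if "k \<in> ?K" "k \<notin> S" "a \<in> A" "b \<in> A" "h \<in> H" "k \<otimes> a = b \<otimes> h" for k a b h
      using conjunct2[OF nL, rule_format, of k a b h] that by simp
    have "S \<union> L \<subseteq> carrier G" using subgroup.subset L by auto
    then have K: "subgroup ?K G" by (rule generate_is_subgroup)
    have SK: "S \<subseteq> ?K" by (auto intro: generate.incl)
    have KG: "k \<in> carrier G" if "k \<in> ?K" for k using subgroup.mem_carrier[OF K that] .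
    have AG: "a \<in> carrier G" if "a \<in> A" for a using that A(1) by blast
    have coset: "?K <#> (S #> a) = ?K #> a" if "a \<in> A" for a
      using subgroup_absorb_left[OF K S SK AG[OF that]] .
    \<comment> \<open>An identification in \<open>Cayley G X K\<close> comes from some \<open>k \<in> K\<close>; if \<open>k \<notin> S\<close>, the vertices are in the
      base orbit.\<close>
    have key: "S #> b = S #> a #> g \<or> (\<exists>s\<in>S. s \<otimes> a \<in> H) \<and> (\<exists>s\<in>S. s \<otimes> b \<in> H)"
      if ab: "a \<in> A" "b \<in> A" and g: "g \<in> H" and eq: "?K #> b = ?K #> a #> g" for a b g
    proof -
      have G: "a \<in> carrier G" "b \<in> carrier G" "g \<in> carrier G" using AG ab g by auto
      have "?K #> b = ?K #> (a \<otimes> g)" using eq G subgroup.subset[OF K] by (simp add: coset_mult_assoc)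
      then have k: "b \<otimes> inv (a \<otimes> g) \<in> ?K" using rcos_eq_iff[OF K] G by simp
      show ?thesis
      proof (cases "b \<otimes> inv (a \<otimes> g) \<in> S")
        case True
        then have "S #> b = S #> (a \<otimes> g)" using rcos_eq_iff[OF S] G by simp
        then show ?thesis using G subgroup.subset[OF S] by (simp add: coset_mult_assoc)
      next
        case False
        have "b \<otimes> inv (a \<otimes> g) \<otimes> a = b \<otimes> inv g" using G by (simp add: group_normalize)
        then show ?thesis using comb[OF k False ab inv_H[OF g]] by blast
      qed
    qed
    have "inj_on (\<lambda>u. ?K <#> u) V"
    proof (rule inj_onI)
      fix u w assume "u \<in> V" "w \<in> V" and eq: "?K <#> u = ?K <#> w"
      then obtain a b where ab: "a \<in> A" "u = S #> a" "b \<in> A" "w = S #> b" using A(3) by blast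
      have Kab: "?K #> a = ?K #> b" using eq ab coset by simp
      then have "?K #> b = ?K #> a #> \<one>" using subgroup.subset[OF K] AG ab by (simp add: coset_mult_assoc)
      from key[OF ab(1,3) one_H this] show "u = w"
      proof
        assume "S #> b = S #> a #> \<one>"
        then show ?thesis using ab AG subgroup.subset[OF S] by (simp add: coset_mult_assoc)
      next
        assume "(\<exists>s\<in>S. s \<otimes> a \<in> H) \<and> (\<exists>s\<in>S. s \<otimes> b \<in> H)"
        then have ca: "c a \<in> H" "S #> a = S #> c a" and cb: "c b \<in> H" "S #> b = S #> c b"
          using c ab by blast+
        have "?K <#> (S #> c a) = ?K <#> (S #> c b)" using eq ab ca cb by simp
        then have "?K #> c a = ?K #> c b"
          using subgroup_absorb_left[OF K S SK] ca cb by simp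
        then have "c a \<otimes> inv (c b) \<in> L"
          using rcos_eq_iff[OF K, of "c a" "c b"] ca(1) cb(1) KH mult_H[OF ca(1) inv_H[OF cb(1)]] by auto
        then have "c a \<otimes> inv (c b) \<in> S"
          using bspec[OF long, of "c a \<otimes> inv (c b)"] N(2)[OF ab(1,3)] by auto
        then have "S #> c a = S #> c b" using rcos_eq_iff[OF S] ca cb by simp
        then show ?thesis using ab ca cb by simp
      qed
    qed
    moreover have "\<exists>h\<in>H. w = u #> h"
      if uw: "u \<in> V" "w \<in> V" and g: "g \<in> H" and eq: "?K <#> w = ?K <#> u #> g" for u w g
    proof -
      obtain a b where ab: "a \<in> A" "u = S #> a" "b \<in> A" "w = S #> b" using uw A(3) by blast
      have "?K #> b = ?K #> a #> g" using eq ab coset by simp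
      from key[OF ab(1,3) g this] show ?thesis
      proof
        assume "(\<exists>s\<in>S. s \<otimes> a \<in> H) \<and> (\<exists>s\<in>S. s \<otimes> b \<in> H)"
        then have ca: "c a \<in> H" "S #> a = S #> c a" and cb: "c b \<in> H" "S #> b = S #> c b"
          using c ab by blast+
        have "u #> (inv (c a) \<otimes> c b) = w"
          using ca cb ab subgroup.subset[OF S] by (simp add: coset_mult_assoc group_normalize)
        then show ?thesis using mult_H[OF inv_H[OF ca(1)] cb(1)] by blast
      qed (use ab g in blast)
    qed
    moreover have "u #> g = u"
      if u: "u \<in> V" "u \<notin> {S #> h | h. h \<in> H}" and g: "g \<in> H" and eq: "?K <#> u #> g = ?K <#> u" for u g
    proof -
      obtain a where a: "a \<in> A" "u = S #> a" using u A(3) by blast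
      have "?K #> a = ?K #> a #> g" using eq a coset by simp
      from key[OF a(1,1) g this] show ?thesis
      proof
        assume "(\<exists>s\<in>S. s \<otimes> a \<in> H) \<and> (\<exists>s\<in>S. s \<otimes> a \<in> H)"
        then have "c a \<in> H \<and> S #> a = S #> c a" using c a by blast
        then show ?thesis using u a by blast
      qed (use a in simp)
    qed
    ultimately show "?K \<inter> H = L \<and> inj_on (\<lambda>u. ?K <#> u) V \<and>
      (\<forall>u\<in>V. \<forall>w\<in>V. \<forall>g\<in>H. ?K <#> w = ?K <#> u #> g \<longrightarrow> (\<exists>h\<in>H. w = u #> h)) \<and>
      (\<forall>u\<in>V. \<forall>g\<in>H. u \<notin> {S #> h | h. h \<in> H} \<longrightarrow> ?K <#> u #> g = ?K <#> u \<longrightarrow> u #> g = u)"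
      using KH by blast
  qed
qed

end

context group
begin

lemma malnormal_quasiconvexI:
  assumes Y: "finite Y" "Y \<subseteq> carrier G" "generate G Y = carrier G"
    and nc: "negatively_curved G Y" and lqc: "locally_quasiconvex G Y"
    and S: "fg_subgroup G S" and G0: "fg_subgroup G G0" and mal: "malnormal G G0"
  shows "\<exists>\<delta> K KS. malnormal_quasiconvex G Y \<delta> G0 S K KS"
proof -
  have sub: "subgroup S G" "subgroup G0 G" using S G0 by (simp_all add: fg_subgroup_def)
  obtain \<delta> where \<delta>: "slim_space (carrier G) (word_dist G Y) \<delta>"
    using negatively_curved_slim[OF Y(2,3) nc] by blast
  interpret sp: slim_space "carrier G" "word_dist G Y" \<delta> by (rule \<delta>)
  have qc: "\<exists>K. sp.qconvex K P" if P: "fg_subgroup G P" for P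
  proof -
    have PG: "P \<subseteq> carrier G" using P subgroup.subset by (auto simp: fg_subgroup_def)
    have "quasiconvex G Y P" using lqc P by (simp add: locally_quasiconvex_def)
    from quasiconvex_word_dist[OF Y(2,3) this PG] show ?thesis
      using PG unfolding sp.qconvex_def sp.between_def by blast
  qed
  obtain K KS where "sp.qconvex K G0" "sp.qconvex KS S" using qc S G0 by blast
  then have "malnormal_quasiconvex G Y \<delta> G0 S K KS"
    using sub mal Y sp.slim_space_axioms group_axioms
    by (intro malnormal_quasiconvex.intro malnormal_quasiconvex_axioms.intro) auto
  then show ?thesis by blast
qed

text \<open>The bound \<open>N\<close> depends on \<open>\<Gamma>\<close> only, and \<open>M\<close> is arbitrary above it: this makes it possible to use
  the same \<open>M\<close> for two graphs, and thus to give them the same intersection with \<open>G0\<close>.\<close>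

lemma separating_extension_exists:
  assumes Y: "finite Y" "Y \<subseteq> carrier G" "generate G Y = carrier G"
    and nc: "negatively_curved G Y" and lqc: "locally_quasiconvex G Y"
    and G0: "fg_subgroup G G0" and mal: "malnormal G G0"
    and X: "X \<subseteq> carrier G" "generate G X = carrier G" and X1: "X1 \<subseteq> X" "finite X1" "generate G X1 = G0"
    and \<Gamma>: "finite_cover_subgraph G X \<Gamma> v" and S: "Lab G \<Gamma> v = S" "fg_subgroup G S"
  shows "\<exists>N. \<forall>M. finite_index G M \<and> S \<inter> G0 \<subseteq> M \<and> (\<forall>l\<in>(M \<inter> G0) - S. N < word_length G Y l) \<longrightarrow>
    (\<exists>\<Gamma>' \<Delta> d f. separating_extension G G0 X1 X \<Gamma> v \<Gamma>' \<Delta> d f \<and> Lab G \<Delta> d \<inter> G0 = M \<inter> G0)"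
proof -
  obtain \<delta> K KS where "malnormal_quasiconvex G Y \<delta> G0 S K KS"
    using malnormal_quasiconvexI[OF Y nc lqc S(2) G0 mal] by blast
  then interpret mq: malnormal_quasiconvex G Y \<delta> G0 S K KS .
  obtain T where T: "subgroup T G" and fin: "finite_lsubgraph G \<Gamma> (Cayley G X T)" and v: "v \<in> verts \<Gamma>"
    using \<Gamma> by (auto simp: finite_cover_subgraph_def)
  have l\<Gamma>: "lsubgraph G \<Gamma> (Cayley G X T)" using fin by (simp add: finite_lsubgraph_def)
  let ?\<phi> = "path_labels G \<Gamma> v"
  let ?\<Gamma>0 = "map_lgraph ?\<phi> \<Gamma>"
  have emb: "?\<phi> ` verts \<Gamma> \<subseteq> rcosets S" "map_edge ?\<phi> ` arcs \<Gamma> \<subseteq> arcs (Cayley G X S)"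
    using path_labels_embedding(1)[OF T X(1) l\<Gamma> v] S(1)
    by (simp_all add: lgraph_embedding_def tilde_def Cayley_verts)
  have l0: "lsubgraph G ?\<Gamma>0 (Cayley G X S)"
    unfolding map_lgraph_def
  proof (rule lsubgraph_mk_lgraph[OF mq.S X(1) emb])
    show "?\<phi> v \<in> ?\<phi> ` verts \<Gamma>" using v by blast
    fix U x W assume "(U, x, W) \<in> map_edge ?\<phi> ` arcs \<Gamma>"
    then obtain u w where uw: "(u, x, w) \<in> arcs \<Gamma>" "U = ?\<phi> u" "W = ?\<phi> w" by (auto simp: map_edge_def)
    note a = lsubgraph_arcD[OF T X(1) l\<Gamma> uw(1)]
    have "(W, inv x, U) \<in> map_edge ?\<phi> ` arcs \<Gamma>"
      using a(5) uw by (intro image_eqI[of _ _ "(w, inv x, u)"]) (auto simp: map_edge_def)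
    then show "U \<in> ?\<phi> ` verts \<Gamma> \<and> W \<in> ?\<phi> ` verts \<Gamma> \<and> (W, inv x, U) \<in> map_edge ?\<phi> ` arcs \<Gamma>"
      using a(6,7) uw by simp
  next
    fix U assume "U \<in> ?\<phi> ` verts \<Gamma>"
    then obtain u where u: "u \<in> verts \<Gamma>" "U = ?\<phi> u" by blast
    show "(?\<phi> v, U) \<in> {(V, W). \<exists>x. (V, x, W) \<in> map_edge ?\<phi> ` arcs \<Gamma>}\<^sup>*"
      unfolding u(2) by (rule map_edges_rtrancl[OF lsubgraph_connected[OF T X(1) l\<Gamma> v u(1)] subset_refl])
  qed
  have fin0: "finite_lsubgraph G ?\<Gamma>0 (Cayley G X S)"
    using l0 fin by (simp add: finite_lsubgraph_def map_lgraph_def)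
  have "fg_subgroup G {g \<in> G0. w #> g = w}" if "w \<in> verts ?\<Gamma>0" for w
    using stabiliser_fg[OF Y lqc S(2) G0] lsubgraph_verts[OF mq.S X(1) l0] that by blast
  then obtain \<Gamma>' where \<Gamma>': "finite_lsubgraph G \<Gamma>' (Cayley G X S)" "subgraph ?\<Gamma>0 \<Gamma>'"
      "property4 G G0 X1 \<Gamma>' (Cayley G X S)" "property5 G G0 X1 \<Gamma>' (Cayley G X S)"
      "property7 G G0 X1 \<Gamma>' (Cayley G X S)"
    using orbit_neighbourhood[OF mq.S X X1 fin0] by blast
  have V: "finite (verts \<Gamma>')" "verts \<Gamma>' \<subseteq> rcosets S"
    using \<Gamma>'(1) lsubgraph_verts[OF mq.S X(1)] by (auto simp: finite_lsubgraph_def)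
  obtain N where N: "\<forall>L. subgroup L G \<and> S \<inter> G0 \<subseteq> L \<and> L \<subseteq> G0 \<and>
      (\<forall>l\<in>L - S \<inter> G0. N < word_length G Y l) \<longrightarrow>
    generate G (S \<union> L) \<inter> G0 = L \<and>
    inj_on (\<lambda>u. generate G (S \<union> L) <#> u) (verts \<Gamma>') \<and>
    (\<forall>u\<in>verts \<Gamma>'. \<forall>w\<in>verts \<Gamma>'. \<forall>g\<in>G0.
      generate G (S \<union> L) <#> w = generate G (S \<union> L) <#> u #> g \<longrightarrow> (\<exists>h\<in>G0. w = u #> h)) \<and>
    (\<forall>u\<in>verts \<Gamma>'. \<forall>g\<in>G0. u \<notin> {S #> h | h. h \<in> G0} \<longrightarrow>
      generate G (S \<union> L) <#> u #> g = generate G (S \<union> L) <#> u \<longrightarrow> u #> g = u)"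
    using mq.deep_subgroup_separates_vertices[OF V] by (elim exE)
  show ?thesis
  proof (intro exI[of _ N] allI impI, elim conjE)
    fix M assume M: "finite_index G M" and SM: "S \<inter> G0 \<subseteq> M"
      and long: "\<forall>l\<in>(M \<inter> G0) - S. N < word_length G Y l"
    have sM: "subgroup M G" using M by (simp add: finite_index_def)
    define L where "L = M \<inter> G0"
    have L: "subgroup L G" unfolding L_def using subgroups_Inter_pair[OF sM mq.H] .
    define K' where "K' = generate G (S \<union> L)"
    have "S \<union> L \<subseteq> carrier G" using subgroup.subset[OF L] subgroup.subset[OF mq.S] by blast
    then have K': "subgroup K' G" unfolding K'_def by (rule generate_is_subgroup)
    have LK': "M \<inter> G0 \<subseteq> K'" unfolding K'_def L_def by (auto intro: generate.incl)
    have "S \<inter> G0 \<subseteq> L" "L \<subseteq> G0" "\<forall>l\<in>L - S \<inter> G0. N < word_length G Y l"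
      using SM long by (auto simp: L_def)
    then have *: "K' \<inter> G0 = L" "inj_on (\<lambda>u. K' <#> u) (verts \<Gamma>')"
      "\<forall>u\<in>verts \<Gamma>'. \<forall>w\<in>verts \<Gamma>'. \<forall>g\<in>G0. K' <#> w = K' <#> u #> g \<longrightarrow> (\<exists>h\<in>G0. w = u #> h)"
      "\<forall>u\<in>verts \<Gamma>'. \<forall>g\<in>G0. u \<notin> {S #> h | h. h \<in> G0} \<longrightarrow> K' <#> u #> g = K' <#> u \<longrightarrow> u #> g = u"
      using N[rule_format, of L] L unfolding K'_def by simp_all
    have "\<exists>\<Delta> d f. separating_extension G G0 X1 X \<Gamma> v \<Gamma>' \<Delta> d f \<and> Lab G \<Delta> d \<inter> G0 = L"
      by (rule separating_extension_quotient[OF X X1 T l\<Gamma> v S(1) \<Gamma>' L K'_def[symmetric] *(1)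
            finite_cosets_Int_finite_index[OF K' mq.H M LK'] *(2)])
        (use *(3,4) in blast)+
    then show "\<exists>\<Gamma>' \<Delta> d f. separating_extension G G0 X1 X \<Gamma> v \<Gamma>' \<Delta> d f \<and> Lab G \<Delta> d \<inter> G0 = M \<inter> G0"
      unfolding L_def by blast
  qed
qed

end

theorem theorem5p4:
  fixes G :: "('a, 'm) monoid_scheme" and Y G0 :: "'a set"
  assumes "group G"
    and "finite Y" and "Y \<subseteq> carrier G" and "generate G Y = carrier G"
    and "negatively_curved G Y"
    and "locally_quasiconvex G Y"
    and "LERF G"
    and "fg_subgroup G G0"
    and "malnormal G G0"
  shows "strongly_separable G G0"
proof -
  interpret group G by (rule assms(1))
  note Y = assms(2-4) and nc = assms(5) and lqc = assms(6) and lerf = assms(7)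
    and G0 = assms(8) and mal = assms(9)
  show ?thesis
    unfolding strongly_separable_def strongly_separable_wrt_def
  proof (intro conjI allI impI G0; elim conjE)
    fix X1 X S1 S2 \<Gamma>1 v1 \<Gamma>2 v2
    assume X1: "finite X1" "X1 \<subseteq> X" "generate G X1 = G0" and X: "X \<subseteq> carrier G" "generate G X = carrier G"
      and S: "fg_subgroup G S1" "fg_subgroup G S2" and D: "S1 \<inter> G0 = S2 \<inter> G0"
      and \<Gamma>1: "finite_cover_subgraph G X \<Gamma>1 v1" "Lab G \<Gamma>1 v1 = S1"
      and \<Gamma>2: "finite_cover_subgraph G X \<Gamma>2 v2" "Lab G \<Gamma>2 v2 = S2"
    have sub: "subgroup S1 G" "subgroup G0 G" using S G0 by (simp_all add: fg_subgroup_def)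
    have fgD: "fg_subgroup G (S1 \<inter> G0)"
      using fg_subgroup_Int[OF Y(2,3,1)] S(1) G0 lqc by (simp add: locally_quasiconvex_def fg_subgroup_def)
    then have Ds: "subgroup (S1 \<inter> G0) G" and Dc: "closedin (profinite_topology G) (S1 \<inter> G0)"
      using lerf by (auto simp: LERF_def fg_subgroup_def)
    obtain N1 where N1: "\<forall>M. finite_index G M \<and> S1 \<inter> G0 \<subseteq> M \<and>
        (\<forall>l\<in>(M \<inter> G0) - S1. N1 < word_length G Y l) \<longrightarrow>
        (\<exists>\<Gamma>' \<Delta> d f. separating_extension G G0 X1 X \<Gamma>1 v1 \<Gamma>' \<Delta> d f \<and> Lab G \<Delta> d \<inter> G0 = M \<inter> G0)"
      using separating_extension_exists[OF Y nc lqc G0 mal X X1(2,1,3) \<Gamma>1 S(1)] by (elim exE)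
    obtain N2 where N2: "\<forall>M. finite_index G M \<and> S2 \<inter> G0 \<subseteq> M \<and>
        (\<forall>l\<in>(M \<inter> G0) - S2. N2 < word_length G Y l) \<longrightarrow>
        (\<exists>\<Gamma>' \<Delta> d f. separating_extension G G0 X1 X \<Gamma>2 v2 \<Gamma>' \<Delta> d f \<and> Lab G \<Delta> d \<inter> G0 = M \<inter> G0)"
      using separating_extension_exists[OF Y nc lqc G0 mal X X1(2,1,3) \<Gamma>2 S(2)] by (elim exE)
    define F where "F = word_ball G Y (max N1 N2) \<inter> G0 - S1"
    have F: "finite F" "F \<subseteq> carrier G - (S1 \<inter> G0)"
      using finite_word_ball[OF Y(1)] subgroup.subset[OF sub(2)] by (auto simp: F_def)
    obtain M where M: "finite_index G M" "S1 \<inter> G0 \<subseteq> M" "M \<inter> F = {}"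
      using closed_subgroup_separated_finite[OF Ds Dc F] by (elim exE conjE)
    have long: "max N1 N2 < word_length G Y l" if "l \<in> (M \<inter> G0) - S1" for l
    proof -
      have "l \<notin> word_ball G Y (max N1 N2)" using that M(3) by (auto simp: F_def)
      then show ?thesis
        using word_length_le_iff[OF Y(2,3), of l "max N1 N2"] that subgroup.mem_carrier[OF sub(2)] by auto
    qed
    have "(M \<inter> G0) - S2 = (M \<inter> G0) - S1" using D by blast
    then have long2: "\<forall>l\<in>(M \<inter> G0) - S2. N2 < word_length G Y l" using long by auto
    have long1: "\<forall>l\<in>(M \<inter> G0) - S1. N1 < word_length G Y l" using long by auto
    have 1: "\<exists>\<Gamma>' \<Delta> d f. separating_extension G G0 X1 X \<Gamma>1 v1 \<Gamma>' \<Delta> d f \<and> Lab G \<Delta> d \<inter> G0 = M \<inter> G0"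
      using N1 M(1,2) long1 by blast
    have 2: "\<exists>\<Gamma>' \<Delta> d f. separating_extension G G0 X1 X \<Gamma>2 v2 \<Gamma>' \<Delta> d f \<and> Lab G \<Delta> d \<inter> G0 = M \<inter> G0"
      using N2 M(1,2) long2 D by blast
    show "\<exists>\<Gamma>1' \<Delta>1 d1 f1 \<Gamma>2' \<Delta>2 d2 f2.
       separating_extension G G0 X1 X \<Gamma>1 v1 \<Gamma>1' \<Delta>1 d1 f1 \<and>
       separating_extension G G0 X1 X \<Gamma>2 v2 \<Gamma>2' \<Delta>2 d2 f2 \<and>
       Lab G \<Delta>1 d1 \<inter> G0 = Lab G \<Delta>2 d2 \<inter> G0"
      using 1 2 by metis
  qed
qed

end
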